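(* If $G$ is a subcubic outerplanar graph, then $\chi_p(D(G))\le 5$. Moreover, if $H$ is a $2$-connected subcubic outerplanar graph, then $\chi_p(D(H))\le 4$.
   Context: A graph is subcubic if its maximum degree is at most $3$. The subdivision $D(G)$ of a graph $G$ is the graph obtained from $G$ by replacing each edge by a path of length two. For a non-decreasing sequence $S=(s_1,\dots,s_k)$ of positive integers, a packing $S$-coloring of a graph $G$ is a partition of $V(G)$ into sets $V_1,\dots,V_k$ (some possibly empty) such that, for each $1\le i\le k$, the distance in $G$ between any two distinct vertices $x,y\in V_i$ is at least $s_i+1$. The packing chromatic number $\chi_p(G)$ is the minimum $k$ such that $G$ has a packing $(1,2,\dots,k)$-coloring. *)

theory Defs
  imports "HOL-Analysis.Analysis" "Graph_Theory.Graph_Theory"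
begin

text \<open>
  A finite simple undirected graph is a \<^locale>\<open>pair_graph\<close>: an undirected edge between
  \<open>u\<close> and \<open>v\<close> is the pair of arcs \<open>(u, v)\<close>, \<open>(v, u)\<close>.  Hence the degree of a vertex is its
  out-degree.
\<close>

definition edges :: "'a pair_pre_digraph \<Rightarrow> 'a set set" where
  "edges G = {{u, v} |u v. (u, v) \<in> parcs G}"

definition subcubic :: "'a pair_pre_digraph \<Rightarrow> bool" where
  "subcubic G \<longleftrightarrow> (\<forall>v \<in> pverts G. out_degree (with_proj G) v \<le> 3)"

definition subdivision_graph :: "'a pair_pre_digraph \<Rightarrow> ('a + 'a set) pair_pre_digraph" where
  "subdivision_graph G =
     \<lparr> pverts = Inl ` pverts G \<union> Inr ` edges G,
       parcs = {(Inl v, Inr e) |v e. e \<in> edges G \<and> v \<in> e} \<union>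
               {(Inr e, Inl v) |v e. e \<in> edges G \<and> v \<in> e} \<rparr>"

text \<open>The distance is infinite if the vertices lie in different components.\<close>

definition graph_dist :: "'a pair_pre_digraph \<Rightarrow> 'a \<Rightarrow> 'a \<Rightarrow> ereal" where
  "graph_dist G u v = wf_digraph.\<mu> (with_proj G) (\<lambda>_. 1) u v"

text \<open>The sequence \<open>s\<^sub>1, \<dots>, s\<^sub>k\<close> is the list \<open>S\<close>, so indices are shifted to start at 0.\<close>

definition packing_coloring :: "nat list \<Rightarrow> 'a pair_pre_digraph \<Rightarrow> (nat \<Rightarrow> 'a set) \<Rightarrow> bool" where
  "packing_coloring S G V \<longleftrightarrow>
     (\<Union>i<length S. V i) = pverts G \<and>
     disjoint_family_on V {..<length S} \<and>
     (\<forall>i<length S. \<forall>x \<in> V i. \<forall>y \<in> V i. x \<noteq> y \<longrightarrow> graph_dist G x y \<ge> ereal (real (S ! i + 1)))"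

definition packing_chromatic_number :: "'a pair_pre_digraph \<Rightarrow> nat" where
  "packing_chromatic_number G = (LEAST k. \<exists>V. packing_coloring [1..<k + 1] G V)"

text \<open>
  A \<open>k\<close>-connected graph has more than \<open>k\<close> vertices and cannot be disconnected by deleting fewer than \<open>k\<close> of
  them; in particular, a 2-connected graph has at least three vertices.
\<close>

definition k_connected :: "nat \<Rightarrow> 'a pair_pre_digraph \<Rightarrow> bool" where
  "k_connected k G \<longleftrightarrow>
     k < card (pverts G) \<and>
     (\<forall>X \<subseteq> pverts G. card X < k \<longrightarrow>
        Digraph_Component.connected (with_proj G \<restriction> (pverts G - X)))"

text \<open>
  A drawing without crossings: \<open>p\<close> places the vertices in the plane and \<open>\<gamma> e\<close> is a simple
  curve representing the edge \<open>e\<close>.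
\<close>

definition plane_drawing ::
    "'a pair_pre_digraph \<Rightarrow> ('a \<Rightarrow> complex) \<Rightarrow> ('a set \<Rightarrow> real \<Rightarrow> complex) \<Rightarrow> bool" where
  "plane_drawing G p \<gamma> \<longleftrightarrow>
     inj_on p (pverts G) \<and>
     (\<forall>e \<in> edges G.
        Path_Connected.arc (\<gamma> e) \<and>
        {pathstart (\<gamma> e), pathfinish (\<gamma> e)} = p ` e \<and>
        path_image (\<gamma> e) \<inter> p ` pverts G = p ` e) \<and>
     (\<forall>e \<in> edges G. \<forall>f \<in> edges G.
        e \<noteq> f \<longrightarrow> path_image (\<gamma> e) \<inter> path_image (\<gamma> f) \<subseteq> p ` (e \<inter> f))"

definition drawing_image ::
    "'a pair_pre_digraph \<Rightarrow> ('a \<Rightarrow> complex) \<Rightarrow> ('a set \<Rightarrow> real \<Rightarrow> complex) \<Rightarrow> complex set" where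
  "drawing_image G p \<gamma> = p ` pverts G \<union> (\<Union>e \<in> edges G. path_image (\<gamma> e))"

text \<open>
  The image of a drawing of a finite graph is compact, so \<^const>\<open>outside\<close> yields the unique
  unbounded (outer) face; all vertices are required to lie on its boundary.
\<close>

definition outerplanar :: "'a pair_pre_digraph \<Rightarrow> bool" where
  "outerplanar G \<longleftrightarrow>
     (\<exists>p \<gamma>. plane_drawing G p \<gamma> \<and>
        (\<forall>v \<in> pverts G. p v \<in> frontier (outside (drawing_image G p \<gamma>))))"

end

theory Submission
  imports Defs
begin

text \<open>
  Give colour 1 of the packing colouring to all subdivision vertices. Since distances between original
  vertices double in the subdivision, it remains to colour \<open>G\<close> itself with two independent sets and two
  sets (for 2-connected graphs: one set) of vertices that have pairwise distance at least 3.

  If all vertices lie on the boundary of the outer face, then Janiszewski's theorem and the Jordan curve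
  theorem exclude three internally disjoint paths with inner vertices between two vertices, and also two
  crossing chords of a cycle. Hence a connected bridgeless graph on more than one vertex has a
  Hamiltonian cycle with noncrossing chords, which form a matching as the graph is subcubic. It is
  coloured face by face along the tree of inner faces: the boundary of a face is coloured
  alternately except for at most one vertex of a special colour that corrects the parity. With one special
  colour, one has to choose this vertex carefully, and the induction needs that every piece behind
  a chord either tolerates the special colour at each end of the chord, or tolerates it at the
  neighbours of the ends in front of the chord. With two special colours, one can alternate between them,
  and there is enough freedom to glue the colourings along bridges.
\<close>

text \<open>The constants come from the doubling: in the subdivision, nonadjacent original vertices
  have distance at least 4, enough for packing colours 2 and 3, and vertices of distance at least 3
  in \<open>G\<close> get distance at least 6, enough for packing colours 4 and 5. The obstacle is
  parity. A triangle beyond an edge \<open>uv\<close> whose ends carry the two ordinary colours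
  forces a special colour on its tip, so special vertices of neighbouring faces can come too close.
  With one special colour there are pieces that do not bear it on an end of their chord, and pieces
  that do not bear it on an outer neighbour of an end; what saves the induction is that no piece
  fails in both ways. Planarity serves only to derive two forbidden configurations. They are stated
  for walks and cycles of a neighbourhood function, so they pass to subgraphs without redrawing
  anything, as the induction along bridges requires.\<close>

abbreviation walk :: "('a \<Rightarrow> 'a set) \<Rightarrow> 'a list \<Rightarrow> bool" where
  "walk N \<equiv> successively (\<lambda>x y. y \<in> N x)"

text \<open>From here on a graph is mostly given by its neighbourhood function \<open>N\<close>. The lists in
  \<open>theta_free\<close> are the inner vertices of three paths from \<open>a\<close> to \<open>b\<close>: what is excluded are the
  subdivisions of \<open>K\<^bsub>2,3\<^esub>\<close>.\<close>

definition theta_free :: "('a \<Rightarrow> 'a set) \<Rightarrow> bool" where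
  "theta_free N \<longleftrightarrow> (\<nexists>a b xs ys zs. xs \<noteq> [] \<and> ys \<noteq> [] \<and> zs \<noteq> [] \<and> distinct (a # b # xs @ ys @ zs) \<and>
     (\<forall>ps \<in> {xs, ys, zs}. walk N (a # ps @ [b])))"

definition cycle :: "('a \<Rightarrow> 'a set) \<Rightarrow> 'a list \<Rightarrow> bool" where
  "cycle N cs \<longleftrightarrow> distinct cs \<and> 3 \<le> length cs \<and>
     (\<forall>i<length cs. cs ! (Suc i mod length cs) \<in> N (cs ! i))"

text \<open>Two crossing chords form, together with the cycle, a subdivision of \<open>K_4\<close>
  in which two disjoint edges stay undivided.\<close>

definition chords_noncrossing :: "('a \<Rightarrow> 'a set) \<Rightarrow> bool" where
  "chords_noncrossing N \<longleftrightarrow> (\<forall>cs i x j y. cycle N cs \<and> i < x \<and> x < j \<and> j < y \<and> y < length cs \<longrightarrow>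
     \<not> (cs ! j \<in> N (cs ! i) \<and> cs ! y \<in> N (cs ! x)))"

definition nbrs :: "'a pair_pre_digraph \<Rightarrow> 'a \<Rightarrow> 'a set" where
  "nbrs G w = {y. (w, y) \<in> parcs G}"

section \<open>Theta curves in the plane\<close>

text \<open>Joining \<open>c1\<close> to the reversal of \<open>c2\<close> gives a simple closed
  path. The Jordan curve theorem is restated for the union of the two images so that the three
  cycles of a theta curve can be treated alike.\<close>

lemma Jordan_arc_pair:
  fixes c1 c2 :: "real \<Rightarrow> complex"
  assumes "arc c1" "arc c2"
    and "pathstart c1 = a" "pathfinish c1 = b" "pathstart c2 = a" "pathfinish c2 = b"
    and "path_image c1 \<inter> path_image c2 = {a, b}"
  defines "C \<equiv> path_image c1 \<union> path_image c2"
  shows "inside C \<noteq> {}" "open (inside C)" "Topological_Spaces.connected (inside C)"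
    "Topological_Spaces.connected (outside C)" "open (outside C)" "inside C \<inter> outside C = {}"
    "inside C \<union> outside C = - C" "frontier (inside C) = C" "frontier (outside C) = C"
    "compact C"
proof -
  let ?c = "c1 +++ reversepath c2"
  have s: "simple_path ?c"
    using assms by (intro simple_path_join_loop) (auto simp: arc_reversepath)
  have l: "pathfinish ?c = pathstart ?c"
    using assms by simp
  have i: "path_image ?c = C"
    using assms by (simp add: path_image_join)
  show "inside C \<noteq> {}" "open (inside C)" "Topological_Spaces.connected (inside C)"
    "Topological_Spaces.connected (outside C)" "open (outside C)" "inside C \<inter> outside C = {}"
    "inside C \<union> outside C = - C" "frontier (inside C) = C" "frontier (outside C) = C"
    using Jordan_inside_outside[OF s l] unfolding i by auto
  show "compact C"
    using assms unfolding C_def by (simp add: compact_Un compact_arc_image)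
qed

lemma connected_arc_interior:
  fixes c :: "real \<Rightarrow> complex"
  assumes "arc c" "pathstart c = a" "pathfinish c = b"
  shows "Topological_Spaces.connected (path_image c - {a, b})"
  using connected_simple_path_endless[OF arc_imp_simple_path[OF assms(1)]] assms by simp

text \<open>Enlarging a set shrinks its outside, and the closure of \<open>outside C\<close> adds
  only points of \<open>C\<close>. Hence an exposed vertex of a drawing, that is, one on the
  frontier of the outer face, lies outside every cycle that does not pass through it.\<close>

lemma frontier_outside_mono:
  fixes C M :: "complex set"
  assumes "C \<subseteq> M" "compact C" "q \<in> frontier (outside M)" "q \<notin> C"
  shows "q \<in> outside C"
proof -
  have "q \<in> closure (outside C)"
    using assms(3) closure_mono[OF outside_mono[OF assms(1)]] by (auto simp: frontier_def)
  moreover have "closure (outside C) \<subseteq> C \<union> outside C"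
    by (metis assms(2) closure_outside_subset compact_imp_closed)
  ultimately show ?thesis
    using assms(4) by auto
qed

text \<open>\<open>inside C\<close> and \<open>outside C\<close> are open and cover the complement
  of \<open>C\<close>, so a connected set off \<open>C\<close> cannot meet both.\<close>

lemma arc_interior_side:
  fixes c c1 c2 :: "real \<Rightarrow> complex"
  assumes J: "arc c1" "arc c2" "pathstart c1 = a" "pathfinish c1 = b" "pathstart c2 = a" "pathfinish c2 = b"
    "path_image c1 \<inter> path_image c2 = {a, b}"
    and S: "Topological_Spaces.connected S" "S \<inter> (path_image c1 \<union> path_image c2) = {}"
  defines "C \<equiv> path_image c1 \<union> path_image c2"
  shows "S \<subseteq> inside C \<or> S \<subseteq> outside C"
proof (rule ccontr)
  note J' = Jordan_arc_pair[OF J, folded C_def]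
  assume "\<not> ?thesis"
  then show False
    using connectedD[OF S(1) J'(2) J'(5)] J'(6,7) S(2) unfolding C_def by blast
qed

text \<open>Each of the three cycles has an inside that misses the third arc, so these insides are
  components of the complement of the whole theta curve. A point inside the cycle through
  \<open>c2\<close> and \<open>c3\<close> is therefore outside the other two cycles, and Janiszewski's theorem, applied to
  these two cycles with common part \<open>c1\<close>, connects it to infinity off the theta curve.\<close>

lemma theta_not_all_outside:
  fixes c1 c2 c3 :: "real \<Rightarrow> complex"
  assumes A: "arc c1" "arc c2" "arc c3"
    and "pathstart c1 = a" "pathfinish c1 = b" "pathstart c2 = a" "pathfinish c2 = b"
      "pathstart c3 = a" "pathfinish c3 = b"
    and I12: "path_image c1 \<inter> path_image c2 = {a, b}"
    and I13: "path_image c1 \<inter> path_image c3 = {a, b}"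
    and I23: "path_image c2 \<inter> path_image c3 = {a, b}"
    and O1: "path_image c1 - {a, b} \<subseteq> outside (path_image c2 \<union> path_image c3)"
    and O2: "path_image c2 - {a, b} \<subseteq> outside (path_image c1 \<union> path_image c3)"
    and O3: "path_image c3 - {a, b} \<subseteq> outside (path_image c1 \<union> path_image c2)"
  shows False
proof -
  let ?p1 = "path_image c1" and ?p2 = "path_image c2" and ?p3 = "path_image c3"
  let ?T = "?p1 \<union> ?p2 \<union> ?p3"
  note J12 = Jordan_arc_pair[OF A(1,2) assms(4-7) I12]
  note J13 = Jordan_arc_pair[OF A(1,3) assms(4,5,8,9) I13]
  note J23 = Jordan_arc_pair[OF A(2,3) assms(6-9) I23]
  have ne: "a \<noteq> b"
    using A(1) assms(4,5) arc_distinct_ends by blast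
  have ab: "a \<in> ?p1" "b \<in> ?p1" "a \<in> ?p2" "b \<in> ?p2" "a \<in> ?p3" "b \<in> ?p3"
    using assms(4-9) pathstart_in_path_image pathfinish_in_path_image by metis+
  have proper: "\<exists>x. x \<in> path_image c - {a, b}" if "arc c" "pathstart c = a" "pathfinish c = b" for c :: "real \<Rightarrow> complex"
  proof (rule ccontr)
    assume "\<not> ?thesis"
    then have "path_image c \<subseteq> {a, b}" by auto
    then have "finite (path_image c)" using finite_subset by blast
    moreover have "Topological_Spaces.connected (path_image c)" using that(1) connected_arc_image by blast
    moreover have "a \<in> path_image c" "b \<in> path_image c"
      using that pathstart_in_path_image pathfinish_in_path_image by metis+
    ultimately show False
      using ne connected_finite_iff_sing[of "path_image c"] by auto
  qed
  obtain x1 where x1: "x1 \<in> ?p1 - {a, b}" using proper[OF A(1) assms(4,5)] by blast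
  obtain x3 where x3: "x3 \<in> ?p3 - {a, b}" using proper[OF A(3) assms(8,9)] by blast
  obtain x2 where x2: "x2 \<in> ?p2 - {a, b}" using proper[OF A(2) assms(6,7)] by blast
  have off12: "inside (?p1 \<union> ?p2) \<inter> ?T = {}"
    using O3 J12(6,7) ab by blast
  have off13: "inside (?p1 \<union> ?p3) \<inter> ?T = {}"
    using O2 J13(6,7) ab by blast
  have off23: "inside (?p2 \<union> ?p3) \<inter> ?T = {}"
    using O1 J23(6,7) ab by blast
  \<comment> \<open>If \<open>inside C\<close> met \<open>inside D\<close>, it would be contained in
    it, being connected and disjoint from \<open>D\<close>. Then its frontier \<open>C\<close> would
    lie in the closure of \<open>inside D\<close>, hence in \<open>D\<close>, as \<open>C\<close>
    misses \<open>inside D\<close>.\<close>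
  have sep: "inside C \<subseteq> outside D"
    if "Topological_Spaces.connected (inside C)" "frontier (inside C) = C" "inside C \<inter> C = {}"
      "frontier (inside D) = D" "open (inside D)" "open (outside D)" "inside D \<inter> D = {}"
      "inside D \<inter> outside D = {}" "inside D \<union> outside D = - D"
      "inside C \<inter> D = {}" "inside D \<inter> C = {}" "\<not> C \<subseteq> D" for C D :: "complex set"
  proof (rule ccontr)
    assume "\<not> ?thesis"
    then have ne: "inside D \<inter> inside C \<noteq> {}"
      using that(9,10) by blast
    have "inside D \<inter> outside D \<inter> inside C = {}" "inside C \<subseteq> inside D \<union> outside D"
      using that(8,9,10) by auto
    then have "outside D \<inter> inside C = {}"
      using connectedD[OF that(1,5,6)] ne by blast
    then have "inside C \<subseteq> inside D" using that(9,10) by blast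
    then have "closure (inside C) \<subseteq> closure (inside D)" by (rule closure_mono)
    then have "C \<subseteq> inside D \<union> D"
      using that(2,4) closure_Un_frontier by blast
    then show False using that(11,12) by blast
  qed
  obtain q where q: "q \<in> inside (?p2 \<union> ?p3)" using J23(1) by blast
  have "q \<in> outside (?p1 \<union> ?p2)"
  proof -
    have "inside (?p2 \<union> ?p3) \<subseteq> outside (?p1 \<union> ?p2)"
    proof (rule sep[OF J23(3,8) _ J12(8,2,5) _ J12(6,7)])
      show "\<not> ?p2 \<union> ?p3 \<subseteq> ?p1 \<union> ?p2" using x3 I13 I23 by blast
    qed (use off12 off23 in blast)+
    then show ?thesis using q by blast
  qed
  moreover have "q \<in> outside (?p1 \<union> ?p3)"
  proof -
    have "inside (?p2 \<union> ?p3) \<subseteq> outside (?p1 \<union> ?p3)"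
    proof (rule sep[OF J23(3,8) _ J13(8,2,5) _ J13(6,7)])
      show "\<not> ?p2 \<union> ?p3 \<subseteq> ?p1 \<union> ?p3" using x2 I12 I23 by blast
    qed (use off13 off23 in blast)+
    then show ?thesis using q by blast
  qed
  moreover have "compact ?T"
    using A by (simp add: compact_Un compact_arc_image)
  then have "outside ?T \<noteq> {}"
    by (intro outside_bounded_nonempty compact_imp_bounded)
  then obtain o' where o: "o' \<in> outside ?T" by blast
  have oo: "o' \<in> outside (?p1 \<union> ?p2)" "o' \<in> outside (?p1 \<union> ?p3)" "o' \<in> outside (?p2 \<union> ?p3)"
    using o outside_mono[of "?p1 \<union> ?p2" ?T] outside_mono[of "?p1 \<union> ?p3" ?T]
      outside_mono[of "?p2 \<union> ?p3" ?T] by blast+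
  have cc: "connected_component (- C) q o'"
    if "Topological_Spaces.connected (outside C)" "inside C \<union> outside C = - C" "q \<in> outside C" "o' \<in> outside C" for C
    unfolding connected_component_def using that by (intro exI[of _ "outside C"]) blast
  have "connected_component (- ((?p1 \<union> ?p2) \<union> (?p1 \<union> ?p3))) q o'"
  proof (rule Janiszewski)
    have "(?p1 \<union> ?p2) \<inter> (?p1 \<union> ?p3) = ?p1"
      using ab(1,2) by (auto simp: Un_Int_distrib[symmetric] I23)
    then show "Topological_Spaces.connected ((?p1 \<union> ?p2) \<inter> (?p1 \<union> ?p3))"
      using A(1) by (simp add: connected_arc_image)
    show "compact (?p1 \<union> ?p2)" "closed (?p1 \<union> ?p3)"
      using J12(10) J13(10) compact_imp_closed by blast+
    show "connected_component (- (?p1 \<union> ?p2)) q o'"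
      using cc[OF J12(4,7)] calculation(1) oo(1) by blast
    show "connected_component (- (?p1 \<union> ?p3)) q o'"
      using cc[OF J13(4,7)] calculation(2) oo(2) by blast
  qed
  then obtain K where K: "Topological_Spaces.connected K" "K \<subseteq> - ((?p1 \<union> ?p2) \<union> (?p1 \<union> ?p3))" "q \<in> K" "o' \<in> K"
    unfolding connected_component_def by blast
  then have "K \<subseteq> inside (?p2 \<union> ?p3) \<or> K \<subseteq> outside (?p2 \<union> ?p3)"
    using arc_interior_side[OF A(2,3) assms(6-9) I23 K(1)] by blast
  then show False
    using K q oo(3) J23(6) by blast
qed

text \<open>The exposed points put the interiors of \<open>c1\<close> and \<open>c2\<close> outside
  the cycles formed by the other two arcs. The interior of \<open>c3\<close> lies on one side of the
  third cycle, and the outer side is excluded by \<open>theta_not_all_outside\<close>.\<close>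

lemma theta_third_inside:
  fixes c1 c2 c3 :: "real \<Rightarrow> complex"
  assumes A: "arc c1" "arc c2" "arc c3"
    and "pathstart c1 = a" "pathfinish c1 = b" "pathstart c2 = a" "pathfinish c2 = b"
      "pathstart c3 = a" "pathfinish c3 = b"
    and I12: "path_image c1 \<inter> path_image c2 = {a, b}"
    and I13: "path_image c1 \<inter> path_image c3 = {a, b}"
    and I23: "path_image c2 \<inter> path_image c3 = {a, b}"
    and M: "path_image c1 \<union> path_image c2 \<union> path_image c3 \<subseteq> M"
    and q1: "q1 \<in> path_image c1 - {a, b}" "q1 \<in> frontier (outside M)"
    and q2: "q2 \<in> path_image c2 - {a, b}" "q2 \<in> frontier (outside M)"
  shows "path_image c3 - {a, b} \<subseteq> inside (path_image c1 \<union> path_image c2)"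
proof -
  let ?p1 = "path_image c1" and ?p2 = "path_image c2" and ?p3 = "path_image c3"
  note J12 = Jordan_arc_pair[OF A(1,2) assms(4-7) I12]
  note J13 = Jordan_arc_pair[OF A(1,3) assms(4,5,8,9) I13]
  note J23 = Jordan_arc_pair[OF A(2,3) assms(6-9) I23]
  have "q1 \<in> outside (?p2 \<union> ?p3)"
    using frontier_outside_mono[OF _ J23(10) q1(2)] M q1(1) I12 I13 by blast
  moreover have "(?p1 - {a, b}) \<inter> (?p2 \<union> ?p3) = {}"
    using I12 I13 by blast
  ultimately have O1: "?p1 - {a, b} \<subseteq> outside (?p2 \<union> ?p3)"
    using arc_interior_side[OF A(2,3) assms(6-9) I23 connected_arc_interior[OF A(1) assms(4,5)]]
      q1(1) J23(6) by blast
  have "q2 \<in> outside (?p1 \<union> ?p3)"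
    using frontier_outside_mono[OF _ J13(10) q2(2)] M q2(1) I12 I23 by blast
  moreover have "(?p2 - {a, b}) \<inter> (?p1 \<union> ?p3) = {}"
    using I12 I23 by blast
  ultimately have O2: "?p2 - {a, b} \<subseteq> outside (?p1 \<union> ?p3)"
    using arc_interior_side[OF A(1,3) assms(4,5,8,9) I13 connected_arc_interior[OF A(2) assms(6,7)]]
      q2(1) J13(6) by blast
  have "(?p3 - {a, b}) \<inter> (?p1 \<union> ?p2) = {}"
    using I13 I23 by blast
  then show ?thesis
    using arc_interior_side[OF A(1,2) assms(4-7) I12 connected_arc_interior[OF A(3) assms(8,9)]]
      theta_not_all_outside[OF A assms(4-9) I12 I13 I23 O1 O2] by blast
qed

text \<open>By \<open>theta_third_inside\<close> the interior of \<open>c3\<close> is enclosed by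
  the other two arcs, whereas its exposed point lies outside them.\<close>

lemma theta_not_all_exposed:
  fixes c1 c2 c3 :: "real \<Rightarrow> complex"
  assumes A: "arc c1" "arc c2" "arc c3"
    and "pathstart c1 = a" "pathfinish c1 = b" "pathstart c2 = a" "pathfinish c2 = b"
      "pathstart c3 = a" "pathfinish c3 = b"
    and I12: "path_image c1 \<inter> path_image c2 = {a, b}"
    and I13: "path_image c1 \<inter> path_image c3 = {a, b}"
    and I23: "path_image c2 \<inter> path_image c3 = {a, b}"
    and M: "path_image c1 \<union> path_image c2 \<union> path_image c3 \<subseteq> M"
    and q1: "q1 \<in> path_image c1 - {a, b}" "q1 \<in> frontier (outside M)"
    and q2: "q2 \<in> path_image c2 - {a, b}" "q2 \<in> frontier (outside M)"
    and q3: "q3 \<in> path_image c3 - {a, b}" "q3 \<in> frontier (outside M)"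
  shows False
proof -
  note J12 = Jordan_arc_pair[OF A(1,2) assms(4-7) I12]
  have "q3 \<in> outside (path_image c1 \<union> path_image c2)"
    using frontier_outside_mono[OF _ J12(10) q3(2)] M q3(1) I13 I23 by blast
  then show False
    using theta_third_inside[OF A assms(4-9) I12 I13 I23 M q1 q2] q3(1) J12(6) by blast
qed

text \<open>By the theta lemma both chords run inside the quadrilateral. The first chord splits this
  inside into two parts, and the second one stays in one of them, so that one of its ends is
  enclosed by the boundary of that part.\<close>

lemma crossing_chords_not_all_exposed:
  fixes s1 s2 s3 s4 d1 d2 :: "real \<Rightarrow> complex"
  assumes A: "arc s1" "arc s2" "arc s3" "arc s4" "arc d1" "arc d2"
    and E: "pathstart s1 = a" "pathfinish s1 = b" "pathstart s2 = b" "pathfinish s2 = c"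
      "pathstart s3 = c" "pathfinish s3 = d" "pathstart s4 = d" "pathfinish s4 = a"
      "pathstart d1 = a" "pathfinish d1 = c" "pathstart d2 = b" "pathfinish d2 = d"
    and I: "path_image s1 \<inter> path_image s2 = {b}" "path_image s2 \<inter> path_image s3 = {c}"
      "path_image s3 \<inter> path_image s4 = {d}" "path_image s4 \<inter> path_image s1 = {a}"
      "path_image s1 \<inter> path_image s3 = {}" "path_image s2 \<inter> path_image s4 = {}"
      "path_image d1 \<inter> path_image s1 = {a}" "path_image d1 \<inter> path_image s2 = {c}"
      "path_image d1 \<inter> path_image s3 = {c}" "path_image d1 \<inter> path_image s4 = {a}"
      "path_image d2 \<inter> path_image s1 = {b}" "path_image d2 \<inter> path_image s2 = {b}"
      "path_image d2 \<inter> path_image s3 = {d}" "path_image d2 \<inter> path_image s4 = {d}"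
      "path_image d1 \<inter> path_image d2 = {}"
    and M: "path_image s1 \<union> path_image s2 \<union> path_image s3 \<union> path_image s4 \<union>
      path_image d1 \<union> path_image d2 \<subseteq> M"
    and F: "a \<in> frontier (outside M)" "b \<in> frontier (outside M)"
      "c \<in> frontier (outside M)" "d \<in> frontier (outside M)"
  shows False
proof -
  \<comment> \<open>One and the same closed curve is read as two arcs between \<open>a\<close> and
    \<open>c\<close> for the first chord, and as two arcs between \<open>b\<close> and
    \<open>d\<close> for the second.\<close>
  define u where "u = s1 +++ s2"
  define w where "w = reversepath s4 +++ reversepath s3"
  define u' where "u' = reversepath s1 +++ reversepath s4"
  define w' where "w' = s2 +++ s3"
  have arcs: "arc u" "arc w" "arc u'" "arc w'"
    unfolding u_def w_def u'_def w'_def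
    by (intro arc_join; use A E I in \<open>auto simp: arc_reversepath\<close>)+
  have ends: "pathstart u = a" "pathfinish u = c" "pathstart w = a" "pathfinish w = c"
    "pathstart u' = b" "pathfinish u' = d" "pathstart w' = b" "pathfinish w' = d"
    unfolding u_def w_def u'_def w'_def using E by auto
  have im: "path_image u = path_image s1 \<union> path_image s2" "path_image w = path_image s4 \<union> path_image s3"
    "path_image u' = path_image s1 \<union> path_image s4" "path_image w' = path_image s2 \<union> path_image s3"
    unfolding u_def w_def u'_def w'_def using E by (auto simp: path_image_join)
  have mem: "a \<in> path_image s1" "b \<in> path_image s1" "b \<in> path_image s2" "c \<in> path_image s2"
    "c \<in> path_image s3" "d \<in> path_image s3" "d \<in> path_image s4" "a \<in> path_image s4"
    "a \<in> path_image d1" "c \<in> path_image d1" "b \<in> path_image d2" "d \<in> path_image d2"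
    using E pathstart_in_path_image pathfinish_in_path_image by metis+
  have dist: "a \<noteq> b" "b \<noteq> c" "c \<noteq> d" "d \<noteq> a" "a \<noteq> c" "b \<noteq> d"
    using I(5,6,15) mem by auto
  have Iuw: "path_image u \<inter> path_image w = {a, c}"
    unfolding im using I(2,4,5,6) by blast
  have Iud: "path_image u \<inter> path_image d1 = {a, c}"
    unfolding im using I(7,8) by blast
  have Iwd: "path_image w \<inter> path_image d1 = {a, c}"
    unfolding im using I(9,10) by blast
  have in1: "path_image d1 - {a, c} \<subseteq> inside (path_image u \<union> path_image w)"
    by (rule theta_third_inside[OF arcs(1,2) A(5) ends(1-4) E(9,10) Iuw Iud Iwd, of M b d])
      (use M F mem dist im in auto)
  have Iuw': "path_image u' \<inter> path_image w' = {b, d}"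
    unfolding im using I(1,3,5,6) by blast
  have Iud': "path_image u' \<inter> path_image d2 = {b, d}"
    unfolding im using I(11,14) by blast
  have Iwd': "path_image w' \<inter> path_image d2 = {b, d}"
    unfolding im using I(12,13) by blast
  have in2: "path_image d2 - {b, d} \<subseteq> inside (path_image u' \<union> path_image w')"
    by (rule theta_third_inside[OF arcs(3,4) A(6) ends(5-8) E(11,12) Iuw' Iud' Iwd', of M a c])
      (use M F mem dist im in auto)
  have same: "path_image u' \<union> path_image w' = path_image u \<union> path_image w"
    unfolding im by blast
  have con1: "Topological_Spaces.connected (path_image d1 - {a, c})" and con2: "Topological_Spaces.connected (path_image d2 - {b, d})"
    using connected_arc_interior A E by blast+
  have nonempty: "path_image d1 - {a, c} \<noteq> {}"
  proof
    assume "path_image d1 - {a, c} = {}"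
    then have "finite (path_image d1)" by (simp add: finite_subset)
    then show False
      using connected_arc_image[OF A(5)] connected_finite_iff_sing[of "path_image d1"] mem(9,10) dist(5)
      by auto
  qed
  then have "path_image d1 \<inter> inside (path_image u \<union> path_image w) \<noteq> {}"
    using in1 by blast
  then obtain sp1: "inside (path_image u \<union> path_image d1) \<inter> inside (path_image w \<union> path_image d1) = {}"
    and sp2: "inside (path_image u \<union> path_image d1) \<union> inside (path_image w \<union> path_image d1) \<union>
           (path_image d1 - {a, c}) = inside (path_image u \<union> path_image w)"
    using split_inside_simple_closed_curve[OF arc_imp_simple_path[OF arcs(1)] ends(1,2)
        arc_imp_simple_path[OF arcs(2)] ends(3,4) arc_imp_simple_path[OF A(5)] E(9,10) dist(5) Iuw Iud Iwd]
    by blast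
  note Ju = Jordan_arc_pair[OF arcs(1) A(5) ends(1,2) E(9,10) Iud]
  note Jw = Jordan_arc_pair[OF arcs(2) A(5) ends(3,4) E(9,10) Iwd]
  have cov: "path_image d2 - {b, d} \<subseteq> inside (path_image u \<union> path_image d1) \<union> inside (path_image w \<union> path_image d1)"
    using in2 sp2 I(15) unfolding same by blast
  \<comment> \<open>The ends of the second chord are limits of its interior, so they lie in the
    closure of whichever part contains this interior.\<close>
  have "path_image d2 \<subseteq> closure (path_image d2 - {b, d})"
  proof -
    have "d2 ` {0..1} \<subseteq> closure (d2 ` {0<..<1})"
    proof -
      have "continuous_on (closure {0<..<1}) d2"
        using A(6) by (simp add: arc_imp_path path_def[symmetric])
      then have "d2 ` closure {0<..<1} \<subseteq> closure (d2 ` {0<..<1})"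
        by (rule image_closure_subset) (simp_all add: closure_subset)
      then show ?thesis by simp
    qed
    moreover have "d2 ` {0<..<1} \<subseteq> path_image d2 - {b, d}"
    proof -
      have "inj_on d2 {0..1}" using A(6) by (simp add: arc_def)
      then show ?thesis
        using E(11,12) unfolding path_image_def pathstart_def pathfinish_def inj_on_def
        by force
    qed
    ultimately show ?thesis
      unfolding path_image_def using closure_mono by blast
  qed
  then have cl: "b \<in> closure (path_image d2 - {b, d})" "d \<in> closure (path_image d2 - {b, d})"
    using mem by blast+
  have "path_image d2 - {b, d} \<subseteq> inside (path_image u \<union> path_image d1) \<or>
      path_image d2 - {b, d} \<subseteq> inside (path_image w \<union> path_image d1)"
    using connectedD[OF con2 Ju(2) Jw(2)] cov sp1 by blast
  then show False
  proof
    assume "path_image d2 - {b, d} \<subseteq> inside (path_image u \<union> path_image d1)"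
    from closure_mono[OF this] have "d \<in> closure (inside (path_image u \<union> path_image d1))"
      using cl by blast
    moreover have n: "d \<notin> path_image u \<union> path_image d1"
      using I(5,15) I(6) mem(3,6,7,12) unfolding im by blast
    ultimately have "d \<in> inside (path_image u \<union> path_image d1)"
      using Ju(8) closure_Un_frontier by blast
    moreover have "d \<in> outside (path_image u \<union> path_image d1)"
      using frontier_outside_mono[OF _ Ju(10) F(4) n] M unfolding im by blast
    ultimately show False using Ju(6) by blast
  next
    assume "path_image d2 - {b, d} \<subseteq> inside (path_image w \<union> path_image d1)"
    from closure_mono[OF this] have "b \<in> closure (inside (path_image w \<union> path_image d1))"
      using cl by blast
    moreover have n: "b \<notin> path_image w \<union> path_image d1"
      using I(5,6,15) mem(2,3,11) unfolding im by blast
    ultimately have "b \<in> inside (path_image w \<union> path_image d1)"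
      using Jw(8) closure_Un_frontier by blast
    moreover have "b \<in> outside (path_image w \<union> path_image d1)"
      using frontier_outside_mono[OF _ Jw(10) F(2) n] M unfolding im by blast
    ultimately show False using Jw(6) by blast
  qed
qed

section \<open>Forbidden configurations in outerplanar graphs\<close>

text \<open>The vertices are given by an index function instead of a list, so that the same lemmas
  serve for lists and for segments of a cycle indexed modulo its length.\<close>

definition path_edges :: "(nat \<Rightarrow> 'a) \<Rightarrow> nat \<Rightarrow> nat \<Rightarrow> 'a set set" where
  "path_edges f m n = (\<lambda>t. {f t, f (Suc t)}) ` {m..<n}"

lemma Union_path_edges:
  assumes "m < n"
  shows "\<Union> (path_edges f m n) = f ` {m..n}"
proof
  show "\<Union> (path_edges f m n) \<subseteq> f ` {m..n}"
    by (auto simp: path_edges_def)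
  show "f ` {m..n} \<subseteq> \<Union> (path_edges f m n)"
  proof
    fix v assume "v \<in> f ` {m..n}"
    then obtain t where t: "m \<le> t" "t \<le> n" "v = f t" by auto
    show "v \<in> \<Union> (path_edges f m n)"
    proof (cases "t = n")
      case True
      then have "{f (n - 1), f n} \<in> path_edges f m n"
        using assms by (auto simp: path_edges_def intro!: image_eqI[of _ _ "n - 1"])
      then show ?thesis using t True by blast
    next
      case False
      then have "{f t, f (Suc t)} \<in> path_edges f m n"
        using t by (auto simp: path_edges_def)
      then show ?thesis using t by blast
    qed
  qed
qed

text \<open>An edge common to two internally disjoint paths with the same ends would have to join
  these ends; this rules it out.\<close>

lemma ends_not_path_edge:
  assumes "inj_on f {m..n}" "m + 2 \<le> n"
  shows "{f m, f n} \<notin> path_edges f m n"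
proof
  assume "{f m, f n} \<in> path_edges f m n"
  then obtain t where t: "m \<le> t" "t < n" "{f m, f n} = {f t, f (Suc t)}"
    by (auto simp: path_edges_def)
  then have "f m = f t \<and> f n = f (Suc t) \<or> f m = f (Suc t) \<and> f n = f t"
    by (auto simp: doubleton_eq_iff)
  then have "m = t \<and> n = Suc t \<or> m = Suc t \<and> n = t"
    using assms t(1,2) by (auto dest: inj_onD)
  then show False using assms(2) t by auto
qed

section \<open>Arcs in a plane drawing\<close>

context
  fixes G :: "'a pair_pre_digraph" and p :: "'a \<Rightarrow> complex" and \<gamma> :: "'a set \<Rightarrow> real \<Rightarrow> complex"
  assumes drawing: "plane_drawing G p \<gamma>"
begin

lemma vertex_in_edge_image:
  assumes "E \<subseteq> edges G" "v \<in> \<Union>E"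
  shows "p v \<in> (\<Union>e\<in>E. path_image (\<gamma> e))"
proof -
  obtain e where e: "e \<in> E" "v \<in> e" using assms by blast
  then have "p v \<in> p ` e" "e \<in> edges G" using assms by auto
  then have "p v \<in> path_image (\<gamma> e)"
    using drawing unfolding plane_drawing_def by blast
  then show ?thesis using e by blast
qed

text \<open>Distinct edges meet only at common ends, and a vertex lies on the images of its edges.
  So intersections of drawn subgraphs without common edges can be read off from their vertex
  sets.\<close>

lemma edge_images_Int:
  assumes "E1 \<subseteq> edges G" "E2 \<subseteq> edges G" "E1 \<inter> E2 = {}"
  shows "(\<Union>e\<in>E1. path_image (\<gamma> e)) \<inter> (\<Union>e\<in>E2. path_image (\<gamma> e)) = p ` (\<Union>E1 \<inter> \<Union>E2)"
proof
  show "p ` (\<Union>E1 \<inter> \<Union>E2) \<subseteq> (\<Union>e\<in>E1. path_image (\<gamma> e)) \<inter> (\<Union>e\<in>E2. path_image (\<gamma> e))"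
    using vertex_in_edge_image[OF assms(1)] vertex_in_edge_image[OF assms(2)] by blast
  show "(\<Union>e\<in>E1. path_image (\<gamma> e)) \<inter> (\<Union>e\<in>E2. path_image (\<gamma> e)) \<subseteq> p ` (\<Union>E1 \<inter> \<Union>E2)"
  proof
    fix x assume "x \<in> (\<Union>e\<in>E1. path_image (\<gamma> e)) \<inter> (\<Union>e\<in>E2. path_image (\<gamma> e))"
    then obtain e f where ef: "e \<in> E1" "f \<in> E2" "x \<in> path_image (\<gamma> e) \<inter> path_image (\<gamma> f)"
      by blast
    then have "e \<noteq> f" "e \<in> edges G" "f \<in> edges G" using assms by auto
    then have "x \<in> p ` (e \<inter> f)"
      using drawing ef(3) unfolding plane_drawing_def by blast
    then show "x \<in> p ` (\<Union>E1 \<inter> \<Union>E2)" using ef(1,2) by blast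
  qed
qed

text \<open>\<open>plane_drawing\<close> does not fix the direction in which the curve of an edge is
  traversed, so it may have to be reversed.\<close>

lemma edge_arc:
  assumes "{u, v} \<in> edges G"
  shows "\<exists>g. arc g \<and> pathstart g = p u \<and> pathfinish g = p v \<and> path_image g = path_image (\<gamma> {u, v})"
proof -
  have a: "arc (\<gamma> {u, v})" and "{pathstart (\<gamma> {u, v}), pathfinish (\<gamma> {u, v})} = {p u, p v}"
    using drawing assms unfolding plane_drawing_def by auto
  then consider "pathstart (\<gamma> {u, v}) = p u" "pathfinish (\<gamma> {u, v}) = p v"
    | "pathstart (\<gamma> {u, v}) = p v" "pathfinish (\<gamma> {u, v}) = p u"
    by (auto simp: doubleton_eq_iff)
  then show ?thesis
  proof cases
    case 1
    then show ?thesis using a by blast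
  next
    case 2
    then show ?thesis
      using a by (intro exI[of _ "reversepath (\<gamma> {u, v})"]) (auto simp: arc_reversepath)
  qed
qed

text \<open>Induction on the number of edges: the new edge meets the arc built so far only in its
  starting point, since its other end is a new vertex.\<close>

lemma path_arc:
  assumes "m < n" "inj_on f {m..n}" "path_edges f m n \<subseteq> edges G"
  obtains g where "arc g" "pathstart g = p (f m)" "pathfinish g = p (f n)"
    "path_image g = (\<Union>e\<in>path_edges f m n. path_image (\<gamma> e))"
proof -
  have "\<exists>g. arc g \<and> pathstart g = p (f m) \<and> pathfinish g = p (f n) \<and>
    path_image g = (\<Union>e\<in>path_edges f m n. path_image (\<gamma> e))"
    using assms
  proof (induction n)
    case (Suc n)
    have E: "path_edges f m (Suc n) = insert {f n, f (Suc n)} (path_edges f m n)"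
      using Suc.prems(1) unfolding path_edges_def by (simp add: atLeastLessThanSuc)
    obtain h where h: "arc h" "pathstart h = p (f n)" "pathfinish h = p (f (Suc n))"
      "path_image h = path_image (\<gamma> {f n, f (Suc n)})"
      using edge_arc[of "f n" "f (Suc n)"] Suc.prems(3) unfolding E by auto
    show ?case
    proof (cases "m = n")
      case True
      then have "path_edges f m n = {}" by (simp add: path_edges_def)
      then show ?thesis unfolding E using h True by auto
    next
      case False
      have sub: "{m..n} \<subseteq> {m..Suc n}" by auto
      obtain g where g: "arc g" "pathstart g = p (f m)" "pathfinish g = p (f n)"
        "path_image g = (\<Union>e\<in>path_edges f m n. path_image (\<gamma> e))"
        using Suc.IH False Suc.prems inj_on_subset[OF Suc.prems(2) sub] unfolding E by auto
      have new: "f (Suc n) \<notin> f ` {m..n}"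
        using Suc.prems(1,2) by (auto dest: inj_onD)
      have U: "\<Union> (path_edges f m n) = f ` {m..n}"
        using Union_path_edges False Suc.prems(1) by (metis less_SucE)
      have "path_edges f m n \<inter> {{f n, f (Suc n)}} = {}"
        using new U by blast
      then have "path_image g \<inter> path_image h = p ` (\<Union> (path_edges f m n) \<inter> \<Union> {{f n, f (Suc n)}})"
        using edge_images_Int[of "path_edges f m n" "{{f n, f (Suc n)}}"] Suc.prems(3) g(4) h(4)
        unfolding E by auto
      also have "\<dots> \<subseteq> {p (f n)}" unfolding U using new by (simp add: Int_insert_right)
      finally have "arc (g +++ h)"
        using g h by (intro arc_join) auto
      moreover have "path_image (g +++ h) = (\<Union>e\<in>path_edges f m (Suc n). path_image (\<gamma> e))"
        using g h unfolding E by (auto simp: path_image_join)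
      ultimately show ?thesis
        using g h by (intro exI[of _ "g +++ h"]) auto
    qed
  qed simp
  then show ?thesis using that by blast
qed

lemma path_edges_image_subset:
  assumes "E \<subseteq> edges G"
  shows "(\<Union>e\<in>E. path_image (\<gamma> e)) \<subseteq> drawing_image G p \<gamma>"
  using assms unfolding drawing_image_def by blast

end

lemma edges_subset_pverts:
  assumes "pair_graph G" "e \<in> edges G"
  shows "e \<subseteq> pverts G"
proof -
  interpret pair_graph G by fact
  show ?thesis using assms(2) in_arcsD1 in_arcsD2 unfolding edges_def by auto
qed

lemma card_edge:
  assumes "pair_graph G" "e \<in> edges G"
  shows "card e = 2"
proof -
  interpret pair_graph G by fact
  show ?thesis using assms(2) no_loops unfolding edges_def by (auto simp: card_insert_if)
qed

text \<open>The exposed points required by \<open>theta_not_all_exposed\<close> are the first inner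
  vertices \<open>hd xs\<close>, \<open>hd ys\<close> and \<open>hd zs\<close>.\<close>

lemma outerplanar_theta_free:
  assumes G: "pair_graph G" and "outerplanar G"
  shows "theta_free (nbrs G)"
  unfolding theta_free_def
proof clarify
  obtain p \<gamma> where d: "plane_drawing G p \<gamma>"
    and fr: "\<And>v. v \<in> pverts G \<Longrightarrow> p v \<in> frontier (outside (drawing_image G p \<gamma>))"
    using assms(2) unfolding outerplanar_def by blast
  fix a b xs ys zs
  assume ne: "xs \<noteq> []" "ys \<noteq> []" "zs \<noteq> []" and dis: "distinct (a # b # xs @ ys @ zs)"
    and suc: "\<forall>ps\<in>{xs, ys, zs}. walk (nbrs G) (a # ps @ [b])"
  let ?f = "\<lambda>ps. nth (a # ps @ [b])"
  let ?E = "\<lambda>ps. path_edges (?f ps) 0 (Suc (length ps))"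
  let ?I = "\<lambda>ps. \<Union>e\<in>?E ps. path_image (\<gamma> e)"
  have P: "\<exists>g. arc g \<and> pathstart g = p a \<and> pathfinish g = p b \<and> path_image g = ?I ps \<and> ?E ps \<subseteq> edges G \<and>
      \<Union> (?E ps) = insert a (insert b (set ps)) \<and> {a, b} \<notin> ?E ps \<and>
      p (hd ps) \<in> path_image g - {p a, p b} \<and> p (hd ps) \<in> frontier (outside (drawing_image G p \<gamma>))"
    if "ps \<in> {xs, ys, zs}" for ps
  proof -
    have dp: "distinct (a # ps @ [b])" and ps: "ps \<noteq> []" using dis that ne by auto
    have inj: "inj_on (?f ps) {0..Suc (length ps)}"
      using dp by (intro inj_on_nth) auto
    have adj: "((a # ps @ [b]) ! t, (a # ps @ [b]) ! Suc t) \<in> parcs G" if "t < Suc (length ps)" for t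
    proof -
      have "Suc t < length (a # ps @ [b])" using that by simp
      then show ?thesis
        using suc \<open>ps \<in> {xs, ys, zs}\<close> unfolding nbrs_def successively_conv_nth by blast
    qed
    have E: "?E ps \<subseteq> edges G"
      unfolding path_edges_def edges_def using adj by fastforce
    have img: "?f ps ` {0..Suc (length ps)} = set (a # ps @ [b])"
      unfolding set_conv_nth by (auto simp: image_def less_Suc_eq_le Bex_def)
    have U: "\<Union> (?E ps) = insert a (insert b (set ps))"
      using Union_path_edges[of 0 "Suc (length ps)" "?f ps"] img by auto
    have nab: "{a, b} \<notin> ?E ps"
      using ends_not_path_edge[OF inj] ps by (cases ps) (auto simp: nth_append)
    obtain g where g: "arc g" "pathstart g = p a" "pathfinish g = p b" "path_image g = ?I ps"
      using path_arc[OF d _ inj E] by (auto simp: nth_append)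
    have V: "\<Union> (?E ps) \<subseteq> pverts G"
      using E edges_subset_pverts[OF G] by blast
    have "inj_on p (pverts G)" using d by (simp add: plane_drawing_def)
    moreover have "hd ps \<in> set ps" "a \<noteq> hd ps" "b \<noteq> hd ps" using ps dp by (auto simp: hd_in_set)
    moreover have vs: "hd ps \<in> pverts G" "a \<in> pverts G" "b \<in> pverts G"
      using V \<open>hd ps \<in> set ps\<close> unfolding U by auto
    ultimately have "p (hd ps) \<noteq> p a" "p (hd ps) \<noteq> p b"
      by (metis inj_onD)+
    moreover have "p (hd ps) \<in> path_image g"
      unfolding g(4) using vertex_in_edge_image[OF d E, of "hd ps"] U \<open>hd ps \<in> set ps\<close> by blast
    ultimately have "p (hd ps) \<in> path_image g - {p a, p b}"
      by blast
    moreover have "p (hd ps) \<in> frontier (outside (drawing_image G p \<gamma>))"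
      using fr vs by blast
    ultimately show ?thesis
      using g E U nab by blast
  qed
  have F: "?E ps \<subseteq> edges G" "\<Union> (?E ps) = insert a (insert b (set ps))" "{a, b} \<notin> ?E ps" if "ps \<in> {xs, ys, zs}" for ps
    using P[OF that] by blast+
  \<comment> \<open>A common edge would have both ends in \<open>{a, b}\<close>, so it would be
    \<open>{a, b}\<close> itself, which is no edge of a path with an inner vertex.\<close>
  have I: "?I ps \<inter> ?I qs = {p a, p b}"
    if "ps \<in> {xs, ys, zs}" "qs \<in> {xs, ys, zs}" "set ps \<inter> set qs = {}" for ps qs
  proof -
    have V: "\<Union> (?E ps) \<inter> \<Union> (?E qs) = {a, b}"
      unfolding F(2)[OF that(1)] F(2)[OF that(2)] using that(3) by auto
    have "?E ps \<inter> ?E qs = {}"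
    proof (rule ccontr)
      assume "\<not> ?thesis"
      then obtain e where e: "e \<in> ?E ps" "e \<in> ?E qs" by blast
      then have "e \<subseteq> {a, b}" using V by blast
      moreover have "card e = 2" using card_edge[OF G] F(1)[OF that(1)] e(1) by blast
      ultimately have "e = {a, b}"
        using card_seteq[of "{a, b}" e] by (simp add: card_insert_if)
      then show False using e F(3)[OF that(1)] by blast
    qed
    from edge_images_Int[OF d F(1)[OF that(1)] F(1)[OF that(2)] this] show ?thesis
      unfolding V by simp
  qed
  obtain g1 where g1: "arc g1" "pathstart g1 = p a" "pathfinish g1 = p b" "path_image g1 = ?I xs"
    "?E xs \<subseteq> edges G" "p (hd xs) \<in> path_image g1 - {p a, p b}"
    "p (hd xs) \<in> frontier (outside (drawing_image G p \<gamma>))" using P[of xs] by blast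
  obtain g2 where g2: "arc g2" "pathstart g2 = p a" "pathfinish g2 = p b" "path_image g2 = ?I ys"
    "?E ys \<subseteq> edges G" "p (hd ys) \<in> path_image g2 - {p a, p b}"
    "p (hd ys) \<in> frontier (outside (drawing_image G p \<gamma>))" using P[of ys] by blast
  obtain g3 where g3: "arc g3" "pathstart g3 = p a" "pathfinish g3 = p b" "path_image g3 = ?I zs"
    "?E zs \<subseteq> edges G" "p (hd zs) \<in> path_image g3 - {p a, p b}"
    "p (hd zs) \<in> frontier (outside (drawing_image G p \<gamma>))" using P[of zs] by blast
  have "path_image g1 \<inter> path_image g2 = {p a, p b}"
    unfolding g1 g2 by (rule I) (use dis in auto)
  moreover have "path_image g1 \<inter> path_image g3 = {p a, p b}"
    unfolding g1 g3 by (rule I) (use dis in auto)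
  moreover have "path_image g2 \<inter> path_image g3 = {p a, p b}"
    unfolding g2 g3 by (rule I) (use dis in auto)
  moreover have "path_image g1 \<union> path_image g2 \<union> path_image g3 \<subseteq> drawing_image G p \<gamma>"
    unfolding g1(4) g2(4) g3(4)
    using path_edges_image_subset[OF d g1(5)] path_edges_image_subset[OF d g2(5)]
      path_edges_image_subset[OF d g3(5)] by simp
  ultimately show False
    by (rule theta_not_all_exposed[OF g1(1) g2(1) g3(1) g1(2,3) g2(2,3) g3(2,3) _ _ _ _ g1(6,7) g2(6,7) g3(6,7)])
qed

lemma outerplanar_chords_noncrossing:
  assumes G: "pair_graph G" and "outerplanar G"
  shows "chords_noncrossing (nbrs G)"
  unfolding chords_noncrossing_def
proof clarify
  obtain p \<gamma> where d: "plane_drawing G p \<gamma>"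
    and fr: "\<And>v. v \<in> pverts G \<Longrightarrow> p v \<in> frontier (outside (drawing_image G p \<gamma>))"
    using assms(2) unfolding outerplanar_def by blast
  fix cs i x j y
  assume cyc: "cycle (nbrs G) cs" and ix: "i < x" and xj: "x < j" and jy: "j < y" and yn: "y < length cs"
    and ch: "cs ! j \<in> nbrs G (cs ! i)" "cs ! y \<in> nbrs G (cs ! x)"
  define n where "n = length cs"
  \<comment> \<open>Positions are read modulo \<open>n\<close>, so that the fourth side, which runs
    from \<open>y\<close> past the end of the list to \<open>i\<close>, is the segment from
    \<open>y\<close> to \<open>n + i\<close>.\<close>
  define f where "f = (\<lambda>t. cs ! (t mod n))"
  have n: "3 \<le> n" "distinct cs" using cyc by (auto simp: cycle_def n_def)
  have edge: "{f t, f (Suc t)} \<in> edges G" for t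
  proof -
    have "cs ! (Suc (t mod n) mod n) \<in> nbrs G (cs ! (t mod n))"
      using cyc n unfolding cycle_def n_def[symmetric] by simp
    then show ?thesis
      unfolding f_def edges_def nbrs_def by (auto simp: mod_Suc_eq)
  qed
  have inj: "inj_on f {i..<i + n}"
  proof (rule linorder_inj_onI')
    fix s t assume st: "s \<in> {i..<i + n}" "t \<in> {i..<i + n}" "s < t"
    have "s mod n \<noteq> t mod n"
    proof
      assume "s mod n = t mod n"
      then have "n dvd t - s" using st(3) by (metis mod_eq_dvd_iff_nat less_imp_le)
      then have "n \<le> t - s" using st(3) by (intro dvd_imp_le) auto
      then show False using st by auto
    qed
    then show "f s \<noteq> f t"
      using n nth_eq_iff_index_eq[OF n(2), of "s mod n" "t mod n"] unfolding f_def
      by (metis mod_less_divisor n_def not_numeral_le_zero gr0I)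
  qed
  have fn: "f (n + i) = f i" by (simp add: f_def)
  have f: "f i = cs ! i" "f x = cs ! x" "f j = cs ! j" "f y = cs ! y"
    using ix xj jy yn by (auto simp: f_def n_def)
  let ?E1 = "path_edges f i x" and ?E2 = "path_edges f x j" and ?E3 = "path_edges f j y"
    and ?E4 = "path_edges f y (n + i)" and ?D1 = "{{f i, f j}}" and ?D2 = "{{f x, f y}}"
  let ?I = "\<lambda>E. \<Union>e\<in>E. path_image (\<gamma> e)"
  have E: "path_edges f s t \<subseteq> edges G" for s t
    using edge by (auto simp: path_edges_def)
  have D: "?D1 \<subseteq> edges G" "?D2 \<subseteq> edges G"
    using ch unfolding f edges_def nbrs_def by auto
  \<comment> \<open>The fourth side is indexed by \<open>insert i {y..<n + i}\<close> instead of
    \<open>{y..n + i}\<close> in order to stay in the window of \<open>n\<close> consecutive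
    positions on which \<open>f\<close> is injective.\<close>
  have V: "\<Union>?E1 = f ` {i..x}" "\<Union>?E2 = f ` {x..j}" "\<Union>?E3 = f ` {j..y}"
    "\<Union>?E4 = f ` insert i {y..<n + i}" "\<Union>?D1 = f ` {i, j}" "\<Union>?D2 = f ` {x, y}"
  proof -
    have "{y..n + i} = insert (n + i) {y..<n + i}" using yn n_def by auto
    then show "\<Union>?E4 = f ` insert i {y..<n + i}"
      using Union_path_edges[of y "n + i" f] yn n_def fn by auto
  qed (simp_all only: Union_path_edges[OF ix] Union_path_edges[OF xj] Union_path_edges[OF jy], auto)
  \<comment> \<open>Any two of the six curves share at most one vertex, hence no edge, so they meet
    exactly in that vertex or not at all.\<close>
  have I: "?I E \<inter> ?I E' = (\<lambda>t. p (f t)) ` (A \<inter> B)"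
    if "E \<subseteq> edges G" "E' \<subseteq> edges G" "\<Union>E = f ` A" "\<Union>E' = f ` B" "A \<subseteq> {i..<i + n}" "B \<subseteq> {i..<i + n}"
      "A \<inter> B \<subseteq> {t}" for E E' A B t
  proof -
    have VV: "\<Union>E \<inter> \<Union>E' = f ` (A \<inter> B)"
      unfolding that(3,4) using inj_on_image_Int[OF inj that(5,6)] by simp
    have "E \<inter> E' = {}"
    proof (rule ccontr)
      assume "\<not> ?thesis"
      then obtain e where e: "e \<in> E" "e \<in> E'" by blast
      then have "e \<subseteq> {f t}" using VV that(7) by blast
      then have "card e \<le> 1" using card_mono[of "{f t}" e] by simp
      then show False using card_edge[OF G] e(1) that(1) by fastforce
    qed
    from edge_images_Int[OF d that(1,2) this] show ?thesis
      unfolding VV by (simp add: image_image)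
  qed
  have seg: "\<exists>g. arc g \<and> pathstart g = p (f s) \<and> pathfinish g = p (f t) \<and> path_image g = ?I (path_edges f s t)"
    if "i \<le> s" "s < t" "t < i + n" for s t
  proof -
    have "{s..t} \<subseteq> {i..<i + n}" using that by auto
    then have "inj_on f {s..t}" using inj inj_on_subset by blast
    then show ?thesis using path_arc[OF d that(2) _ E] by blast
  qed
  have yi: "y < i + n" "y < n + i" using yn n_def by auto
  obtain s1 where s1: "arc s1" "pathstart s1 = p (f i)" "pathfinish s1 = p (f x)" "path_image s1 = ?I ?E1"
    using seg[of i x] ix xj jy yi by auto
  obtain s2 where s2: "arc s2" "pathstart s2 = p (f x)" "pathfinish s2 = p (f j)" "path_image s2 = ?I ?E2"
    using seg[of x j] ix xj jy yi by auto
  obtain s3 where s3: "arc s3" "pathstart s3 = p (f j)" "pathfinish s3 = p (f y)" "path_image s3 = ?I ?E3"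
    using seg[of j y] ix xj jy yi by auto
  have "inj_on f {y..n + i}"
  proof -
    have "inj_on f {y..<n + i}"
      using inj by (rule inj_on_subset) (use ix xj jy in auto)
    moreover have "f (n + i) \<notin> f ` {y..<n + i}"
    proof
      assume "f (n + i) \<in> f ` {y..<n + i}"
      then obtain t where "t \<in> {y..<n + i}" "f i = f t" unfolding fn by auto
      then show False using inj_onD[OF inj, of i t] ix xj jy n by auto
    qed
    ultimately show ?thesis
      using yi by (simp add: inj_on_insert atLeastLessThanSuc_atLeastAtMost[symmetric] atLeastLessThanSuc)
  qed
  then obtain s4 where s4: "arc s4" "pathstart s4 = p (f y)" "pathfinish s4 = p (f i)" "path_image s4 = ?I ?E4"
    using path_arc[OF d yi(2) _ E] fn by metis
  obtain d1 where d1: "arc d1" "pathstart d1 = p (f i)" "pathfinish d1 = p (f j)" "path_image d1 = ?I ?D1"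
    using edge_arc[OF d, of "f i" "f j"] D(1) by auto
  obtain d2 where d2: "arc d2" "pathstart d2 = p (f x)" "pathfinish d2 = p (f y)" "path_image d2 = ?I ?D2"
    using edge_arc[OF d, of "f x" "f y"] D(2) by auto
  have sub: "{i..x} \<subseteq> {i..<i + n}" "{x..j} \<subseteq> {i..<i + n}" "{j..y} \<subseteq> {i..<i + n}"
    "insert i {y..<n + i} \<subseteq> {i..<i + n}" "{i, j} \<subseteq> {i..<i + n}" "{x, y} \<subseteq> {i..<i + n}"
    using ix xj jy yi n by auto
  note II = I[OF E E V(1,2) sub(1,2), of x] I[OF E E V(2,3) sub(2,3), of j]
    I[OF E E V(3,4) sub(3,4), of y] I[OF E E V(4,1) sub(4,1), of i]
    I[OF E E V(1,3) sub(1,3), of i] I[OF E E V(2,4) sub(2,4), of i]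
    I[OF D(1) E V(5,1) sub(5,1), of i] I[OF D(1) E V(5,2) sub(5,2), of j]
    I[OF D(1) E V(5,3) sub(5,3), of j] I[OF D(1) E V(5,4) sub(5,4), of i]
    I[OF D(2) E V(6,1) sub(6,1), of x] I[OF D(2) E V(6,2) sub(6,2), of x]
    I[OF D(2) E V(6,3) sub(6,3), of y] I[OF D(2) E V(6,4) sub(6,4), of y]
    I[OF D V(5,6) sub(5,6), of i]
  have sets: "{i..x} \<inter> {x..j} = {x}" "{x..j} \<inter> {j..y} = {j}" "{j..y} \<inter> insert i {y..<n + i} = {y}"
    "insert i {y..<n + i} \<inter> {i..x} = {i}" "{i..x} \<inter> {j..y} = {}" "{x..j} \<inter> insert i {y..<n + i} = {}"
    "{i, j} \<inter> {i..x} = {i}" "{i, j} \<inter> {x..j} = {j}" "{i, j} \<inter> {j..y} = {j}"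
    "{i, j} \<inter> insert i {y..<n + i} = {i}"
    "{x, y} \<inter> {i..x} = {x}" "{x, y} \<inter> {x..j} = {x}" "{x, y} \<inter> {j..y} = {y}"
    "{x, y} \<inter> insert i {y..<n + i} = {y}" "{i, j} \<inter> {x, y} = {}"
    using ix xj jy yi by auto
  note II' = II[unfolded sets, folded s1(4) s2(4) s3(4) s4(4) d1(4) d2(4), simplified]
  have "path_image s1 \<union> path_image s2 \<union> path_image s3 \<union> path_image s4 \<union>
      path_image d1 \<union> path_image d2 \<subseteq> drawing_image G p \<gamma>"
    unfolding s1(4) s2(4) s3(4) s4(4) d1(4) d2(4)
    using path_edges_image_subset[OF d E] path_edges_image_subset[OF d D(1)]
      path_edges_image_subset[OF d D(2)] by simp
  moreover have "p (f t) \<in> frontier (outside (drawing_image G p \<gamma>))" for t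
    using edge[of t] edges_subset_pverts[OF G] fr by blast
  ultimately show False
    by (intro crossing_chords_not_all_exposed[OF s1(1) s2(1) s3(1) s4(1) d1(1) d2(1) s1(2,3) s2(2,3) s3(2,3)
      s4(2,3) d1(2,3) d2(2,3) II'])
qed

section \<open>Colouring the boundary of a face\<close>

text \<open>Colours 0 and 1 are independent sets, and colours 2 and 3 are sets of vertices at pairwise
  distance at least 3. Given that the colouring is proper, the distance condition just says that no
  vertex has two neighbours of the same special colour.\<close>

definition packed :: "('a \<Rightarrow> nat) \<Rightarrow> 'a set \<Rightarrow> bool" where
  "packed c A \<longleftrightarrow> (\<forall>x\<in>A. \<forall>y\<in>A. x \<noteq> y \<longrightarrow> c x = c y \<longrightarrow> c x \<in> {0, 1})"

definition valid_on :: "('a \<Rightarrow> 'a set) \<Rightarrow> nat set \<Rightarrow> ('a \<Rightarrow> nat) \<Rightarrow> 'a set \<Rightarrow> bool" where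
  "valid_on N K c W \<longleftrightarrow> (\<forall>w\<in>W. c w \<in> K \<and> (\<forall>y\<in>N w. c y \<noteq> c w) \<and> packed c (N w))"

text \<open>Outside \<open>I\<close>, only \<open>u\<close> and \<open>v\<close> are meant to have
  neighbours in \<open>I\<close>, hence the two packing conditions. That \<open>u\<close> and
  \<open>v\<close> differ from their neighbours in \<open>I\<close> follows from validity on
  \<open>I\<close> and symmetry.\<close>

definition extends :: "('a \<Rightarrow> 'a set) \<Rightarrow> nat set \<Rightarrow> ('a \<Rightarrow> nat) \<Rightarrow> 'a \<Rightarrow> 'a \<Rightarrow> 'a set \<Rightarrow> bool" where
  "extends N K c u v I \<longleftrightarrow> (\<exists>c'. (\<forall>x. x \<notin> I \<longrightarrow> c' x = c x) \<and> valid_on N K c' I \<and>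
     packed c' (N u) \<and> packed c' (N v))"

text \<open>The face at the edge \<open>uv\<close> has the boundary \<open>u = z 0, z 1, \<dots>, z k, z (k + 1) = v\<close>, and \<open>J t\<close>
  consists of the vertices that lie beyond the boundary edge from \<open>z t\<close> to \<open>z (t + 1)\<close>, as seen from
  this face. As the maximum degree is 3, no two consecutive sets \<open>J t\<close> are nonempty.\<close>

definition face_interior :: "nat \<Rightarrow> (nat \<Rightarrow> 'a) \<Rightarrow> (nat \<Rightarrow> 'a set) \<Rightarrow> 'a set" where
  "face_interior k z J = z ` {1..k} \<union> (\<Union>t\<le>k. J t)"

definition face :: "('a \<Rightarrow> 'a set) \<Rightarrow> 'a \<Rightarrow> 'a \<Rightarrow> nat \<Rightarrow> (nat \<Rightarrow> 'a) \<Rightarrow> (nat \<Rightarrow> 'a set) \<Rightarrow> bool" where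
  "face N u v k z J \<longleftrightarrow> 1 \<le> k \<and> z 0 = u \<and> z (Suc k) = v \<and> inj_on z {..Suc k} \<and>
     (\<forall>t\<le>k. \<forall>s\<le>Suc k. z s \<notin> J t) \<and>
     (\<forall>s\<le>k. \<forall>t\<le>k. s \<noteq> t \<longrightarrow> J s \<inter> J t = {}) \<and>
     (\<forall>t. 1 \<le> t \<longrightarrow> t \<le> k \<longrightarrow> N (z t) \<subseteq> {z (t - 1), z (Suc t)} \<union> J (t - 1) \<union> J t) \<and>
     (\<forall>t\<le>k. \<forall>w\<in>J t. N w \<subseteq> J t \<union> {z t, z (Suc t)}) \<and>
     (\<forall>t<k. J t = {} \<or> J (Suc t) = {}) \<and>
     N u \<inter> face_interior k z J \<subseteq> insert (z 1) (J 0) \<and>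
     N v \<inter> face_interior k z J \<subseteq> insert (z k) (J k)"

lemma faceD:
  assumes "face N u v k z J"
  shows "1 \<le> k" "z 0 = u" "z (Suc k) = v" "inj_on z {..Suc k}"
    "\<And>t s. t \<le> k \<Longrightarrow> s \<le> Suc k \<Longrightarrow> z s \<notin> J t"
    "\<And>s t. s \<le> k \<Longrightarrow> t \<le> k \<Longrightarrow> s \<noteq> t \<Longrightarrow> J s \<inter> J t = {}"
    "\<And>t. 1 \<le> t \<Longrightarrow> t \<le> k \<Longrightarrow> N (z t) \<subseteq> {z (t - 1), z (Suc t)} \<union> J (t - 1) \<union> J t"
    "\<And>t w. t \<le> k \<Longrightarrow> w \<in> J t \<Longrightarrow> N w \<subseteq> J t \<union> {z t, z (Suc t)}"
    "\<And>t. t < k \<Longrightarrow> J t = {} \<or> J (Suc t) = {}"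
    "N u \<inter> face_interior k z J \<subseteq> insert (z 1) (J 0)"
    "N v \<inter> face_interior k z J \<subseteq> insert (z k) (J k)"
  using assms unfolding face_def by simp_all

lemma packed_cong:
  assumes "\<And>x. x \<in> A \<Longrightarrow> c x = c' x"
  shows "packed c A = packed c' A"
  using assms unfolding packed_def by auto

lemma packed_mono: "packed c A \<Longrightarrow> B \<subseteq> A \<Longrightarrow> packed c B"
  unfolding packed_def by blast

lemma packed_le_one_special:
  assumes "\<And>x. x \<in> A \<Longrightarrow> x \<noteq> y \<Longrightarrow> c x \<in> {0, 1}"
  shows "packed c A"
  using assms unfolding packed_def by metis

lemma packed_insert:
  assumes "packed c A" "\<And>x. x \<in> A \<Longrightarrow> x \<noteq> y \<Longrightarrow> c x = c y \<Longrightarrow> c x \<in> {0, 1}"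
  shows "packed c (insert y A)"
  using assms unfolding packed_def by (metis insert_iff)

lemma valid_on_cong:
  assumes "valid_on N K c W" "\<And>w. w \<in> W \<Longrightarrow> c' w = c w" "\<And>w y. w \<in> W \<Longrightarrow> y \<in> N w \<Longrightarrow> c' y = c y"
  shows "valid_on N K c' W"
  unfolding valid_on_def
proof (intro ballI conjI)
  fix w assume w: "w \<in> W"
  show "c' w \<in> K" using assms w unfolding valid_on_def by auto
  show "packed c' (N w)"
    using assms(1) w packed_cong[of "N w" c' c] assms(3)[OF w] unfolding valid_on_def by auto
  fix y assume "y \<in> N w"
  then show "c' y \<noteq> c' w" using assms w unfolding valid_on_def by auto
qed

lemma extends_commute: "extends N K c u v I = extends N K c v u I"
  unfolding extends_def by blast

text \<open>Used to see that filling one \<open>J m\<close> affects no neighbourhoods of boundary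
  vertices other than those of the two ends of its edge.\<close>

lemma face_nbr_J:
  assumes F: "face N u v k z J" and "s \<le> Suc k" "m \<le> k" "N (z s) \<inter> J m \<noteq> {}"
  shows "m = s \<or> Suc m = s"
proof -
  have J: "J m \<subseteq> face_interior k z J" using assms(3) unfolding face_interior_def by auto
  note zn = faceD(5)[OF F assms(3)] and dj = faceD(6)[OF F _ assms(3)]
  obtain y where y: "y \<in> N (z s)" "y \<in> J m" using assms(4) by auto
  show ?thesis
  proof (cases "s = 0 \<or> s = Suc k")
    case True
    then have "y \<in> insert (z 1) (J 0) \<and> s = 0 \<or> y \<in> insert (z k) (J k) \<and> s = Suc k"
      using faceD(2,3,10,11)[OF F] y J by auto
    then show ?thesis
    proof
      assume *: "y \<in> insert (z 1) (J 0) \<and> s = 0"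
      have "y \<noteq> z 1" using y(2) zn[of 1] by auto
      then have "y \<in> J 0" using * by auto
      then have "m = 0" using dj[of 0] y(2) by auto
      then show ?thesis using * by auto
    next
      assume *: "y \<in> insert (z k) (J k) \<and> s = Suc k"
      have "y \<noteq> z k" using y(2) zn[of k] by auto
      then have "y \<in> J k" using * by auto
      then have "m = k" using dj[of k] y(2) by auto
      then show ?thesis using * by auto
    qed
  next
    case False
    then have s: "1 \<le> s" "s \<le> k" using assms(2) by auto
    then have "N (z s) \<subseteq> {z (s - 1), z (Suc s)} \<union> J (s - 1) \<union> J s"
      using faceD(7)[OF F] by auto
    moreover have "y \<noteq> z (s - 1)" "y \<noteq> z (Suc s)"
      using y(2) zn[of "s - 1"] zn[of "Suc s"] s by auto
    ultimately have "y \<in> J (s - 1) \<or> y \<in> J s" using y by auto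
    then have "m = s - 1 \<or> m = s"
    proof
      assume "y \<in> J (s - 1)"
      moreover have "s - 1 \<le> k" using s by simp
      ultimately show ?thesis using dj[of "s - 1"] y(2) by blast
    next
      assume "y \<in> J s"
      then show ?thesis using dj[of s] s y(2) by blast
    qed
    then show ?thesis using s by auto
  qed
qed

text \<open>The pieces are filled one after another. As consecutive pieces are not both nonempty, a
  boundary vertex has neighbours in at most one of them, so later fillings spoil nothing. Earlier
  pieces are already recoloured by then, which is why \<open>h5\<close> is asked for every colouring
  that agrees with \<open>c\<close> off the pieces.\<close>

lemma face_fill:
  assumes F: "face N u v k z J" and sym: "\<And>x y. y \<in> N x \<Longrightarrow> x \<in> N y"
    and h1: "\<And>t. t \<le> k \<Longrightarrow> c (z t) \<noteq> c (z (Suc t))"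
    and h2: "\<And>t. t < k \<Longrightarrow> c (z t) = c (z (Suc (Suc t))) \<Longrightarrow> c (z t) \<in> {0, 1}"
    and h3: "packed c (N u - (\<Union>t\<le>k. J t))" "packed c (N v - (\<Union>t\<le>k. J t))"
    and h4: "\<And>t. 1 \<le> t \<Longrightarrow> t \<le> k \<Longrightarrow> c (z t) \<in> K"
    and h5: "\<And>t c'. t \<le> k \<Longrightarrow> J t \<noteq> {} \<Longrightarrow> (\<forall>x. x \<notin> (\<Union>t\<le>k. J t) \<longrightarrow> c' x = c x) \<Longrightarrow>
      extends N K c' (z t) (z (Suc t)) (J t)"
  shows "\<exists>c'. (\<forall>x. x \<notin> (\<Union>t\<le>k. J t) \<longrightarrow> c' x = c x) \<and> valid_on N K c' (face_interior k z J) \<and>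
    packed c' (N u) \<and> packed c' (N v)"
proof -
  let ?J = "\<Union>t\<le>k. J t"
  note k = faceD(1)[OF F] and zu = faceD(2)[OF F] and zv = faceD(3)[OF F] and zJ = faceD(5)[OF F]
    and dj = faceD(6)[OF F] and Nz = faceD(7)[OF F] and NJ = faceD(8)[OF F] and alt = faceD(9)[OF F]
  \<comment> \<open>For an empty \<open>J t\<close> nothing is demanded at its ends, since they may
    border a piece that is still to be filled.\<close>
  define good where "good = (\<lambda>c' t. valid_on N K c' (J t) \<and>
    (J t \<noteq> {} \<longrightarrow> packed c' (N (z t)) \<and> packed c' (N (z (Suc t)))))"
  have "\<exists>c'. (\<forall>x. x \<notin> ?J \<longrightarrow> c' x = c x) \<and> (\<forall>t<m. good c' t)" if "m \<le> Suc k" for m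
    using that
  proof (induction m)
    case 0
    then show ?case by auto
  next
    case (Suc m)
    have "\<exists>c'. (\<forall>x. x \<notin> ?J \<longrightarrow> c' x = c x) \<and> (\<forall>t<m. good c' t)"
      by (rule Suc.IH) (use Suc.prems in simp)
    then obtain c' where c': "\<forall>x. x \<notin> ?J \<longrightarrow> c' x = c x" "\<forall>t<m. good c' t"
      by blast
    show ?case
    proof (cases "J m = {}")
      case True
      then have "good c' m" by (simp add: good_def valid_on_def)
      then have "\<forall>t<Suc m. good c' t" using c'(2) less_Suc_eq by simp
      then show ?thesis using c'(1) by blast
    next
      case False
      have mk: "m \<le> k" using Suc.prems by simp
      obtain c'' where c'': "\<forall>x. x \<notin> J m \<longrightarrow> c'' x = c' x" "valid_on N K c'' (J m)"
        "packed c'' (N (z m))" "packed c'' (N (z (Suc m)))"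
        using h5[OF mk False c'(1)] unfolding extends_def by blast
      have "good c'' t" if "t < m" for t
      proof -
        have g: "good c' t" using c' that by auto
        have tk: "t \<le> k" "t \<noteq> m" using that mk by auto
        have "valid_on N K c'' (J t)"
        proof (rule valid_on_cong)
          show "valid_on N K c' (J t)" using g by (simp add: good_def)
          show "c'' w = c' w" if "w \<in> J t" for w
            using c''(1) dj[OF tk(1) mk tk(2)] that by auto
          show "c'' y = c' y" if "w \<in> J t" "y \<in> N w" for w y
          proof -
            have "y \<in> J t \<or> y = z t \<or> y = z (Suc t)" using NJ[OF tk(1) that(1)] that(2) by blast
            then have "y \<notin> J m" using dj[OF tk(1) mk tk(2)] zJ[OF mk, of t] zJ[OF mk, of "Suc t"] tk(1) by auto
            then show ?thesis using c''(1) by simp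
          qed
        qed
        moreover have "packed c'' (N (z s))" if "s = t \<or> s = Suc t" "J t \<noteq> {}" for s
        proof -
          have "N (z s) \<inter> J m = {}"
          proof (rule ccontr)
            assume "N (z s) \<inter> J m \<noteq> {}"
            then have "m = s \<or> Suc m = s"
              using face_nbr_J[OF F _ mk, of s] that tk by auto
            then have "m = Suc t" using that(1) \<open>t < m\<close> by auto
            then show False using alt[of t] that(2) False mk by auto
          qed
          then have "packed c'' (N (z s)) = packed c' (N (z s))"
            using c''(1) by (intro packed_cong) blast
          moreover have "packed c' (N (z s))" using g that unfolding good_def by blast
          ultimately show ?thesis by simp
        qed
        ultimately show ?thesis unfolding good_def by blast
      qed
      moreover have "good c'' m" using c'' by (simp add: good_def)
      ultimately have "\<forall>t<Suc m. good c'' t" using less_Suc_eq by simp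
      moreover have "J m \<subseteq> ?J" using mk by auto
      then have "\<forall>x. x \<notin> ?J \<longrightarrow> c'' x = c x" using c'(1) c''(1) by (metis subsetD)
      ultimately show ?thesis by blast
    qed
  qed
  from this[of "Suc k"] obtain c' where c': "\<forall>x. x \<notin> ?J \<longrightarrow> c' x = c x" "\<And>t. t \<le> k \<Longrightarrow> good c' t"
    by (auto simp: less_Suc_eq_le)
  have cz: "c' (z s) = c (z s)" if "s \<le> Suc k" for s
    using c'(1) zJ[OF _ that] by auto
  have ends: "packed c' (N u)" "packed c' (N v)"
  proof -
    show "packed c' (N u)"
    proof (cases "J 0 = {}")
      case True
      have "N u \<inter> J m = {}" if "m \<le> k" for m
      proof (rule ccontr)
        assume *: "\<not> ?thesis"
        then have "m = 0" using face_nbr_J[OF F _ that, of 0] zu by auto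
        then show False using * True by auto
      qed
      then have e: "N u - ?J = N u" by auto
      have "packed c' (N u) = packed c (N u)"
        using c'(1) e by (intro packed_cong) blast
      then show ?thesis using h3(1) e by simp
    next
      case False
      then show ?thesis using c'(2)[of 0] zu by (simp add: good_def)
    qed
    show "packed c' (N v)"
    proof (cases "J k = {}")
      case True
      have "N v \<inter> J m = {}" if "m \<le> k" for m
      proof (rule ccontr)
        assume *: "\<not> ?thesis"
        then have "m = k" using face_nbr_J[OF F _ that, of "Suc k"] zv that by auto
        then show False using * True by auto
      qed
      then have e: "N v - ?J = N v" by auto
      have "packed c' (N v) = packed c (N v)"
        using c'(1) e by (intro packed_cong) blast
      then show ?thesis using h3(2) e by simp
    next
      case False
      then show ?thesis using c'(2)[of k] zv by (simp add: good_def)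
    qed
  qed
  have "valid_on N K c' (face_interior k z J)"
    unfolding valid_on_def
  proof
    fix w assume "w \<in> face_interior k z J"
    then consider t where "t \<le> k" "w \<in> J t" | t where "1 \<le> t" "t \<le> k" "w = z t"
      unfolding face_interior_def by auto
    then show "c' w \<in> K \<and> (\<forall>y\<in>N w. c' y \<noteq> c' w) \<and> packed c' (N w)"
    proof cases
      case 1
      then show ?thesis using c'(2) by (auto simp: good_def valid_on_def)
    next
      case 2
      have p: "packed c' (N w)"
      proof (cases "J t = {} \<and> J (t - 1) = {}")
        case True
        then have "N w \<subseteq> {z (t - 1), z (Suc t)}" using Nz 2 by auto
        moreover have "packed c' {z (t - 1), z (Suc t)}"
          using h2[of "t - 1"] 2 cz[of "t - 1"] cz[of "Suc t"] unfolding packed_def by auto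
        ultimately show ?thesis using packed_mono by blast
      next
        case False
        then show ?thesis
          using c'(2)[of t] c'(2)[of "t - 1"] 2 unfolding good_def by auto
      qed
      have "c' y \<noteq> c' w" if y: "y \<in> N w" for y
      proof (cases "y \<in> ?J")
        case True
        then obtain s where "s \<le> k" "y \<in> J s" by auto
        then have "c' w \<noteq> c' y"
          using c'(2)[of s] sym[OF y] unfolding good_def valid_on_def by auto
        then show ?thesis by simp
      next
        case False
        then have "y \<in> {z (t - 1), z (Suc t)}" using Nz 2 y by fastforce
        moreover have "t - 1 \<le> k" "Suc (t - 1) = t" using 2 by auto
        ultimately show ?thesis
          using h1[of "t - 1"] h1[of t] 2 cz[of "t - 1"] cz[of t] cz[of "Suc t"] by auto
      qed
      then show ?thesis using p h4[of t] 2 cz[of t] by auto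
    qed
  qed
  then show ?thesis using c'(1) ends by blast
qed

text \<open>The boundary of the face is coloured alternately from both ends up to the index \<open>i\<close>, which
  gets the special colour \<open>s\<close>; the choice \<open>i = k + 2\<close> means that no special colour occurs on it.\<close>

lemma face_break:
  assumes F: "face N u v k z J" and sym: "\<And>x y. y \<in> N x \<Longrightarrow> x \<in> N y"
    and J0: "J 0 = {}"
    and s: "s \<notin> {0, 1}" "s \<in> K" "{0, 1} \<subseteq> K" and i: "i \<le> Suc (Suc k)"
    and cu: "if i = 0 then c u = s else c u \<in> {0, 1}"
    and cv: "if i = Suc k then c v = s else c v \<in> {0, 1}"
    and par: "i = Suc (Suc k) \<Longrightarrow> even k \<and> c u \<noteq> c v"
    and pu: "packed c (N u - face_interior k z J)" and pv: "packed c (N v - face_interior k z J)"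
    and ou: "\<And>y. i = 1 \<Longrightarrow> y \<in> N u - face_interior k z J \<Longrightarrow> c y \<noteq> s"
    and ov: "\<And>y. i = k \<Longrightarrow> y \<in> N v - face_interior k z J \<Longrightarrow> c y \<noteq> s"
    and ch: "\<And>t c'. t \<le> k \<Longrightarrow> J t \<noteq> {} \<Longrightarrow> (\<And>x. x \<notin> face_interior k z J \<Longrightarrow> c' x = c x) \<Longrightarrow>
       (\<And>r. r \<le> Suc k \<Longrightarrow> if r = i then c' (z r) = s else c' (z r) \<in> {0, 1}) \<Longrightarrow>
       (\<And>r. r \<le> k \<Longrightarrow> c' (z r) \<noteq> c' (z (Suc r))) \<Longrightarrow>
       extends N K c' (z t) (z (Suc t)) (J t)"
  shows "extends N K c u v (face_interior k z J)"
proof -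
  let ?I = "face_interior k z J"
  note k = faceD(1)[OF F] and zu = faceD(2)[OF F] and zv = faceD(3)[OF F] and inj = faceD(4)[OF F]
    and zJ = faceD(5)[OF F] and Nu = faceD(10)[OF F] and Nv = faceD(11)[OF F]
  \<comment> \<open>Parity is counted from \<open>u\<close> before the break and backwards from
    \<open>v\<close> after it, so that both prescribed end colours are met wherever the break
    is.\<close>
  define col where "col = (\<lambda>t. if t = i then s else if t < i then (if even t then c u else 1 - c u)
    else (if even (Suc k - t) then c v else 1 - c v))"
  define c0 where "c0 = (\<lambda>x. if x \<in> z ` {1..k} then col (inv_into {1..k} z x) else c x)"
  have injk: "inj_on z {1..k}" using inj by (rule inj_on_subset) auto
  have zi: "z 0 \<notin> z ` {1..k}" "z (Suc k) \<notin> z ` {1..k}"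
    using inj unfolding inj_on_def by fastforce+
  \<comment> \<open>Without a break, the alternation starting at \<open>u\<close> has to arrive at
    the colour of \<open>v\<close>, which is what \<open>par\<close> provides.\<close>
  have col_ends: "col 0 = c u" "col (Suc k) = c v"
    using cu cv par i unfolding col_def by (auto split: if_splits)
  have c0z: "c0 (z r) = col r" if "r \<le> Suc k" for r
  proof -
    consider "r = 0" | "r = Suc k" | "1 \<le> r" "r \<le> k" using \<open>r \<le> Suc k\<close> by linarith
    then show ?thesis
    proof cases
      case 3
      then show ?thesis unfolding c0_def using inv_into_f_f[OF injk, of r] by auto
    qed (use zi col_ends zu zv in \<open>auto simp: c0_def\<close>)
  qed
  have c0I: "c0 x = c x" if "x \<notin> ?I" for x
    using that unfolding c0_def face_interior_def by auto
  have col01: "if r = i then col r = s else col r \<in> {0, 1}" if "r \<le> Suc k" for r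
  proof (cases r i rule: linorder_cases)
    case less
    then have "c u \<in> {0, 1}" using cu by (auto split: if_splits)
    then show ?thesis using less by (auto simp: col_def)
  next
    case greater
    then have "c v \<in> {0, 1}" using cv that by (auto split: if_splits)
    then show ?thesis using greater by (auto simp: col_def)
  qed (simp add: col_def)
  have coln: "col r \<noteq> col (Suc r)" if r: "r \<le> k" for r
  proof -
    consider "r = i" | "Suc r = i" | "Suc r < i" | "i < r" by linarith
    then show ?thesis
    proof cases
      case 1
      then show ?thesis using col01[of r] col01[of "Suc r"] s(1) r by auto
    next
      case 2
      then show ?thesis using col01[of r] col01[of "Suc r"] s(1) r by auto
    next
      case 3
      then have "c u \<in> {0, 1}" using cu by (auto split: if_splits)
      then show ?thesis using 3 by (auto simp: col_def)
    next
      case 4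
      then have "c v \<in> {0, 1}" using cv r by (auto split: if_splits)
      moreover have "even (Suc k - r) \<longleftrightarrow> odd (Suc k - Suc r)" using r by auto
      ultimately show ?thesis using 4 by (auto simp: col_def)
    qed
  qed
  have col2: "col r \<in> {0, 1}" if "r < k" "col r = col (Suc (Suc r))" for r
    using col01[of r] col01[of "Suc (Suc r)"] that s(1) by (auto split: if_splits)
  have colK: "col r \<in> K" if "r \<le> Suc k" for r
    using col01[OF that] s by (auto split: if_splits)
  have sub: "N u - (\<Union>t\<le>k. J t) \<subseteq> insert (z 1) (N u - ?I)" "N v - (\<Union>t\<le>k. J t) \<subseteq> insert (z k) (N v - ?I)"
  proof -
    show "N u - (\<Union>t\<le>k. J t) \<subseteq> insert (z 1) (N u - ?I)"
    proof
      fix x assume x: "x \<in> N u - (\<Union>t\<le>k. J t)"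
      show "x \<in> insert (z 1) (N u - ?I)"
        by (cases "x \<in> ?I") (use Nu x in blast)+
    qed
    show "N v - (\<Union>t\<le>k. J t) \<subseteq> insert (z k) (N v - ?I)"
    proof
      fix x assume x: "x \<in> N v - (\<Union>t\<le>k. J t)"
      show "x \<in> insert (z k) (N v - ?I)"
        by (cases "x \<in> ?I") (use Nv x in blast)+
    qed
  qed
  have p3: "packed c0 (N w - (\<Union>t\<le>k. J t))"
    if "N w - (\<Union>t\<le>k. J t) \<subseteq> insert (z r) (N w - ?I)" "packed c (N w - ?I)" "r \<le> Suc k"
      "\<And>y. i = r \<Longrightarrow> y \<in> N w - ?I \<Longrightarrow> c y \<noteq> s" for w r
  proof (rule packed_mono[OF packed_insert that(1)])
    show "packed c0 (N w - ?I)"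
      using that(2) packed_cong[of "N w - ?I" c0 c] c0I by auto
    fix x assume "x \<in> N w - ?I" "c0 x = c0 (z r)"
    then show "c0 x \<in> {0, 1}"
      using that(4)[of x] c0I[of x] c0z[OF that(3)] col01[OF that(3)] by (auto split: if_splits)
  qed
  have IJ: "(\<Union>t\<le>k. J t) \<subseteq> ?I" unfolding face_interior_def by auto
  have "\<exists>c'. (\<forall>x. x \<notin> (\<Union>t\<le>k. J t) \<longrightarrow> c' x = c0 x) \<and> valid_on N K c' ?I \<and>
    packed c' (N u) \<and> packed c' (N v)"
  proof (rule face_fill[OF F sym])
    show "c0 (z t) \<noteq> c0 (z (Suc t))" if "t \<le> k" for t
      using c0z coln that by auto
    show "c0 (z t) \<in> {0, 1}" if "t < k" "c0 (z t) = c0 (z (Suc (Suc t)))" for t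
      using c0z col2 that by auto
    show "packed c0 (N u - (\<Union>t\<le>k. J t))"
      by (rule p3[OF sub(1) pu]) (use ou in auto)
    show "packed c0 (N v - (\<Union>t\<le>k. J t))"
      by (rule p3[OF sub(2) pv]) (use ov in auto)
    show "c0 (z t) \<in> K" if "1 \<le> t" "t \<le> k" for t using c0z colK that by auto
    fix t c' assume t: "t \<le> k" "J t \<noteq> {}" and c': "\<forall>x. x \<notin> (\<Union>t\<le>k. J t) \<longrightarrow> c' x = c0 x"
    have c'z: "c' (z r) = col r" if "r \<le> Suc k" for r
      using c' zJ[OF _ that] c0z[OF that] by auto
    show "extends N K c' (z t) (z (Suc t)) (J t)"
    proof (rule ch[OF t])
      show "c' x = c x" if "x \<notin> ?I" for x
        using c' c0I[OF that] IJ that by (metis subsetD)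
      show "if r = i then c' (z r) = s else c' (z r) \<in> {0, 1}" if "r \<le> Suc k" for r
        unfolding c'z[OF that] by (rule col01[OF that])
      show "c' (z r) \<noteq> c' (z (Suc r))" if "r \<le> k" for r
        using c'z coln[OF that] that by simp
    qed
  qed
  then obtain c' where c': "\<forall>x. x \<notin> (\<Union>t\<le>k. J t) \<longrightarrow> c' x = c0 x" "valid_on N K c' ?I"
    "packed c' (N u)" "packed c' (N v)" by blast
  have "\<forall>x. x \<notin> ?I \<longrightarrow> c' x = c x" using c'(1) c0I IJ by (metis subsetD)
  then show ?thesis using c' unfolding extends_def by blast
qed

section \<open>Colouring one side of a chord\<close>

text \<open>A piece is the part of an outerplanar graph on one side of an edge \<open>uv\<close>; the last argument is
  the set of its vertices other than \<open>u\<close> and \<open>v\<close>.\<close>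

inductive piece :: "('a \<Rightarrow> 'a set) \<Rightarrow> 'a \<Rightarrow> 'a \<Rightarrow> 'a set \<Rightarrow> bool" for N where
  edge: "piece N u v {}"
| face: "face N u v k z J \<Longrightarrow> J 0 = {} \<Longrightarrow> J k = {} \<Longrightarrow> \<forall>t\<le>k. piece N (z t) (z (Suc t)) (J t) \<Longrightarrow>
    piece N u v (face_interior k z J)"

text \<open>Makes the one-sided lemma \<open>face_end_or_outer\<close> available at the other end.
  Vertices are reindexed by \<open>Suc k - t\<close> but edges by \<open>k - t\<close>, as there is
  one vertex more.\<close>

lemma face_rev:
  assumes F: "face N u v k z J"
  shows "face N v u k (\<lambda>t. z (Suc k - t)) (\<lambda>t. J (k - t))"
    "face_interior k (\<lambda>t. z (Suc k - t)) (\<lambda>t. J (k - t)) = face_interior k z J"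
proof -
  have im: "(\<lambda>t. Suc k - t) ` {1..k} = {1..k}"
  proof
    show "{1..k} \<subseteq> (\<lambda>t. Suc k - t) ` {1..k}"
    proof
      fix t assume "t \<in> {1..k}"
      then show "t \<in> (\<lambda>t. Suc k - t) ` {1..k}" by (intro image_eqI[of _ _ "Suc k - t"]) auto
    qed
  qed auto
  have im': "(\<lambda>t. k - t) ` {..k} = {..k}"
  proof
    show "{..k} \<subseteq> (\<lambda>t. k - t) ` {..k}"
    proof
      fix t assume "t \<in> {..k}"
      then show "t \<in> (\<lambda>t. k - t) ` {..k}" by (intro image_eqI[of _ _ "k - t"]) auto
    qed
  qed auto
  have "(\<lambda>t. z (Suc k - t)) ` {1..k} = z ` {1..k}"
    unfolding image_image[of z "\<lambda>t. Suc k - t", symmetric] im ..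
  moreover have "(\<Union>t\<le>k. J (k - t)) = (\<Union>t\<le>k. J t)"
    using arg_cong[OF im', of "\<lambda>A. \<Union> (J ` A)"] by (simp add: image_image)
  ultimately show I: "face_interior k (\<lambda>t. z (Suc k - t)) (\<lambda>t. J (k - t)) = face_interior k z J"
    unfolding face_interior_def by simp
  show "face N v u k (\<lambda>t. z (Suc k - t)) (\<lambda>t. J (k - t))"
    unfolding face_def I
  proof (intro conjI allI impI ballI)
    show "1 \<le> k" "z (Suc k - 0) = v" "z (Suc k - Suc k) = u" using faceD(1-3)[OF F] by auto
    show "inj_on (\<lambda>t. z (Suc k - t)) {..Suc k}"
    proof (rule inj_onI)
      fix s t assume "s \<in> {..Suc k}" "t \<in> {..Suc k}" "z (Suc k - s) = z (Suc k - t)"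
      then show "s = t" using inj_onD[OF faceD(4)[OF F], of "Suc k - s" "Suc k - t"] by auto
    qed
    show "z (Suc k - s) \<notin> J (k - t)" if "t \<le> k" "s \<le> Suc k" for s t
      using faceD(5)[OF F, of "k - t" "Suc k - s"] by auto
    show "J (k - s) \<inter> J (k - t) = {}" if "s \<le> k" "t \<le> k" "s \<noteq> t" for s t
      using faceD(6)[OF F, of "k - s" "k - t"] that by auto
    show "N (z (Suc k - t)) \<subseteq> {z (Suc k - (t - 1)), z (Suc k - Suc t)} \<union> J (k - (t - 1)) \<union> J (k - t)"
      if "1 \<le> t" "t \<le> k" for t
    proof -
      have e: "Suc k - t - 1 = k - t" "Suc (Suc k - t) = Suc k - (t - 1)" "k - (t - 1) = Suc k - t"
        "Suc k - Suc t = k - t"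
        using that by auto
      have "N (z (Suc k - t)) \<subseteq> {z (k - t), z (Suc k - (t - 1))} \<union> J (k - t) \<union> J (Suc k - t)"
        using faceD(7)[OF F, of "Suc k - t"] that unfolding e by fastforce
      then show ?thesis unfolding e by blast
    qed
    show "N w \<subseteq> J (k - t) \<union> {z (Suc k - t), z (Suc k - Suc t)}" if "t \<le> k" "w \<in> J (k - t)" for t w
      using faceD(8)[OF F, of "k - t" w] that by (auto simp: Suc_diff_le)
    show "J (k - t) = {} \<or> J (k - Suc t) = {}" if "t < k" for t
      using faceD(9)[OF F, of "k - Suc t"] that by (auto simp: Suc_diff_Suc)
    show "N v \<inter> face_interior k z J \<subseteq> insert (z (Suc k - 1)) (J (k - 0))"
      "N u \<inter> face_interior k z J \<subseteq> insert (z (Suc k - k)) (J (k - k))"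
      using faceD(10,11)[OF F] by auto
  qed
qed

text \<open>The neighbouring pieces of a nonempty piece are empty, so all outer neighbours of its
  ends lie on the boundary of the face, where the colouring is controlled.\<close>

lemma face_child_nbrs:
  assumes F: "face N u v k z J" and "1 \<le> t" "t < k" "J t \<noteq> {}"
  shows "N (z t) - J t \<subseteq> {z (t - 1), z (Suc t)}" "N (z (Suc t)) - J t \<subseteq> {z t, z (Suc (Suc t))}"
proof -
  have "J (t - 1) = {}" "J (Suc t) = {}"
    using faceD(9)[OF F, of "t - 1"] faceD(9)[OF F, of t] assms(2-4) by auto
  then show "N (z t) - J t \<subseteq> {z (t - 1), z (Suc t)}" "N (z (Suc t)) - J t \<subseteq> {z t, z (Suc (Suc t))}"
    using faceD(7)[OF F, of t] faceD(7)[OF F, of "Suc t"] assms(2,3) by auto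
qed

section \<open>Pieces with one special colour\<close>

text \<open>The following predicates say that every partial colouring can be extended to the piece with
  only one special colour 2, where near the edge \<open>uv\<close> the colour 2 is so far not used at all
  (\<open>plain_ok\<close>), is used for \<open>u\<close> only (\<open>end_ok\<close>), or may be used for any of the outer
  neighbours of \<open>u\<close> and \<open>v\<close> (\<open>outer_ok\<close>).\<close>

definition plain_ok :: "('a \<Rightarrow> 'a set) \<Rightarrow> 'a \<Rightarrow> 'a \<Rightarrow> 'a set \<Rightarrow> bool" where
  "plain_ok N u v I \<longleftrightarrow> (\<forall>c :: 'a \<Rightarrow> nat. c u \<in> {0, 1} \<and> c v \<in> {0, 1} \<and> c u \<noteq> c v \<and>
     (\<forall>y \<in> (N u \<union> N v) - I. c y \<in> {0, 1}) \<longrightarrow> extends N {0, 1, 2} c u v I)"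

definition end_ok :: "('a \<Rightarrow> 'a set) \<Rightarrow> 'a \<Rightarrow> 'a \<Rightarrow> 'a set \<Rightarrow> bool" where
  "end_ok N u v I \<longleftrightarrow> (\<forall>c :: 'a \<Rightarrow> nat. c u = 2 \<and> c v \<in> {0, 1} \<and>
     (\<forall>y \<in> (N u \<union> N v) - I - {u}. c y \<in> {0, 1}) \<longrightarrow> extends N {0, 1, 2} c u v I)"

definition outer_ok :: "('a \<Rightarrow> 'a set) \<Rightarrow> 'a \<Rightarrow> 'a \<Rightarrow> 'a set \<Rightarrow> bool" where
  "outer_ok N u v I \<longleftrightarrow> (\<forall>c :: 'a \<Rightarrow> nat. c u \<in> {0, 1} \<and> c v \<in> {0, 1} \<and> c u \<noteq> c v \<and>
     (\<forall>y \<in> (N u \<union> N v) - I. c y \<in> {0, 1, 2}) \<and> packed c (N u - I) \<and> packed c (N v - I)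
     \<longrightarrow> extends N {0, 1, 2} c u v I)"

text \<open>Neither alternative holds for all pieces. A triangle beyond \<open>uv\<close> violates
  \<open>outer_ok\<close> if \<open>u\<close> has an outer neighbour besides \<open>v\<close>,
  because its tip needs colour 2 once \<open>u\<close> and \<open>v\<close> have the colours 0 and
  1. If such a triangle lies beyond the edge from \<open>z 1\<close> to \<open>z 2\<close>, then
  \<open>end_ok\<close> fails at \<open>u\<close>, because colour 2 on \<open>u\<close> bars it from
  \<open>z 1\<close>, from \<open>z 2\<close> and from the tip.\<close>

definition flexible :: "('a \<Rightarrow> 'a set) \<Rightarrow> 'a \<Rightarrow> 'a \<Rightarrow> 'a set \<Rightarrow> bool" where
  "flexible N u v I \<longleftrightarrow> plain_ok N u v I \<and> (end_ok N u v I \<and> end_ok N v u I \<or> outer_ok N u v I)"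

lemma plain_ok_commute: "plain_ok N u v I \<longleftrightarrow> plain_ok N v u I"
  unfolding plain_ok_def by (subst extends_commute) (auto simp: Un_commute)

lemma outer_ok_commute: "outer_ok N u v I \<longleftrightarrow> outer_ok N v u I"
  unfolding outer_ok_def by (subst extends_commute) (auto simp: Un_commute)

lemma flexible_commute: "flexible N u v I \<longleftrightarrow> flexible N v u I"
  unfolding flexible_def using plain_ok_commute outer_ok_commute by metis

text \<open>When \<open>z i\<close> is the only special vertex of the boundary, a piece sees it at
  an end of its edge (\<open>end_ok\<close>), at an outer neighbour of an end
  (\<open>outer_ok\<close>), or not at all (\<open>plain_ok\<close>).\<close>

lemma face_extends3:
  assumes F: "face N u v k z J" and sym: "\<And>x y. y \<in> N x \<Longrightarrow> x \<in> N y"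
    and J: "J 0 = {}" "J k = {}" and i: "i \<le> Suc (Suc k)"
    and cu: "if i = 0 then c u = 2 else c u \<in> {0, 1}"
    and cv: "if i = Suc k then c v = 2 else c v \<in> {0, 1}"
    and par: "i = Suc (Suc k) \<Longrightarrow> even k \<and> c u \<noteq> c v"
    and pu: "packed c (N u - face_interior k z J)" and pv: "packed c (N v - face_interior k z J)"
    and ou: "\<And>y. i = 1 \<Longrightarrow> y \<in> N u - face_interior k z J \<Longrightarrow> c y \<noteq> 2"
    and ov: "\<And>y. i = k \<Longrightarrow> y \<in> N v - face_interior k z J \<Longrightarrow> c y \<noteq> 2"
    and plain: "\<And>t. t \<le> k \<Longrightarrow> J t \<noteq> {} \<Longrightarrow> plain_ok N (z t) (z (Suc t)) (J t)"
    and e1: "i \<le> k \<Longrightarrow> J i \<noteq> {} \<Longrightarrow> end_ok N (z i) (z (Suc i)) (J i)"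
    and e2: "\<And>t. t \<le> k \<Longrightarrow> i = Suc t \<Longrightarrow> J t \<noteq> {} \<Longrightarrow> end_ok N (z (Suc t)) (z t) (J t)"
    and o1: "Suc i \<le> k \<Longrightarrow> J (Suc i) \<noteq> {} \<Longrightarrow> outer_ok N (z (Suc i)) (z (Suc (Suc i))) (J (Suc i))"
    and o2: "\<And>t. t \<le> k \<Longrightarrow> i = Suc (Suc t) \<Longrightarrow> J t \<noteq> {} \<Longrightarrow> outer_ok N (z t) (z (Suc t)) (J t)"
  shows "extends N {0, 1, 2} c u v (face_interior k z J)"
proof (rule face_break[OF F sym J(1) _ _ _ i cu cv par pu pv ou ov])
  fix t and c' :: "'a \<Rightarrow> nat"
  assume t: "t \<le> k" "J t \<noteq> {}"
    and pat: "\<And>r. r \<le> Suc k \<Longrightarrow> if r = i then c' (z r) = 2 else c' (z r) \<in> {0, 1}"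
    and alt: "\<And>r. r \<le> k \<Longrightarrow> c' (z r) \<noteq> c' (z (Suc r))"
  have t': "1 \<le> t" "t < k" using t J by (cases "t = 0"; cases "t = k"; auto)+
  note nb = face_child_nbrs[OF F t' t(2)]
  have p: "c' (z r) = 2 \<or> c' (z r) = 0 \<or> c' (z r) = 1" "c' (z r) = 2 \<longleftrightarrow> r = i" if "r \<le> Suc k" for r
    using pat[OF that] by (auto split: if_splits)
  have p': "c' (z r) \<in> {0, 1}" if "r \<le> Suc k" "r \<noteq> i" for r
    using pat[OF that(1)] that(2) by simp
  have inj: "z r = z r' \<longleftrightarrow> r = r'" if "r \<le> Suc k" "r' \<le> Suc k" for r r'
    using faceD(4)[OF F] that by (auto dest: inj_onD)
  have le: "t - 1 \<le> Suc k" "t \<le> Suc k" "Suc t \<le> Suc k" "Suc (Suc t) \<le> Suc k" using t' by auto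
  have out: "y = z (t - 1) \<or> y = z t \<or> y = z (Suc t) \<or> y = z (Suc (Suc t))"
    if "y \<in> (N (z t) \<union> N (z (Suc t))) - J t" for y using that nb by blast
  consider "i = t" | "i = Suc t" | "Suc i = t \<or> i = Suc (Suc t)"
    | "i \<noteq> t" "i \<noteq> Suc t" "i \<noteq> t - 1" "i \<noteq> Suc (Suc t)" by linarith
  then show "extends N {0, 1, 2} c' (z t) (z (Suc t)) (J t)"
  proof cases
    case 1
    have "c' y \<in> {0, 1}" if "y \<in> (N (z t) \<union> N (z (Suc t))) - J t - {z t}" for y
      using out[of y] that p'[OF le(1)] p'[OF le(3)] p'[OF le(4)] 1 t' by auto
    then show ?thesis
      using e1 1 t p(2)[OF le(2)] p'[OF le(3)] unfolding end_ok_def by auto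
  next
    case 2
    have "c' y \<in> {0, 1}" if "y \<in> (N (z (Suc t)) \<union> N (z t)) - J t - {z (Suc t)}" for y
      using out[of y] that p'[OF le(1)] p'[OF le(2)] p'[OF le(4)] 2 t' by auto
    then show ?thesis
      using e2[OF t(1) 2 t(2)] 2 p(2)[OF le(3)] p'[OF le(2)] unfolding end_ok_def
      by (subst extends_commute) auto
  next
    case 3
    have "c' y \<in> {0, 1, 2}" if "y \<in> (N (z t) \<union> N (z (Suc t))) - J t" for y
      using out[OF that] p(1)[OF le(1)] p(1)[OF le(2)] p(1)[OF le(3)] p(1)[OF le(4)] by auto
    moreover have "packed c' (N (z t) - J t)"
      by (rule packed_mono[OF packed_le_one_special[where y = "z (t - 1)"] nb(1)])
        (use p'[OF le(3)] 3 t' in auto)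
    moreover have "packed c' (N (z (Suc t)) - J t)"
      by (rule packed_mono[OF packed_le_one_special[where y = "z (Suc (Suc t))"] nb(2)])
        (use p'[OF le(2)] 3 t' in auto)
    moreover have "outer_ok N (z t) (z (Suc t)) (J t)"
      using 3 o1 o2[OF t(1) _ t(2)] t by auto
    ultimately show ?thesis
      using p'[OF le(2)] p'[OF le(3)] 3 alt[OF t(1)] unfolding outer_ok_def by auto
  next
    case 4
    have "c' y \<in> {0, 1}" if "y \<in> (N (z t) \<union> N (z (Suc t))) - J t" for y
      using out[OF that] p'[OF le(1)] p'[OF le(2)] p'[OF le(3)] p'[OF le(4)] 4 by auto
    then show ?thesis
      using plain[OF t] p'[OF le(2)] p'[OF le(3)] 4 alt[OF t(1)] unfolding plain_ok_def by auto
  qed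
qed (use assms in auto)

text \<open>In the next two lemmas, \<open>D\<close> is the set of boundary edges with a nonempty piece, and \<open>S\<close> is the
  set of those whose piece does not satisfy \<open>outer_ok\<close> and hence satisfies \<open>end_ok\<close> from both
  ends. The index \<open>i\<close> is where the special colour is put on an odd boundary path: at the
  right end of an edge in \<open>S\<close> that is not followed by another one, or at a vertex without a piece.\<close>

lemma break_index_plain:
  fixes D S :: "nat \<Rightarrow> bool"
  assumes "odd k" and D: "\<not> D 0" "\<And>t. D t \<Longrightarrow> t < k" "\<And>t. D t \<Longrightarrow> \<not> D (Suc t)" and S: "\<And>t. S t \<Longrightarrow> D t"
  shows "\<exists>i. 1 \<le> i \<and> i \<le> k \<and> \<not> D i \<and> \<not> S (Suc i) \<and>
    (\<forall>t. i = Suc t \<longrightarrow> D t \<longrightarrow> S t) \<and> (\<forall>t. i = Suc (Suc t) \<longrightarrow> \<not> S t)"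
proof (cases "\<exists>t. S t")
  case True
  define t where "t = Max {t. S t}"
  have fin: "finite {t. S t}" by (rule finite_subset[of _ "{..<k}"]) (use S D(2) in auto)
  then have t: "S t" "\<And>r. S r \<Longrightarrow> r \<le> t"
    using True Max_in[of "{t. S t}"] unfolding t_def by auto
  have "\<not> S (Suc (Suc t))" using t(2)[of "Suc (Suc t)"] by auto
  moreover have "\<not> S r" if "t = Suc r" for r using D(3)[of r] S[of r] S[OF t(1)] that by auto
  ultimately show ?thesis
    using t(1) D(2)[OF S[OF t(1)]] D(3)[OF S[OF t(1)]] by (intro exI[of _ "Suc t"]) auto
next
  case False
  obtain m where m: "k = 2 * m + 1" using \<open>odd k\<close> oddE by blast
  \<comment> \<open>Search along the odd edges: a first edge \<open>2 * l + 1\<close> without a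
    piece exists because \<open>k\<close> is odd and edge \<open>k\<close> has none. The edge
    \<open>2 * l\<close> before it is edge 0 or follows an edge with a piece, so it has none
    either.\<close>
  define l where "l = (LEAST l. \<not> D (2 * l + 1))"
  have "\<not> D (2 * m + 1)" using D(2)[of k] m by auto
  then have l: "\<not> D (2 * l + 1)" "l \<le> m" "\<And>r. r < l \<Longrightarrow> D (2 * r + 1)"
    unfolding l_def using LeastI[of "\<lambda>l. \<not> D (2 * l + 1)" m] Least_le[of "\<lambda>l. \<not> D (2 * l + 1)" m]
    by (auto dest: not_less_Least)
  have "\<not> D (2 * l)"
  proof (cases l)
    case (Suc r)
    then show ?thesis using D(3)[OF l(3)[of r]] by simp
  qed (use D in simp)
  then show ?thesis
    by (intro exI[of _ "2 * l + 1"]) (use l m False in auto)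
qed

lemma break_index_outer:
  fixes D S :: "nat \<Rightarrow> bool"
  assumes "odd k" and D: "\<And>t. D t \<Longrightarrow> t < k" "\<And>t. D t \<Longrightarrow> \<not> D (Suc t)" and S: "\<And>t. S t \<Longrightarrow> D t" "S 1"
  shows "\<exists>i. 2 \<le> i \<and> i < k \<and> \<not> D i \<and> \<not> S (Suc i) \<and>
    (\<forall>t. i = Suc t \<longrightarrow> S t) \<and> (\<forall>t. i = Suc (Suc t) \<longrightarrow> \<not> S t)"
proof -
  obtain m where m: "k = 2 * m + 1" using \<open>odd k\<close> oddE by blast
  \<comment> \<open>The run of edges 1, 3, ... in \<open>S\<close> stops before \<open>k\<close>, as
    \<open>k\<close> is odd and edge \<open>k\<close> has no piece. The break \<open>2 * l\<close>
    at its right end satisfies \<open>2 \<le> 2 * l\<close> and \<open>2 * l < k\<close>, so it is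
    adjacent neither to \<open>u\<close> nor to \<open>v\<close>.\<close>
  define l where "l = (LEAST l. \<not> S (2 * l + 1))"
  have "\<not> S (2 * m + 1)" using D(1)[of k] S(1) m by auto
  then have l: "\<not> S (2 * l + 1)" "l \<le> m" "\<And>r. r < l \<Longrightarrow> S (2 * r + 1)"
    unfolding l_def using LeastI[of "\<lambda>l. \<not> S (2 * l + 1)" m] Least_le[of "\<lambda>l. \<not> S (2 * l + 1)" m]
    by (auto dest: not_less_Least)
  obtain r where r: "l = Suc r" using l(1) S(2) by (cases l) auto
  have Sr: "S (2 * r + 1)" using l(3) r by simp
  then have "\<not> D (2 * l)" using D(2)[OF S(1)] r by fastforce
  moreover have "\<not> S (2 * r)" using D(2)[OF S(1), of "2 * r"] S(1)[OF Sr] by auto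
  ultimately show ?thesis
    by (intro exI[of _ "2 * l"]) (use l r m Sr in auto)
qed

text \<open>If the special colour at \<open>u\<close> is a problem, then the first boundary edge off \<open>u\<close> that has a piece
  is in \<open>S\<close>, and the run of consecutive edges in \<open>S\<close> starting there ends at a vertex that is at
  distance at least 3 from all outer neighbours of \<open>u\<close> and \<open>v\<close>.\<close>

lemma face_end_or_outer:
  assumes F: "face N u v k z J" and sym: "\<And>x y. y \<in> N x \<Longrightarrow> x \<in> N y"
    and J: "J 0 = {}" "J k = {}"
    and ch: "\<And>t. t \<le> k \<Longrightarrow> flexible N (z t) (z (Suc t)) (J t)"
  shows "end_ok N u v (face_interior k z J) \<or> outer_ok N u v (face_interior k z J)"
proof (cases "1 \<le> k \<and> J 1 \<noteq> {} \<and> \<not> outer_ok N (z 1) (z (Suc 1)) (J 1)")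
  case False
  let ?I = "face_interior k z J"
  \<comment> \<open>The special vertex \<open>u\<close> itself is the break, with index 0, and the
    rest of the boundary alternates backwards from \<open>v\<close>. Only the piece beyond the edge
    from \<open>z 1\<close> to \<open>z 2\<close> sees colour 2, and in this case it tolerates it on
    an outer neighbour.\<close>
  have "end_ok N u v (?I)"
    unfolding end_ok_def
  proof (intro allI impI)
    fix c :: "'a \<Rightarrow> nat" assume c: "c u = 2 \<and> c v \<in> {0, 1} \<and>
      (\<forall>y\<in>(N u \<union> N v) - ?I - {u}. c y \<in> {0, 1})"
    show "extends N {0, 1, 2} c u v (?I)"
    proof (rule face_extends3[OF F sym J, of 0])
      show "packed c (N u - ?I)" "packed c (N v - ?I)"
        by (rule packed_le_one_special[of _ u], use c in blast)+
    qed (use c False J ch faceD(1)[OF F] in \<open>auto simp: flexible_def\<close>)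
  qed
  then show ?thesis ..
next
  case True
  let ?I = "face_interior k z J"
  define D where "D = (\<lambda>t. t \<le> k \<and> J t \<noteq> {})"
  define S where "S = (\<lambda>t. D t \<and> \<not> outer_ok N (z t) (z (Suc t)) (J t))"
  have D: "D t \<Longrightarrow> t < k" "D t \<Longrightarrow> \<not> D (Suc t)" for t
    using J faceD(9)[OF F, of t] unfolding D_def by (cases "t = k"; auto)+
  have SE: "end_ok N (z t) (z (Suc t)) (J t) \<and> end_ok N (z (Suc t)) (z t) (J t)" if "S t" for t
    using ch[of t] that unfolding S_def D_def flexible_def by auto
  have "outer_ok N u v (?I)"
    unfolding outer_ok_def
  proof (intro allI impI)
    fix c :: "'a \<Rightarrow> nat" assume c: "c u \<in> {0, 1} \<and> c v \<in> {0, 1} \<and> c u \<noteq> c v \<and>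
      (\<forall>y\<in>(N u \<union> N v) - ?I. c y \<in> {0, 1, 2}) \<and>
      packed c (N u - ?I) \<and> packed c (N v - ?I)"
    show "extends N {0, 1, 2} c u v (?I)"
    proof (cases "even k")
      case True
      show ?thesis
        by (rule face_extends3[OF F sym J, of "Suc (Suc k)"])
          (use c True J ch in \<open>auto simp: flexible_def\<close>)
    next
      case odd: False
      have "S 1" using True unfolding S_def D_def by simp
      obtain i where i: "2 \<le> i" "i < k" "\<not> D i" "\<not> S (Suc i)" "\<And>t. i = Suc t \<Longrightarrow> S t"
        "\<And>t. i = Suc (Suc t) \<Longrightarrow> \<not> S t"
        using break_index_outer[where D = D and S = S, OF odd D _ \<open>S 1\<close>] unfolding S_def by blast
      show ?thesis
      proof (rule face_extends3[OF F sym J, of i])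
        show "plain_ok N (z t) (z (Suc t)) (J t)" if "t \<le> k" for t
          using ch[OF that] by (simp add: flexible_def)
        show "end_ok N (z (Suc t)) (z t) (J t)" if "t \<le> k" "i = Suc t" for t
          using SE[OF i(5)[OF that(2)]] by simp
        show "outer_ok N (z (Suc i)) (z (Suc (Suc i))) (J (Suc i))" if "Suc i \<le> k" "J (Suc i) \<noteq> {}"
          using i(4) that unfolding S_def D_def by auto
        show "outer_ok N (z t) (z (Suc t)) (J t)" if "t \<le> k" "i = Suc (Suc t)" "J t \<noteq> {}" for t
          using i(6)[OF that(2)] that unfolding S_def D_def by auto
      qed (use c i in \<open>auto simp: D_def\<close>)
    qed
  qed
  then show ?thesis ..
qed

text \<open>Colour 2 does not yet occur near \<open>uv\<close>, so on an odd boundary the break may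
  even be adjacent to \<open>u\<close> or \<open>v\<close>; \<open>break_index_plain\<close> finds
  one that every piece tolerates.\<close>

lemma face_plain:
  assumes F: "face N u v k z J" and sym: "\<And>x y. y \<in> N x \<Longrightarrow> x \<in> N y"
    and J: "J 0 = {}" "J k = {}"
    and ch: "\<And>t. t \<le> k \<Longrightarrow> flexible N (z t) (z (Suc t)) (J t)"
  shows "plain_ok N u v (face_interior k z J)"
  unfolding plain_ok_def
proof (intro allI impI)
  let ?I = "face_interior k z J"
  define D where "D = (\<lambda>t. t \<le> k \<and> J t \<noteq> {})"
  define S where "S = (\<lambda>t. D t \<and> \<not> outer_ok N (z t) (z (Suc t)) (J t))"
  have D: "\<not> D 0" "D t \<Longrightarrow> t < k" "D t \<Longrightarrow> \<not> D (Suc t)" for t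
    using J faceD(9)[OF F, of t] unfolding D_def by (cases "t = k"; auto)+
  have SE: "end_ok N (z t) (z (Suc t)) (J t) \<and> end_ok N (z (Suc t)) (z t) (J t)" if "S t" for t
    using ch[of t] that unfolding S_def D_def flexible_def by auto
  fix c :: "'a \<Rightarrow> nat" assume c: "c u \<in> {0, 1} \<and> c v \<in> {0, 1} \<and> c u \<noteq> c v \<and>
    (\<forall>y\<in>(N u \<union> N v) - ?I. c y \<in> {0, 1})"
  have p: "packed c (N u - ?I)" "packed c (N v - ?I)"
    by (rule packed_le_one_special[of _ u], use c in blast)+
  have c2: "c y \<noteq> 2" if "y \<in> (N u \<union> N v) - ?I" for y
  proof -
    have "c y \<in> {0, 1}" using c that by blast
    then show ?thesis by auto
  qed
  show "extends N {0, 1, 2} c u v (?I)"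
  proof (cases "even k")
    case True
    show ?thesis
      by (rule face_extends3[OF F sym J, of "Suc (Suc k)"])
        (use c True J ch p in \<open>auto simp: flexible_def\<close>)
  next
    case False
    obtain i where i: "1 \<le> i" "i \<le> k" "\<not> D i" "\<not> S (Suc i)" "\<And>t. i = Suc t \<Longrightarrow> D t \<Longrightarrow> S t"
      "\<And>t. i = Suc (Suc t) \<Longrightarrow> \<not> S t"
      using break_index_plain[OF False D, of S] unfolding S_def by blast
    show ?thesis
    proof (rule face_extends3[OF F sym J, of i])
      show "plain_ok N (z t) (z (Suc t)) (J t)" if "t \<le> k" for t
        using ch[OF that] by (simp add: flexible_def)
      show "end_ok N (z (Suc t)) (z t) (J t)" if "t \<le> k" "i = Suc t" "J t \<noteq> {}" for t
        using SE[OF i(5)[OF that(2)]] that by (simp add: D_def)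
      show "outer_ok N (z (Suc i)) (z (Suc (Suc i))) (J (Suc i))" if "Suc i \<le> k" "J (Suc i) \<noteq> {}"
        using i(4) that unfolding S_def D_def by auto
      show "outer_ok N (z t) (z (Suc t)) (J t)" if "t \<le> k" "i = Suc (Suc t)" "J t \<noteq> {}" for t
        using i(6)[OF that(2)] that unfolding S_def D_def by auto
    qed (use c i p c2 in \<open>auto simp: D_def\<close>)
  qed
qed

lemma extends_empty:
  assumes "packed c (N u)" "packed c (N v)"
  shows "extends N K c u v {}"
  using assms unfolding extends_def valid_on_def by (intro exI[of _ c]) simp

text \<open>\<open>face_end_or_outer\<close> offers its two alternatives at each end separately. As
  \<open>outer_ok\<close> is symmetric, either it holds or \<open>end_ok\<close> holds from both
  ends.\<close>

lemma piece_flexible: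
  assumes "piece N u v I" and sym: "\<And>x y. y \<in> N x \<Longrightarrow> x \<in> N y"
  shows "flexible N u v I"
  using assms(1)
proof induction
  case (edge u v)
  have "plain_ok N u v {}"
    unfolding plain_ok_def
  proof (intro allI impI extends_empty)
    fix c :: "'a \<Rightarrow> nat"
    assume "c u \<in> {0, 1} \<and> c v \<in> {0, 1} \<and> c u \<noteq> c v \<and> (\<forall>y\<in>N u \<union> N v - {}. c y \<in> {0, 1})"
    then have "\<And>y. y \<in> N u \<union> N v \<Longrightarrow> c y \<in> {0, 1}" by simp
    then show "packed c (N u)" "packed c (N v)" unfolding packed_def by simp_all
  qed
  moreover have "outer_ok N u v {}"
    unfolding outer_ok_def by (auto intro!: extends_empty)
  ultimately show ?case by (simp add: flexible_def)
next
  case (face u v k z J)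
  let ?I = "face_interior k z J" and ?z = "\<lambda>t. z (Suc k - t)" and ?J = "\<lambda>t. J (k - t)"
  have ch: "flexible N (z t) (z (Suc t)) (J t)" if "t \<le> k" for t
    using face.IH that by auto
  have ch': "flexible N (?z t) (?z (Suc t)) (?J t)" if "t \<le> k" for t
    using ch[of "k - t"] that by (subst flexible_commute) (auto simp: Suc_diff_le)
  have "end_ok N u v ?I \<or> outer_ok N u v ?I"
    by (rule face_end_or_outer[OF face.hyps(1) sym face.hyps(2,3) ch])
  moreover have "end_ok N v u ?I \<or> outer_ok N v u ?I"
    using face_end_or_outer[OF face_rev(1)[OF face.hyps(1)] sym _ _ ch'] face.hyps(2,3)
    unfolding face_rev(2)[OF face.hyps(1)] by simp
  ultimately show ?case
    using face_plain[OF face.hyps(1) sym face.hyps(2,3) ch] outer_ok_commute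
    unfolding flexible_def by metis
qed

section \<open>Pieces with two special colours\<close>

text \<open>With two special colours, a piece can be coloured whenever only one of them, \<open>s\<close>, occurs near
  the edge \<open>uv\<close>: unless \<open>s\<close> is the colour of \<open>u\<close> or \<open>v\<close>, the next face uses the other one.\<close>

definition four_ok :: "('a \<Rightarrow> 'a set) \<Rightarrow> 'a \<Rightarrow> 'a \<Rightarrow> 'a set \<Rightarrow> bool" where
  "four_ok N u v I \<longleftrightarrow> (\<forall>(c :: 'a \<Rightarrow> nat) s. s \<in> {2, 3} \<and> c u \<noteq> c v \<and>
     (\<forall>y \<in> {u, v} \<union> ((N u \<union> N v) - I). c y \<in> {0, 1, s}) \<and> packed c (N u - I) \<and> packed c (N v - I)
     \<longrightarrow> extends N {0, 1, 2, 3} c u v I)"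

text \<open>Outside its own vertices, a piece sees only the face boundary, and there only the
  special colour \<open>s\<close>. The second alternative for \<open>J k\<close> is meant for a face
  at an edge of the outer cycle: there \<open>v\<close> has no outer neighbour besides
  \<open>u\<close>, so even the last piece sees nothing but the boundary.\<close>

lemma face_extends4:
  assumes F: "face N u v k z J" and sym: "\<And>x y. y \<in> N x \<Longrightarrow> x \<in> N y"
    and J: "J 0 = {}" "J k = {} \<or> N v - face_interior k z J \<subseteq> {u}"
    and i: "i \<le> Suc (Suc k)" and s: "s \<in> {2, 3}"
    and cu: "if i = 0 then c u = s else c u \<in> {0, 1}"
    and cv: "if i = Suc k then c v = s else c v \<in> {0, 1}"
    and par: "i = Suc (Suc k) \<Longrightarrow> even k \<and> c u \<noteq> c v"
    and pu: "packed c (N u - face_interior k z J)" and pv: "packed c (N v - face_interior k z J)"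
    and ou: "\<And>y. i = 1 \<Longrightarrow> y \<in> N u - face_interior k z J \<Longrightarrow> c y \<noteq> s"
    and ov: "\<And>y. i = k \<Longrightarrow> y \<in> N v - face_interior k z J \<Longrightarrow> c y \<noteq> s"
    and ch: "\<And>t. t \<le> k \<Longrightarrow> J t \<noteq> {} \<Longrightarrow> four_ok N (z t) (z (Suc t)) (J t)"
  shows "extends N {0, 1, 2, 3} c u v (face_interior k z J)"
proof (rule face_break[OF F sym J(1) _ _ _ i cu cv par pu pv ou ov])
  fix t and c' :: "'a \<Rightarrow> nat"
  assume t: "t \<le> k" "J t \<noteq> {}"
    and pat: "\<And>r. r \<le> Suc k \<Longrightarrow> if r = i then c' (z r) = s else c' (z r) \<in> {0, 1}"
    and alt: "\<And>r. r \<le> k \<Longrightarrow> c' (z r) \<noteq> c' (z (Suc r))"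
  have t1: "1 \<le> t" using t(2) J by (cases "t = 0") auto
  have nb: "N (z t) - J t \<subseteq> z ` {..Suc k} \<and> N (z (Suc t)) - J t \<subseteq> z ` {..Suc k}"
  proof (cases "t = k")
    case True
    have "J (t - 1) = {}"
      using faceD(9)[OF F, of "t - 1"] t t1 by auto
    then have "N (z t) - J t \<subseteq> {z (t - 1), z (Suc t)}"
      using faceD(7)[OF F, of t] t t1 by auto
    moreover have "N (z (Suc t)) - J t \<subseteq> {z 0, z k}"
      using faceD(2,3,11)[OF F] J(2) True t(2) by auto
    ultimately show ?thesis using t by fastforce
  next
    case False
    then have "t < k" using t by auto
    then show ?thesis
      using face_child_nbrs[OF F t1 \<open>t < k\<close> t(2)] by fastforce
  qed
  have c01: "c' y \<in> {0, 1, s}" "y \<noteq> z i \<Longrightarrow> c' y \<in> {0, 1}" if y: "y \<in> z ` {..Suc k}" for y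
  proof -
    obtain r where r: "r \<le> Suc k" "y = z r" using y by auto
    show "c' y \<in> {0, 1, s}"
      using pat[OF r(1)] unfolding r(2) by (cases "r = i") auto
    show "c' y \<in> {0, 1}" if "y \<noteq> z i"
      using pat[OF r(1)] that unfolding r(2) by (cases "r = i") auto
  qed
  \<comment> \<open>The whole boundary has at most one special vertex, so the packing condition
    holds for every set of boundary vertices.\<close>
  have pk: "packed c' (z ` {..Suc k})"
    by (rule packed_le_one_special[of _ "z i"]) (rule c01(2))
  show "extends N {0, 1, 2, 3} c' (z t) (z (Suc t)) (J t)"
  proof -
    have "\<forall>y \<in> {z t, z (Suc t)} \<union> ((N (z t) \<union> N (z (Suc t))) - J t). c' y \<in> {0, 1, s}"
    proof
      fix y assume "y \<in> {z t, z (Suc t)} \<union> ((N (z t) \<union> N (z (Suc t))) - J t)"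
      then have "y \<in> z ` {..Suc k}" using nb t by auto
      then show "c' y \<in> {0, 1, s}" by (rule c01(1))
    qed
    moreover have "packed c' (N (z t) - J t)" "packed c' (N (z (Suc t)) - J t)"
      using packed_mono[OF pk] nb by blast+
    ultimately show ?thesis
      using ch[OF t] s alt[OF t(1)] unfolding four_ok_def by blast
  qed
qed (use assms in auto)

lemma piece_four_ok:
  assumes "piece N u v I" and sym: "\<And>x y. y \<in> N x \<Longrightarrow> x \<in> N y"
  shows "four_ok N u v I"
  using assms(1)
proof induction
  case (edge u v)
  show ?case unfolding four_ok_def by (auto intro!: extends_empty)
next
  case (face u v k z J)
  let ?I = "face_interior k z J"
  have ch: "four_ok N (z t) (z (Suc t)) (J t)" if "t \<le> k" for t
    using face.IH that by auto
  have J: "J 0 = {}" "J k = {} \<or> N v - ?I \<subseteq> {u}" using face.hyps by auto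
  show ?case
    unfolding four_ok_def
  proof (intro allI impI)
    fix c :: "'a \<Rightarrow> nat" and s :: nat
    assume c: "s \<in> {2, 3} \<and> c u \<noteq> c v \<and> (\<forall>y \<in> {u, v} \<union> ((N u \<union> N v) - ?I). c y \<in> {0, 1, s}) \<and>
      packed c (N u - ?I) \<and> packed c (N v - ?I)"
    then have s: "s \<in> {2, 3}" and uv: "c u \<in> {0, 1, s}" "c v \<in> {0, 1, s}" "c u \<noteq> c v"
      and out: "\<And>y. y \<in> (N u \<union> N v) - ?I \<Longrightarrow> c y \<in> {0, 1, s}"
      and p: "packed c (N u - ?I)" "packed c (N v - ?I)" by blast+
    have k: "1 \<le> k" using faceD(1)[OF face.hyps(1)] .
    note ext = face_extends4[OF face.hyps(1) sym J]
    consider "c u = s" | "c v = s" | "c u \<noteq> s" "c v \<noteq> s" "even k" | "c u \<noteq> s" "c v \<noteq> s" "odd k" by blast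
    then show "extends N {0, 1, 2, 3} c u v ?I"
    proof cases
      case 1
      show ?thesis by (rule ext[of 0 s]) (use 1 s uv p k ch in auto)
    next
      case 2
      show ?thesis by (rule ext[of "Suc k" s]) (use 2 s uv p k ch in auto)
    next
      case 3
      show ?thesis by (rule ext[of "Suc (Suc k)" s]) (use 3 s uv p k ch in auto)
    next
      case 4
      \<comment> \<open>\<open>5 - s\<close> is the other special colour; as it does not occur near
        \<open>uv\<close>, the break can be put right next to \<open>u\<close>.\<close>
      have "c y \<noteq> 5 - s" if "y \<in> (N u \<union> N v) - ?I" for y
        using out[OF that] s by auto
      then show ?thesis by (intro ext[of 1 "5 - s"]) (use 4 s uv p k ch in auto)
    qed
  qed
qed

section \<open>Gluing the two sides of an edge\<close>

text \<open>The second side is extended from the colouring of the first, whose vertices next to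
  \<open>u\<close> and \<open>v\<close> are outer neighbours for the second; \<open>e2\<close> may
  therefore use what is known of that colouring. The first side stays valid because no vertex of
  \<open>I\<close> has a neighbour in \<open>I'\<close>.\<close>

lemma extends_both_sides:
  assumes sym: "\<And>x y. y \<in> N x \<Longrightarrow> x \<in> N y"
    and I: "\<And>w. w \<in> I \<Longrightarrow> N w \<subseteq> I \<union> {u, v}" and I': "\<And>w. w \<in> I' \<Longrightarrow> N w \<subseteq> I' \<union> {u, v}"
    and uv: "u \<notin> I" "v \<notin> I" "u \<notin> I'" "v \<notin> I'" and dj: "I \<inter> I' = {}"
    and Nu: "N u \<subseteq> I \<union> I' \<union> {v}" and Nv: "N v \<subseteq> I \<union> I' \<union> {u}"
    and c: "c u \<noteq> c v" "c u \<in> K" "c v \<in> K"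
    and e1: "extends N K c u v I"
    and e2: "\<And>c'. (\<And>x. x \<notin> I \<Longrightarrow> c' x = c x) \<Longrightarrow> valid_on N K c' I \<Longrightarrow> packed c' (N u) \<Longrightarrow> packed c' (N v) \<Longrightarrow>
      extends N K c' u v I'"
  shows "\<exists>c'. valid_on N K c' (I \<union> I' \<union> {u, v}) \<and> c' u = c u \<and> c' v = c v"
proof -
  obtain c1 where c1: "\<forall>x. x \<notin> I \<longrightarrow> c1 x = c x" "valid_on N K c1 I" "packed c1 (N u)" "packed c1 (N v)"
    using e1 unfolding extends_def by blast
  obtain c2 where c2: "\<forall>x. x \<notin> I' \<longrightarrow> c2 x = c1 x" "valid_on N K c2 I'" "packed c2 (N u)" "packed c2 (N v)"
    using e2[OF _ c1(2-4)] c1(1) unfolding extends_def by blast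
  have ends: "c2 u = c u" "c2 v = c v" using c1(1) c2(1) uv by auto
  have "valid_on N K c2 I"
  proof (rule valid_on_cong[OF c1(2)])
    show "c2 w = c1 w" if "w \<in> I" for w using that c2(1) dj by auto
    show "c2 y = c1 y" if "w \<in> I" "y \<in> N w" for w y
    proof -
      have "y \<in> I \<or> y = u \<or> y = v" using I that by auto
      then have "y \<notin> I'" using dj uv by auto
      then show ?thesis using c2(1) by simp
    qed
  qed
  then have V: "valid_on N K c2 (I \<union> I')" using c2(2) unfolding valid_on_def by auto
  have ne: "c2 y \<noteq> c2 w" if "y \<in> N w" "y \<in> I \<union> I'" for y w
    using V sym[OF that(1)] that(2) unfolding valid_on_def by metis
  have "c2 y \<noteq> c2 u" if "y \<in> N u" for y
    using ne[OF that] Nu that c(1) ends by (cases "y = v") auto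
  moreover have "c2 y \<noteq> c2 v" if "y \<in> N v" for y
    using ne[OF that] Nv that c(1) ends by (cases "y = u") auto
  ultimately have "valid_on N K c2 (I \<union> I' \<union> {u, v})"
    using V c2(3,4) c ends unfolding valid_on_def by auto
  then show ?thesis using ends by blast
qed

text \<open>If one side satisfies \<open>outer_ok\<close>, the other side is coloured first by
  \<open>plain_ok\<close>, and its special vertices next to \<open>u\<close> and \<open>v\<close>
  are tolerated. Otherwise both sides satisfy \<open>end_ok\<close>, and giving \<open>u\<close> the
  special colour serves both.\<close>

lemma flexible_both_sides:
  assumes fl: "flexible N u v I" "flexible N u v I'" and sym: "\<And>x y. y \<in> N x \<Longrightarrow> x \<in> N y"
    and I: "\<And>w. w \<in> I \<Longrightarrow> N w \<subseteq> I \<union> {u, v}" and I': "\<And>w. w \<in> I' \<Longrightarrow> N w \<subseteq> I' \<union> {u, v}"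
    and uv: "u \<notin> I" "v \<notin> I" "u \<notin> I'" "v \<notin> I'" "u \<noteq> v" "u \<in> N v" and dj: "I \<inter> I' = {}"
    and Nu: "N u \<subseteq> I \<union> I' \<union> {v}" and Nv: "N v \<subseteq> I \<union> I' \<union> {u}"
  shows "\<exists>c. valid_on N {0, 1, 2} c (I \<union> I' \<union> {u, v})"
proof -
  have outer: "\<exists>c. valid_on N {0, 1, 2} c (A \<union> B \<union> {u, v})"
    if A: "plain_ok N u v A" "\<And>w. w \<in> A \<Longrightarrow> N w \<subseteq> A \<union> {u, v}" "u \<notin> A" "v \<notin> A"
      and B: "outer_ok N u v B" "\<And>w. w \<in> B \<Longrightarrow> N w \<subseteq> B \<union> {u, v}" "u \<notin> B" "v \<notin> B"
      and AB: "A \<inter> B = {}" "N u \<subseteq> A \<union> B \<union> {v}" "N v \<subseteq> A \<union> B \<union> {u}" for A B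
  proof -
    \<comment> \<open>Only \<open>u\<close> and \<open>v\<close> are really coloured so far; the
      default 0 elsewhere is an ordinary colour and is overwritten on \<open>A\<close> and
      \<open>B\<close>.\<close>
    define c :: "'a \<Rightarrow> nat" where "c = (\<lambda>x. 0)(v := 1)"
    have "\<exists>c'. valid_on N {0, 1, 2} c' (A \<union> B \<union> {u, v}) \<and> c' u = c u \<and> c' v = c v"
    proof (rule extends_both_sides[OF sym A(2) B(2) A(3,4) B(3,4) AB])
      show "extends N {0, 1, 2} c u v A"
        using A(1) uv(5) unfolding plain_ok_def c_def by auto
      fix c' assume c': "\<And>x. x \<notin> A \<Longrightarrow> c' x = c x" "valid_on N {0, 1, 2} c' A"
        "packed c' (N u)" "packed c' (N v)"
      have "c' y \<in> {0, 1, 2}" for y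
        using c'(1)[of y] c'(2) unfolding valid_on_def c_def by (cases "y \<in> A") auto
      moreover have "c' u = 0" "c' v = 1" using c'(1) A uv(5) by (auto simp: c_def)
      ultimately show "extends N {0, 1, 2} c' u v B"
        using B(1) packed_mono[OF c'(3)] packed_mono[OF c'(4)] unfolding outer_ok_def by auto
    qed (use uv in \<open>auto simp: c_def\<close>)
    then show ?thesis by blast
  qed
  consider "outer_ok N u v I'" | "outer_ok N u v I" | "end_ok N u v I" "end_ok N u v I'"
    using fl unfolding flexible_def by blast
  then show ?thesis
  proof cases
    case 1
    then show ?thesis
      by (intro outer[OF _ I uv(1,2) _ I' uv(3,4) dj Nu Nv]) (use fl in \<open>auto simp: flexible_def\<close>)
  next
    case 2
    have "\<exists>c. valid_on N {0, 1, 2} c (I' \<union> I \<union> {u, v})"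
      by (rule outer[OF _ I' uv(3,4) _ I uv(1,2)])
        (use fl 2 dj Nu Nv in \<open>auto simp: flexible_def\<close>)
    then show ?thesis by (simp add: Un_commute)
  next
    case 3
    define c :: "'a \<Rightarrow> nat" where "c = (\<lambda>x. 0)(u := 2)"
    have "\<exists>c'. valid_on N {0, 1, 2} c' (I \<union> I' \<union> {u, v}) \<and> c' u = c u \<and> c' v = c v"
    proof (rule extends_both_sides[OF sym I I' uv(1-4) dj Nu Nv])
      show "extends N {0, 1, 2} c u v I"
        using 3(1) uv(5) unfolding end_ok_def c_def by auto
      fix c' assume c': "\<And>x. x \<notin> I \<Longrightarrow> c' x = c x" "valid_on N {0, 1, 2} c' I"
        "packed c' (N u)" "packed c' (N v)"
      have e: "c' u = 2" "c' v = 0" using c'(1) uv by (auto simp: c_def)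
      \<comment> \<open>On the side already coloured, a neighbour of \<open>u\<close> avoids colour
        2 by properness, and a neighbour of \<open>v\<close> avoids it by the packing condition at
        \<open>v\<close>, because \<open>u\<close> is a neighbour of \<open>v\<close> with colour
        2.\<close>
      have "c' y \<in> {0, 1}" if "y \<in> (N u \<union> N v) - I' - {u}" for y
      proof (cases "y \<in> I")
        case True
        then have y: "c' y \<in> {0, 1, 2}" "\<And>x. x \<in> N y \<Longrightarrow> c' x \<noteq> c' y"
          using c'(2) unfolding valid_on_def by auto
        have "c' y \<noteq> 2"
        proof (cases "y \<in> N u")
          case True
          then show ?thesis using y(2)[OF sym] e by auto
        next
          case False
          then have "y \<in> N v" using that by auto
          then show ?thesis using c'(4) uv(6) that e(1) unfolding packed_def by force
        qed
        then show ?thesis using y by auto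
      next
        case False
        then show ?thesis using c'(1) that by (auto simp: c_def)
      qed
      then show "extends N {0, 1, 2} c' u v I'"
        using 3(2) e unfolding end_ok_def by auto
    qed (use uv in \<open>auto simp: c_def\<close>)
    then show ?thesis by blast
  qed
qed

text \<open>Here \<open>uv\<close> is an edge of the outer cycle with everything on one side.
  \<open>J k\<close> may be nonempty, as \<open>v\<close> may have a chord, while \<open>J 0\<close>
  is empty because the root \<open>u\<close> will have degree 2.\<close>

lemma face_rooted_coloring:
  assumes F: "face N u v k z J" and sym: "\<And>x y. y \<in> N x \<Longrightarrow> x \<in> N y"
    and J: "J 0 = {}" and p: "\<And>t. t \<le> k \<Longrightarrow> piece N (z t) (z (Suc t)) (J t)"
    and I: "\<And>w. w \<in> face_interior k z J \<Longrightarrow> N w \<subseteq> face_interior k z J \<union> {u, v}"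
    and uv: "u \<notin> face_interior k z J" "v \<notin> face_interior k z J"
    and Nu: "N u \<subseteq> face_interior k z J \<union> {v}" and Nv: "N v \<subseteq> face_interior k z J \<union> {u}"
  shows "\<exists>c. valid_on N {0, 1, 2, 3} c (face_interior k z J \<union> {u, v}) \<and> c u = 0 \<and> c v = 1"
proof -
  let ?I = "face_interior k z J"
  define c :: "'a \<Rightarrow> nat" where "c = (\<lambda>x. 0)(v := 1)"
  have k: "1 \<le> k" using faceD(1)[OF F] .
  have ne: "u \<noteq> v" using faceD(2-4)[OF F] unfolding inj_on_def by force
  then have cuv: "c u = 0" "c v = 1" by (auto simp: c_def)
  have pk: "packed c A" for A unfolding packed_def c_def by auto
  have ch: "four_ok N (z t) (z (Suc t)) (J t)" if "t \<le> k" for t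
    using piece_four_ok[OF p[OF that] sym] .
  have "J k = {} \<or> N v - ?I \<subseteq> {u}" using Nv by auto
  note ext = face_extends4[OF F sym J this]
  have "extends N {0, 1, 2, 3} c u v ?I"
  proof (cases "even k")
    case True
    show ?thesis by (rule ext[of "Suc (Suc k)" 2]) (use True k ne pk ch in \<open>auto simp: c_def\<close>)
  next
    case False
    show ?thesis by (rule ext[of 1 2]) (use False k ne pk ch in \<open>auto simp: c_def\<close>)
  qed
  then have "\<exists>c'. valid_on N {0, 1, 2, 3} c' (?I \<union> {} \<union> {u, v}) \<and> c' u = c u \<and> c' v = c v"
    by (intro extends_both_sides[OF sym I _ uv])
      (use Nu Nv cuv in \<open>auto intro!: extends_empty\<close>)
  then show ?thesis using cuv by simp
qed

section \<open>Hamiltonian outerplanar graphs\<close>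

lemma cycle_rotate:
  assumes "cycle N cs"
  shows "cycle N (rotate m cs)"
proof -
  let ?n = "length cs"
  have n: "distinct cs" "3 \<le> ?n" and adj: "\<And>i. i < ?n \<Longrightarrow> cs ! (Suc i mod ?n) \<in> N (cs ! i)"
    using assms unfolding cycle_def by auto
  have "rotate m cs ! (Suc i mod ?n) \<in> N (rotate m cs ! i)" if "i < ?n" for i
  proof -
    have p: "0 < ?n" using n by auto
    then have "rotate m cs ! (Suc i mod ?n) = cs ! ((m + Suc i) mod ?n)"
      by (simp add: nth_rotate mod_add_right_eq)
    also have "(m + Suc i) mod ?n = Suc ((m + i) mod ?n) mod ?n" by (simp add: mod_Suc_eq)
    finally show ?thesis
      using adj[of "(m + i) mod ?n"] p that by (simp add: nth_rotate)
  qed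
  then show ?thesis using n unfolding cycle_def by simp
qed

locale outer_graph =
  fixes W :: "'a set" and N :: "'a \<Rightarrow> 'a set"
  assumes finite_W: "finite W" and N_sub: "N w \<subseteq> W" and sym: "y \<in> N x \<Longrightarrow> x \<in> N y"
    and irr: "x \<notin> N x" and deg: "card (N x) \<le> 3"
    and theta: "theta_free N" and noncrossing: "chords_noncrossing N"

locale ham_graph = outer_graph +
  fixes cs assumes cyc: "cycle N cs" and set_cs: "set cs = W"
begin

definition n where "n = length cs"

abbreviation p where "p \<equiv> nth cs"

text \<open>With neighbours as positions on the cycle, the sides of a chord become intervals and
  noncrossing becomes a statement about the order.\<close>

definition A where "A q = {y. y < n \<and> p y \<in> N (p q)}"

lemma n3: "3 \<le> n" and dist: "distinct cs"
  using cyc unfolding cycle_def n_def by auto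

lemma p_inj: "q < n \<Longrightarrow> q' < n \<Longrightarrow> p q = p q' \<longleftrightarrow> q = q'"
  using dist unfolding n_def by (simp add: nth_eq_iff_index_eq)

lemma W_p: "W = p ` {..<n}"
  using set_cs unfolding n_def by (auto simp: in_set_conv_nth)

lemma N_A: "q < n \<Longrightarrow> N (p q) = p ` A q"
  using N_sub W_p unfolding A_def by auto

lemma A_sym: "q < n \<Longrightarrow> y \<in> A q \<Longrightarrow> q \<in> A y"
  using sym unfolding A_def by auto

lemma A_irr: "q \<notin> A q"
  using irr unfolding A_def by auto

lemma A_less: "y \<in> A q \<Longrightarrow> y < n"
  unfolding A_def by auto

lemma A_fin: "finite (A q)"
  unfolding A_def by auto

lemma card_A: "q < n \<Longrightarrow> card (A q) \<le> 3"
proof -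
  assume q: "q < n"
  have "inj_on p (A q)" using p_inj A_less by (auto intro!: inj_onI)
  then show ?thesis using deg[of "p q"] N_A[OF q] card_image by fastforce
qed

lemma A_Suc: "Suc q < n \<Longrightarrow> Suc q \<in> A q"
  using cyc unfolding cycle_def A_def n_def by (metis Suc_lessD mod_less mem_Collect_eq)

lemma A_pred: "0 < q \<Longrightarrow> q < n \<Longrightarrow> q - 1 \<in> A q"
  using A_Suc[of "q - 1"] A_sym[of "q - 1" q] by auto

lemma A_wrap: "0 \<in> A (n - 1)" "n - 1 \<in> A 0"
proof -
  have "p (Suc (n - 1) mod n) \<in> N (p (n - 1))"
    using cyc n3 unfolding cycle_def n_def by auto
  then show "0 \<in> A (n - 1)" using n3 unfolding A_def by simp
  then show "n - 1 \<in> A 0" using A_sym[of "n - 1" 0] n3 by auto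
qed

lemma A_noncrossing: "i < x \<Longrightarrow> x < j \<Longrightarrow> j < y \<Longrightarrow> j \<in> A i \<Longrightarrow> y \<in> A x \<Longrightarrow> False"
  using noncrossing cyc unfolding chords_noncrossing_def A_def n_def by blast

text \<open>An edge from \<open>w\<close> out of the interval would cross the chord.\<close>

lemma chord_closed:
  assumes "j \<in> A i" "i < w" "w < j" "y \<in> A w"
  shows "i \<le> y \<and> y \<le> j"
proof (rule ccontr)
  assume "\<not> ?thesis"
  then consider "y < i" | "j < y" by linarith
  then show False
  proof cases
    case 1
    have "w \<in> A y" using A_sym[of w y] assms(3,4) A_less[OF assms(1)] by auto
    then show ?thesis using A_noncrossing[of y i w j] 1 assms by blast
  next
    case 2
    then show ?thesis using A_noncrossing[of i w j y] assms by blast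
  qed
qed

lemma card_le_3_eq: "finite S \<Longrightarrow> card S \<le> 3 \<Longrightarrow> {a, b, c} \<subseteq> S \<Longrightarrow> a \<noteq> b \<Longrightarrow> b \<noteq> c \<Longrightarrow> a \<noteq> c \<Longrightarrow> S = {a, b, c}"
  by (rule card_seteq[symmetric]) (simp_all add: card_insert_if)

text \<open>Besides the chord and the cycle edge that leaves the interval, the degree bound leaves
  each end only its cycle neighbour inside. This makes the first and the last piece of the face at
  the chord empty.\<close>

lemma chord_ends:
  assumes "j \<in> A i" "i + 2 \<le> j" "\<not> (i = 0 \<and> j = n - 1)"
  shows "A i \<inter> {i<..<j} = {Suc i}" "A j \<inter> {i<..<j} = {j - 1}"
proof -
  have j: "j < n" using A_less assms(1) by auto
  define i' where "i' = (if i = 0 then n - 1 else i - 1)"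
  have "i' \<in> A i" using A_wrap A_pred[of i] j assms(2) unfolding i'_def by auto
  moreover have "i' < i \<or> j < i'" using assms j n3 unfolding i'_def by auto
  moreover have "Suc i \<in> A i" "i < n" using A_Suc[of i] assms(2) j by auto
  moreover have "Suc i \<noteq> i'" "i' \<noteq> j" "Suc i \<noteq> j" using \<open>i' < i \<or> j < i'\<close> assms(2) by auto
  ultimately have "A i = {Suc i, i', j}"
    using assms(1) by (intro card_le_3_eq A_fin card_A) simp_all
  then have *: "A i \<inter> {i<..<j} = {Suc i, i', j} \<inter> {i<..<j}" by simp
  show "A i \<inter> {i<..<j} = {Suc i}"
    unfolding * using \<open>i' < i \<or> j < i'\<close> assms(2) by auto
  define j' where "j' = (if j = n - 1 then 0 else Suc j)"
  have "j' \<in> A j" using A_wrap A_Suc[of j] j unfolding j'_def by auto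
  moreover have "j' < i \<or> j < j'" using assms j n3 unfolding j'_def by auto
  moreover have "i \<in> A j" using A_sym[OF _ assms(1)] assms(2) j by auto
  moreover have "j - 1 \<in> A j" using A_pred[of j] j assms(2) by auto
  moreover have "j - 1 \<noteq> j'" "j' \<noteq> i" "j - 1 \<noteq> i" using \<open>j' < i \<or> j < j'\<close> assms(2) by auto
  ultimately have "A j = {j - 1, j', i}"
    using j by (intro card_le_3_eq A_fin card_A) simp_all
  then have *: "A j \<inter> {i<..<j} = {j - 1, j', i} \<inter> {i<..<j}" by simp
  show "A j \<inter> {i<..<j} = {j - 1}"
    unfolding * using \<open>j' < i \<or> j < j'\<close> assms(2) by auto
qed

text \<open>The boundary of the face at a chord from \<open>i\<close> to \<open>j\<close> is found by always jumping to the furthest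
  neighbour up to \<open>j\<close>.\<close>

lemma jump_chain:
  assumes "j < n" "s \<le> j"
  shows "\<exists>k z. z 0 = s \<and> z k = j \<and>
    (\<forall>t<k. z t < z (Suc t) \<and> z (Suc t) \<in> A (z t) \<and> z (Suc t) \<le> j \<and> (\<forall>y\<in>A (z t). y \<le> j \<longrightarrow> y \<le> z (Suc t)))"
  using assms(2)
proof (induction "j - s" arbitrary: s rule: less_induct)
  case less
  show ?case
  proof (cases "s = j")
    case True
    then show ?thesis by (intro exI[of _ 0] exI[of _ "\<lambda>_. j"]) auto
  next
    case False
    then have s: "s < j" using less.prems by auto
    define m where "m = Max {y \<in> A s. y \<le> j}"
    have fin: "finite {y \<in> A s. y \<le> j}" using A_fin by auto
    have mem: "Suc s \<in> {y \<in> A s. y \<le> j}" using A_Suc s assms(1) by auto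
    then have "m \<in> {y \<in> A s. y \<le> j}" unfolding m_def using Max_in[OF fin] by blast
    moreover have "Suc s \<le> m" unfolding m_def using Max_ge[OF fin mem] .
    moreover have mx: "\<forall>y\<in>A s. y \<le> j \<longrightarrow> y \<le> m" unfolding m_def using Max_ge[OF fin] by auto
    ultimately have m: "m \<in> A s" "m \<le> j" "s < m" by auto
    obtain k z where z: "z 0 = m" "z k = j"
      "\<forall>t<k. z t < z (Suc t) \<and> z (Suc t) \<in> A (z t) \<and> z (Suc t) \<le> j \<and> (\<forall>y\<in>A (z t). y \<le> j \<longrightarrow> y \<le> z (Suc t))"
      using less.hyps[OF _ m(2)] m s by (metis diff_less_mono2)
    show ?thesis
    proof (intro exI conjI)
      show "case_nat s z 0 = s" "case_nat s z (Suc k) = j" using z by auto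
      show "\<forall>t<Suc k. case_nat s z t < case_nat s z (Suc t) \<and> case_nat s z (Suc t) \<in> A (case_nat s z t) \<and>
        case_nat s z (Suc t) \<le> j \<and> (\<forall>y\<in>A (case_nat s z t). y \<le> j \<longrightarrow> y \<le> case_nat s z (Suc t))"
      proof (intro allI impI)
        fix t assume "t < Suc k"
        then show "case_nat s z t < case_nat s z (Suc t) \<and> case_nat s z (Suc t) \<in> A (case_nat s z t) \<and>
          case_nat s z (Suc t) \<le> j \<and> (\<forall>y\<in>A (case_nat s z t). y \<le> j \<longrightarrow> y \<le> case_nat s z (Suc t))"
          using m mx z by (cases t) auto
      qed
    qed
  qed
qed

text \<open>The chain of jumps starts at \<open>Suc i\<close>, because from \<open>i\<close> itself
  the furthest jump up to \<open>j\<close> is the edge to \<open>j\<close>. What a jump skips lies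
  behind a chord with a shorter interval, which drives the induction in
  \<open>chord_piece\<close>.\<close>

lemma interval_face:
  assumes ij: "i + 2 \<le> j" and jA: "j \<in> A i" and Ai: "A i \<inter> {i<..<j} = {Suc i}"
  obtains k z J where "face N (p i) (p j) k z J" "J 0 = {}"
    "face_interior k z J = p ` {i<..<j}"
    "\<And>t. t \<le> k \<Longrightarrow> J t = {} \<or> (\<exists>q q'. z t = p q \<and> z (Suc t) = p q' \<and> J t = p ` {q<..<q'} \<and>
      q + 2 \<le> q' \<and> q' - q < j - i \<and> q' \<in> A q)"
    "A j \<inter> {i<..<j} \<subseteq> {j - 1} \<Longrightarrow> J k = {}"
proof -
  have jn: "j < n" using A_less[OF jA] .
  obtain k z' where z': "z' 0 = Suc i" "z' k = j" and z'_step: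
    "\<And>t. t < k \<Longrightarrow> z' t < z' (Suc t) \<and> z' (Suc t) \<in> A (z' t) \<and> z' (Suc t) \<le> j \<and> (\<forall>y\<in>A (z' t). y \<le> j \<longrightarrow> y \<le> z' (Suc t))"
    using jump_chain[OF jn, of "Suc i"] ij by auto
  have k: "1 \<le> k" using z' ij by (cases k) auto
  define z where "z = case_nat i z'"
  have z0: "z 0 = i" and z1: "z 1 = Suc i" and zk: "z (Suc k) = j"
    using z' unfolding z_def by auto
  have step: "z t < z (Suc t)" "z (Suc t) \<in> A (z t)" if "t \<le> k" for t
  proof -
    have "z t < z (Suc t) \<and> z (Suc t) \<in> A (z t)"
      using that z' z'_step[of "t - 1"] A_Suc[of i] ij jn unfolding z_def by (cases t) auto
    then show "z t < z (Suc t)" "z (Suc t) \<in> A (z t)" by auto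
  qed
  have far: "y \<le> z (Suc t)" if "1 \<le> t" "t \<le> k" "y \<in> A (z t)" "y \<le> j" for t y
    using that z'_step[of "t - 1"] unfolding z_def by (cases t) auto
  have mono: "z s < z t" if "s < t" "t \<le> Suc k" for s t
    using that
  proof (induction t)
    case (Suc t)
    then show ?case using step(1)[of t] by (cases "s = t") auto
  qed simp
  have mono': "z s \<le> z t" if "s \<le> t" "t \<le> Suc k" for s t
    using mono[of s t] that by (cases "s = t") auto
  have zj: "z t \<le> j" "i \<le> z t" "z t < n" if "t \<le> Suc k" for t
    using mono'[of t "Suc k"] mono'[of 0 t] that zk z0 jn by auto
  have inner: "i < z t" "z t < j" if "1 \<le> t" "t \<le> k" for t
    using mono[of t "Suc k"] mono[of 0 t] that zk z0 by auto
  have locate: "\<exists>t\<le>m. z t \<le> y \<and> y < z (Suc t)" if "i \<le> y" "y < z (Suc m)" for y m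
    using that
  proof (induction m)
    case 0
    then show ?case using z0 by auto
  next
    case (Suc m)
    then show ?case by (cases "y < z (Suc m)") (auto intro: le_SucI)
  qed
  \<comment> \<open>Suppose that an edge goes from \<open>z t\<close> back to some \<open>y\<close>
    before \<open>z (t - 1)\<close>. If \<open>y\<close> is a boundary vertex, then the jump from
    \<open>y\<close> was not the furthest one; otherwise the edge crosses the chord that skips
    \<open>y\<close>.\<close>
  have left: "z (t - 1) \<le> y" if t: "1 \<le> t" "t \<le> Suc k" and y: "y \<in> A (z t)" "i < y" "y < z t" for t y
  proof (rule ccontr)
    assume "\<not> ?thesis"
    then have "y < z (t - 1)" by simp
    then have "t - 1 \<noteq> 0" using y(2) z0 by (metis not_less_iff_gr_or_eq)
    then obtain m where m: "t = Suc (Suc m)" by (metis One_nat_def Suc_pred gr0I t(1) Suc_le_lessD)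
    then obtain s where s: "s \<le> m" "z s \<le> y" "y < z (Suc s)"
      using locate[of y m] \<open>y < z (t - 1)\<close> y(2) by auto
    have lt: "z (Suc s) < z t" using mono[of "Suc s" t] s m t by auto
    show False
    proof (cases "z s = y")
      case True
      have "1 \<le> s" using True y(2) z0 by (cases s) auto
      have "z t \<in> A (z s)" using A_sym[of "z t" y] y(1) zj(3)[OF t(2)] True by simp
      then have "z t \<le> z (Suc s)" using far[of s "z t"] \<open>1 \<le> s\<close> s m t zj(1)[OF t(2)] by auto
      then show ?thesis using lt by simp
    next
      case False
      have "z t \<in> A y" using A_sym[of "z t" y] y(1) zj(3)[OF t(2)] by simp
      then show ?thesis
        using A_noncrossing[of "z s" y "z (Suc s)" "z t"] False s lt step(2)[of s] m t by auto
    qed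
  qed
  define J where "J = (\<lambda>t. p ` {z t<..<z (Suc t)})"
  have Jmem: "p y \<in> J t \<longleftrightarrow> z t < y \<and> y < z (Suc t)" if "t \<le> k" "y < n" for t y
    using that p_inj zj(3)[of "Suc t"] unfolding J_def by (auto simp: image_iff)
  have I: "face_interior k (\<lambda>t. p (z t)) J = p ` {i<..<j}"
  proof
    have "(\<lambda>t. p (z t)) ` {1..k} \<subseteq> p ` {i<..<j}" using inner by auto
    moreover have "J t \<subseteq> p ` {i<..<j}" if "t \<le> k" for t
      using zj(2)[of t] zj(1)[of "Suc t"] that unfolding J_def by (intro image_mono) auto
    ultimately show "face_interior k (\<lambda>t. p (z t)) J \<subseteq> p ` {i<..<j}"
      unfolding face_interior_def by blast
    show "p ` {i<..<j} \<subseteq> face_interior k (\<lambda>t. p (z t)) J"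
    proof
      fix x assume "x \<in> p ` {i<..<j}"
      then obtain y where y: "x = p y" "i < y" "y < j" by auto
      then obtain t where t: "t \<le> k" "z t \<le> y" "y < z (Suc t)" using locate[of y k] zk by auto
      show "x \<in> face_interior k (\<lambda>t. p (z t)) J"
      proof (cases "z t = y")
        case True
        then have "1 \<le> t" using y(2) z0 by (cases t) auto
        then have "x \<in> (\<lambda>t. p (z t)) ` {1..k}" using True y t by auto
        then show ?thesis unfolding face_interior_def by blast
      next
        case False
        then have "x \<in> J t" using t y by (auto simp: J_def)
        then show ?thesis using t unfolding face_interior_def by blast
      qed
    qed
  qed
  have between: "p y \<in> {p (z (t - 1)), p (z (Suc t))} \<union> J (t - 1) \<union> J t"
    if t: "1 \<le> t" "t \<le> k" and y: "y \<in> A (z t)" for t y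
  proof -
    have yij: "i \<le> y \<and> y \<le> j" using chord_closed[OF jA inner[OF t] y] .
    have le: "y \<le> z (Suc t)" using far[OF t y] yij by auto
    have ge: "z (t - 1) \<le> y"
    proof (cases "y = i \<or> z t \<le> y")
      case True
      then show ?thesis
      proof
        assume yi: "y = i"
        then have "z t \<in> A i" using A_sym[of "z t" y] y zj(3)[of t] t by auto
        then have "z t \<in> {Suc i}" using inner[OF t] unfolding Ai[symmetric] by auto
        then have "t = 1" using mono[of 1 t] z1 t by (cases "t = 1") auto
        then show ?thesis using yi z0 by simp
      next
        assume "z t \<le> y"
        then show ?thesis using mono'[of "t - 1" t] t by auto
      qed
    next
      case False
      then show ?thesis using left[of t y] t y yij by auto
    qed
    have "y \<noteq> z t" using y A_irr by auto
    then consider "y = z (t - 1)" | "y = z (Suc t)" | "z (t - 1) < y" "y < z t" | "z t < y" "y < z (Suc t)"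
      using le ge by linarith
    then show ?thesis using t by cases (auto simp: J_def)
  qed
  have F: "face N (p i) (p j) k (\<lambda>t. p (z t)) J"
    unfolding face_def I
  proof (intro conjI allI impI ballI)
    show "1 \<le> k" "p (z 0) = p i" "p (z (Suc k)) = p j" using k z0 zk by auto
    show "inj_on (\<lambda>t. p (z t)) {..Suc k}"
    proof (rule linorder_inj_onI')
      fix s t assume "s \<in> {..Suc k}" "t \<in> {..Suc k}" "s < t"
      then show "p (z s) \<noteq> p (z t)" using mono[of s t] p_inj zj(3)[of s] zj(3)[of t] by auto
    qed
    show "p (z s) \<notin> J t" if "t \<le> k" "s \<le> Suc k" for s t
      using Jmem[OF that(1) zj(3)[OF that(2)]] mono'[of s t] mono'[of "Suc t" s] that by (cases "s \<le> t") auto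
    have dj: "J s \<inter> J t = {}" if "s < t" "t \<le> k" for s t
    proof (rule ccontr)
      assume "\<not> ?thesis"
      then obtain x where "x \<in> J s" "x \<in> J t" by blast
      from this(1) obtain y where "x = p y" and y: "z s < y" "y < z (Suc s)" unfolding J_def by auto
      with \<open>x \<in> J t\<close> have yt: "p y \<in> J t" by simp
      have "y < n" using y(2) zj(3)[of "Suc s"] that by linarith
      then have "z t < y" using yt Jmem[of t y] that by blast
      moreover have "z (Suc s) \<le> z t" using mono'[of "Suc s" t] that by linarith
      ultimately show False using y by linarith
    qed
    show "J s \<inter> J t = {}" if "s \<le> k" "t \<le> k" "s \<noteq> t" for s t
      using dj[of s t] dj[of t s] that by (metis Int_commute linorder_neqE_nat)
    show "N (p (z t)) \<subseteq> {p (z (t - 1)), p (z (Suc t))} \<union> J (t - 1) \<union> J t" if "1 \<le> t" "t \<le> k" for t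
    proof
      fix x assume "x \<in> N (p (z t))"
      moreover have "z t < n" using zj(3)[of t] that by linarith
      ultimately obtain y where "x = p y" "y \<in> A (z t)" using N_A by blast
      then show "x \<in> {p (z (t - 1)), p (z (Suc t))} \<union> J (t - 1) \<union> J t" using between[OF that] by simp
    qed
    show "N w \<subseteq> J t \<union> {p (z t), p (z (Suc t))}" if t: "t \<le> k" and w: "w \<in> J t" for t w
    proof -
      obtain q where q: "w = p q" "z t < q" "q < z (Suc t)" using w unfolding J_def by auto
      have "p y \<in> J t \<union> {p (z t), p (z (Suc t))}" if "y \<in> A q" for y
      proof -
        have "z t \<le> y \<and> y \<le> z (Suc t)" using chord_closed[OF step(2) q(2,3) that] \<open>t \<le> k\<close> by auto
        then consider "y = z t" | "y = z (Suc t)" | "z t < y" "y < z (Suc t)" by linarith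
        then show ?thesis by cases (auto simp: J_def)
      qed
      moreover have "q < n" using q(3) zj(3)[of "Suc t"] t by linarith
      ultimately show ?thesis unfolding q(1) N_A[OF \<open>q < n\<close>] by blast
    qed
    \<comment> \<open>Otherwise \<open>z (Suc t)\<close> would have four neighbours: the far ends of
      the two skipping chords and its two neighbours on the cycle.\<close>
    show "J t = {} \<or> J (Suc t) = {}" if "t < k" for t
    proof (rule ccontr)
      assume "\<not> ?thesis"
      then obtain a b where ab: "z t < a" "a < z (Suc t)" "z (Suc t) < b" "b < z (Suc (Suc t))"
        unfolding J_def by auto
      let ?q = "z (Suc t)"
      have q: "?q < n" "Suc ?q < n" using zj(3)[of "Suc t"] zj(3)[of "Suc (Suc t)"] ab that by auto
      have "z t \<in> A ?q" using A_sym[of "z t" ?q] step(2)[of t] zj(3)[of t] that by auto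
      moreover have "?q - 1 \<in> A ?q" "Suc ?q \<in> A ?q" using A_pred[of ?q] A_Suc q ab by auto
      moreover have "z (Suc (Suc t)) \<in> A ?q" using step(2)[of "Suc t"] that by auto
      ultimately have "{z t, ?q - 1, Suc ?q, z (Suc (Suc t))} \<subseteq> A ?q" by auto
      then have "card {z t, ?q - 1, Suc ?q, z (Suc (Suc t))} \<le> 3"
        using card_mono[OF A_fin] card_A[OF q(1)] le_trans by blast
      moreover have "z t \<noteq> ?q - 1" "z t \<noteq> Suc ?q" "z t \<noteq> z (Suc (Suc t))" "?q - 1 \<noteq> Suc ?q"
        "?q - 1 \<noteq> z (Suc (Suc t))" "Suc ?q \<noteq> z (Suc (Suc t))" using ab by linarith+
      ultimately show False by simp
    qed
    show "N (p i) \<inter> p ` {i<..<j} \<subseteq> insert (p (z 1)) (J 0)"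
    proof
      fix x assume "x \<in> N (p i) \<inter> p ` {i<..<j}"
      then obtain y where y: "x = p y" "i < y" "y < j" "p y \<in> N (p i)" by auto
      then have "y \<in> A i \<inter> {i<..<j}" using jn unfolding A_def by auto
      then have "y = Suc i" unfolding Ai by simp
      then show "x \<in> insert (p (z 1)) (J 0)" using y z1 by simp
    qed
    show "N (p j) \<inter> p ` {i<..<j} \<subseteq> insert (p (z k)) (J k)"
    proof
      fix x assume "x \<in> N (p j) \<inter> p ` {i<..<j}"
      then obtain y where y: "x = p y" "i < y" "y < j" "p y \<in> N (p j)" by auto
      then have "y \<in> A (z (Suc k))" using jn zk unfolding A_def by auto
      then have "z k \<le> y" using left[of "Suc k" y] y zk by auto
      then show "x \<in> insert (p (z k)) (J k)" using y zk by (cases "y = z k") (auto simp: J_def)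
    qed
  qed
  show ?thesis
  proof (rule that[OF F _ I])
    show "J 0 = {}" using z0 z1 unfolding J_def by auto
    show "J t = {} \<or> (\<exists>q q'. p (z t) = p q \<and> p (z (Suc t)) = p q' \<and> J t = p ` {q<..<q'} \<and>
      q + 2 \<le> q' \<and> q' - q < j - i \<and> q' \<in> A q)" if "t \<le> k" for t
    proof (cases "z t + 2 \<le> z (Suc t)")
      case True
      have "z (Suc t) - z t < j - i"
      proof (cases "t = 0")
        case True
        then show ?thesis using z0 z1 ij by auto
      next
        case False
        then show ?thesis using inner[of t] zj(1)[of "Suc t"] that by auto
      qed
      then show ?thesis using True step(2)[OF that] unfolding J_def by blast
    next
      case False
      then show ?thesis unfolding J_def by auto
    qed
    show "J k = {}" if "A j \<inter> {i<..<j} \<subseteq> {j - 1}"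
    proof -
      have "z k \<in> A j" using step(2)[of k] A_sym[of "z k" j] zj(3)[of k] zk by auto
      then have "z k = j - 1" using that inner[of k] k by auto
      then show ?thesis using zk unfolding J_def by auto
    qed
  qed
qed

lemma chord_piece:
  assumes "j \<in> A i" "i + 2 \<le> j" "\<not> (i = 0 \<and> j = n - 1)"
  shows "piece N (p i) (p j) (p ` {i<..<j})"
  using assms
proof (induction "j - i" arbitrary: i j rule: less_induct)
  case less
  note ends = chord_ends[OF less.prems]
  obtain k z J where F: "face N (p i) (p j) k z J" "J 0 = {}" "face_interior k z J = p ` {i<..<j}"
    and ch: "\<And>t. t \<le> k \<Longrightarrow> J t = {} \<or> (\<exists>q q'. z t = p q \<and> z (Suc t) = p q' \<and> J t = p ` {q<..<q'} \<and>
      q + 2 \<le> q' \<and> q' - q < j - i \<and> q' \<in> A q)"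
    and Jk: "A j \<inter> {i<..<j} \<subseteq> {j - 1} \<Longrightarrow> J k = {}"
    using interval_face[OF less.prems(2,1) ends(1)] by metis
  have "piece N (z t) (z (Suc t)) (J t)" if "t \<le> k" for t
    using ch[OF that]
  proof
    assume "J t = {}"
    then show ?thesis by (simp add: piece.edge)
  next
    assume "\<exists>q q'. z t = p q \<and> z (Suc t) = p q' \<and> J t = p ` {q<..<q'} \<and>
      q + 2 \<le> q' \<and> q' - q < j - i \<and> q' \<in> A q"
    then obtain q q' where q: "z t = p q" "z (Suc t) = p q'" "J t = p ` {q<..<q'}"
      "q + 2 \<le> q'" "q' - q < j - i" "q' \<in> A q" by blast
    have "\<not> (q = 0 \<and> q' = n - 1)" using q(5) A_less[OF less.prems(1)] by auto
    then show ?thesis using less.hyps[OF q(5,6,4)] q(1-3) by simp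
  qed
  then have "\<forall>t\<le>k. piece N (z t) (z (Suc t)) (J t)" by blast
  from piece.face[OF F(1,2) Jk this] show ?case using ends(2) F(3) by auto
qed

text \<open>The cycle edge between the last and the first position is treated like a chord with the
  whole graph on one side. The boundary chords of the face found there are proper chords, so
  \<open>chord_piece\<close> applies to them.\<close>

lemma outer_face:
  assumes "A 0 \<inter> {0<..<n - 1} = {Suc 0}"
  obtains k z J where "face N (p 0) (p (n - 1)) k z J" "J 0 = {}"
    "face_interior k z J = p ` {0<..<n - 1}" "\<And>t. t \<le> k \<Longrightarrow> piece N (z t) (z (Suc t)) (J t)"
    "A (n - 1) \<inter> {0<..<n - 1} \<subseteq> {n - 1 - 1} \<Longrightarrow> J k = {}"
proof -
  have two: "0 + 2 \<le> n - 1" using n3 by simp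
  obtain k z J where F: "face N (p 0) (p (n - 1)) k z J" "J 0 = {}"
      "face_interior k z J = p ` {0<..<n - 1}"
    and ch: "\<And>t. t \<le> k \<Longrightarrow> J t = {} \<or> (\<exists>q q'. z t = p q \<and> z (Suc t) = p q' \<and> J t = p ` {q<..<q'} \<and>
      q + 2 \<le> q' \<and> q' - q < n - 1 - 0 \<and> q' \<in> A q)"
    and Jk: "A (n - 1) \<inter> {0<..<n - 1} \<subseteq> {n - 1 - 1} \<Longrightarrow> J k = {}"
    using interval_face[OF two A_wrap(2) assms] by metis
  have "piece N (z t) (z (Suc t)) (J t)" if "t \<le> k" for t
    using ch[OF that]
  proof
    assume "J t = {}"
    then show ?thesis by (simp add: piece.edge)
  next
    assume "\<exists>q q'. z t = p q \<and> z (Suc t) = p q' \<and> J t = p ` {q<..<q'} \<and>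
      q + 2 \<le> q' \<and> q' - q < n - 1 - 0 \<and> q' \<in> A q"
    then obtain q q' where q: "z t = p q" "z (Suc t) = p q'" "J t = p ` {q<..<q'}"
      "q + 2 \<le> q'" "q' - q < n - 1 - 0" "q' \<in> A q" by blast
    have "\<not> (q = 0 \<and> q' = n - 1)" using q(5) by auto
    then show ?thesis using chord_piece[OF q(6,4)] q(1-3) by simp
  qed
  then show ?thesis using that F Jk by blast
qed

lemma ends_W: "p ` {0<..<n - 1} \<union> {p 0, p (n - 1)} = W"
proof -
  have "{..<n} = {0<..<n - 1} \<union> {0, n - 1}" using n3 by auto
  then show ?thesis unfolding W_p by (metis image_Un image_insert image_empty)
qed

lemma ends_notin: "p 0 \<notin> p ` {0<..<n - 1}" "p (n - 1) \<notin> p ` {0<..<n - 1}" "p 0 \<noteq> p (n - 1)"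
  using p_inj n3 by (auto simp: image_iff)

end

section \<open>Colourings of Hamiltonian graphs\<close>

context outer_graph
begin

lemma ham_rotate:
  assumes "cycle N cs" "set cs = W" "r \<in> W"
  obtains cs' where "ham_graph W N cs'" "cs' ! 0 = r"
proof -
  obtain m where m: "m < length cs" "cs ! m = r" using assms in_set_conv_nth[of r cs] by auto
  have "ham_graph W N (rotate m cs)"
    by (unfold_locales) (use assms cycle_rotate in auto)
  moreover have "rotate m cs ! 0 = r" using m nth_rotate[of 0 cs m] by (cases cs) auto
  ultimately show ?thesis using that by blast
qed

text \<open>With \<open>r\<close> at position 0 and without a chord, its neighbours are the next
  vertex and the last one. The last one gets colour 1, so at most one special colour occurs next to
  \<open>r\<close>.\<close>

lemma ham_rooted_coloring:
  assumes "cycle N cs" "set cs = W" "r \<in> W" "card (N r) \<le> 2"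
  shows "\<exists>c. valid_on N {0, 1, 2, 3} c W \<and> c r \<in> {0, 1} \<and> (2 \<notin> c ` N r \<or> 3 \<notin> c ` N r)"
proof -
  obtain cs' where h: "ham_graph W N cs'" and r: "cs' ! 0 = r" using ham_rotate[OF assms(1-3)] .
  interpret h: ham_graph W N cs' by fact
  let ?n = "h.n"
  have mem: "{Suc 0, ?n - 1} \<subseteq> h.A 0" using h.A_Suc[of 0] h.A_wrap h.n3 by auto
  have "inj_on ((!) cs') (h.A 0)" using h.p_inj h.A_less by (auto intro!: inj_onI)
  then have "card (h.A 0) \<le> 2" using assms(4) h.N_A[of 0] h.n3 r card_image by fastforce
  then have A0: "h.A 0 = {Suc 0, ?n - 1}"
    using card_seteq[OF h.A_fin mem] h.n3 by (simp add: card_insert_if)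
  have A0': "h.A 0 \<inter> {0<..<?n - 1} = {Suc 0}" unfolding A0 using h.n3 by auto
  have Nr: "N r = {cs' ! Suc 0, cs' ! (?n - 1)}" using h.N_A[of 0] h.n3 r A0 by auto
  obtain k z J where F: "face N (cs' ! 0) (cs' ! (?n - 1)) k z J" "J 0 = {}"
    "face_interior k z J = (!) cs' ` {0<..<?n - 1}" "\<And>t. t \<le> k \<Longrightarrow> piece N (z t) (z (Suc t)) (J t)"
    using h.outer_face[OF A0'] by metis
  have W: "face_interior k z J \<union> {cs' ! 0, cs' ! (?n - 1)} = W" unfolding F(3) by (rule h.ends_W)
  have "\<exists>c. valid_on N {0, 1, 2, 3} c (face_interior k z J \<union> {cs' ! 0, cs' ! (?n - 1)}) \<and>
      c (cs' ! 0) = 0 \<and> c (cs' ! (?n - 1)) = 1"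
  proof (rule face_rooted_coloring[OF F(1) sym F(2,4)])
    show "N w \<subseteq> face_interior k z J \<union> {cs' ! 0, cs' ! (?n - 1)}" for w
      unfolding W by (rule N_sub)
    show "cs' ! 0 \<notin> face_interior k z J" "cs' ! (?n - 1) \<notin> face_interior k z J"
      unfolding F(3) using h.ends_notin by auto
    show "N (cs' ! 0) \<subseteq> face_interior k z J \<union> {cs' ! (?n - 1)}"
      "N (cs' ! (?n - 1)) \<subseteq> face_interior k z J \<union> {cs' ! 0}"
      using N_sub irr unfolding W[symmetric] by blast+
  qed
  then obtain c where "valid_on N {0, 1, 2, 3} c W" "c r = 0" "c (cs' ! (?n - 1)) = 1"
    unfolding W unfolding r by blast
  then show ?thesis using Nr by (intro exI[of _ c]) auto
qed

text \<open>With a chord, its two sides are flexible pieces, the second one becoming an interval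
  after a rotation. Without a chord, everything forms one piece at the edge from the last to the
  first vertex.\<close>

lemma ham_coloring:
  assumes cs: "cycle N cs" "set cs = W"
  shows "\<exists>c. valid_on N {0, 1, 2} c W"
proof -
  interpret h: ham_graph W N cs by unfold_locales (use cs in auto)
  let ?n = "h.n" and ?p = "(!) cs"
  show ?thesis
  proof (cases "\<exists>i j. j \<in> h.A i \<and> i + 2 \<le> j \<and> \<not> (i = 0 \<and> j = ?n - 1)")
    case True
    then obtain i j where ij: "j \<in> h.A i" "i + 2 \<le> j" "\<not> (i = 0 \<and> j = ?n - 1)" by blast
    have j: "j < ?n" using h.A_less ij by auto
    define cs' where "cs' = rotate j cs"
    interpret h': ham_graph W N cs'
      by unfold_locales (use cs cycle_rotate in \<open>auto simp: cs'_def\<close>)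
    have nn: "h'.n = ?n" by (simp only: h.n_def h'.n_def) (simp add: cs'_def)
    \<comment> \<open>Rotation by \<open>j\<close> moves \<open>j\<close> to position 0 and
      \<open>i\<close> to position \<open>j'\<close>, so that the other side of the chord fills the
      positions in between.\<close>
    define j' where "j' = ?n - j + i"
    have j': "j' < ?n" "2 \<le> j'" "j' \<noteq> ?n - 1" using ij j unfolding j'_def by linarith+
    have nth': "cs' ! t = ?p ((j + t) mod ?n)" if "t < ?n" for t
      using that unfolding cs'_def h.n_def by (simp add: nth_rotate)
    have c0: "cs' ! 0 = ?p j" using nth'[of 0] j h.n3 by simp
    have "(j + j') mod ?n = i" using ij j unfolding j'_def by simp
    then have cj: "cs' ! j' = ?p i" using nth'[OF j'(1)] by simp
    have I': "(!) cs' ` {0<..<j'} = ?p ` ({j<..<?n} \<union> {..<i})"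
    proof -
      have "(!) cs' ` {0<..<j'} = (\<lambda>t. ?p ((j + t) mod ?n)) ` {0<..<j'}"
        using nth' j' by (intro image_cong) auto
      also have "\<dots> = ?p ` ((\<lambda>t. (j + t) mod ?n) ` {0<..<j'})" by (simp add: image_image)
      also have "(\<lambda>t. (j + t) mod ?n) ` {0<..<j'} = {j<..<?n} \<union> {..<i}"
      proof
        show "(\<lambda>t. (j + t) mod ?n) ` {0<..<j'} \<subseteq> {j<..<?n} \<union> {..<i}"
        proof
          fix x assume "x \<in> (\<lambda>t. (j + t) mod ?n) ` {0<..<j'}"
          then obtain t where t: "0 < t" "t < j'" "x = (j + t) mod ?n" by auto
          show "x \<in> {j<..<?n} \<union> {..<i}"
          proof (cases "j + t < ?n")
            case True
            then show ?thesis using t by simp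
          next
            case False
            then have "x = j + t - ?n" using t j'(1) j unfolding t(3) by (simp add: le_mod_geq)
            then show ?thesis using t(2) False j unfolding j'_def by auto
          qed
        qed
        show "{j<..<?n} \<union> {..<i} \<subseteq> (\<lambda>t. (j + t) mod ?n) ` {0<..<j'}"
        proof
          fix x assume "x \<in> {j<..<?n} \<union> {..<i}"
          then show "x \<in> (\<lambda>t. (j + t) mod ?n) ` {0<..<j'}"
          proof
            assume x: "x \<in> {j<..<?n}"
            then have "x - j \<in> {0<..<j'}" "(j + (x - j)) mod ?n = x"
              unfolding j'_def by auto
            then show ?thesis by (metis imageI)
          next
            assume x: "x \<in> {..<i}"
            then have "?n - j + x \<in> {0<..<j'}" "(j + (?n - j + x)) mod ?n = x"
              using ij j unfolding j'_def by auto
            then show ?thesis by (metis imageI)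
          qed
        qed
      qed
      finally show ?thesis .
    qed
    have jA': "j' \<in> h'.A 0"
      unfolding h'.A_def using j' nn c0 cj h.A_sym[OF _ ij(1)] ij j unfolding h.A_def by auto
    have "piece N (?p j) (?p i) (?p ` ({j<..<?n} \<union> {..<i}))"
      using h'.chord_piece[OF jA'] j' nn c0 cj I' by auto
    from flexible_commute[THEN iffD1, OF piece_flexible[OF this sym]]
    have fl': "flexible N (?p i) (?p j) (?p ` ({j<..<?n} \<union> {..<i}))" .
    have fl: "flexible N (?p i) (?p j) (?p ` {i<..<j})"
      using piece_flexible[OF h.chord_piece[OF ij] sym] .
    let ?I = "?p ` {i<..<j}" and ?I' = "?p ` ({j<..<?n} \<union> {..<i})"
    have all: "{..<?n} = {i<..<j} \<union> ({j<..<?n} \<union> {..<i}) \<union> {i, j}" using ij j by auto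
    have cov: "?I \<union> ?I' \<union> {?p i, ?p j} = W"
      unfolding h.W_p by (subst all) (simp add: image_Un)
    have out: "?p q \<in> ?p ` S \<longleftrightarrow> q \<in> S" if "q < ?n" "S \<subseteq> {..<?n}" for q S
      using that h.p_inj by (auto simp: image_iff)
    have sub: "{i<..<j} \<subseteq> {..<?n}" "{j<..<?n} \<union> {..<i} \<subseteq> {..<?n}" "i < ?n" using ij j by auto
    have "\<exists>c. valid_on N {0, 1, 2} c (?I \<union> ?I' \<union> {?p i, ?p j})"
    proof (rule flexible_both_sides[OF fl fl' sym])
      show "N w \<subseteq> ?I \<union> {?p i, ?p j}" if w: "w \<in> ?I" for w
      proof
        fix x assume "x \<in> N w"
        moreover obtain q where q0: "w = ?p q" "i < q" "q < j" using w by auto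
        moreover have "q < ?n" using q0(3) j by simp
        ultimately obtain y where q: "w = ?p q" "i < q" "q < j" "x = ?p y" "y \<in> h.A q"
          using h.N_A by blast
        then have "i \<le> y \<and> y \<le> j" using h.chord_closed[OF ij(1)] by blast
        then show "x \<in> ?I \<union> {?p i, ?p j}" using q(4) by (cases "y = i \<or> y = j") auto
      qed
      show "N w \<subseteq> ?I' \<union> {?p i, ?p j}" if w: "w \<in> ?I'" for w
      proof
        fix x assume x: "x \<in> N w"
        have "w \<in> (!) cs' ` {0<..<j'}" using w I' by simp
        then obtain q where q0: "w = cs' ! q" "0 < q" "q < j'" by auto
        moreover have "q < h'.n" using q0(3) j'(1) nn by simp
        ultimately obtain y where q: "w = cs' ! q" "0 < q" "q < j'" "x = cs' ! y" "y \<in> h'.A q"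
          using x h'.N_A by blast
        then have "y \<le> j'" using h'.chord_closed[OF jA'] by blast
        then show "x \<in> ?I' \<union> {?p i, ?p j}" using q(4) c0 cj I'
          by (cases "y = 0 \<or> y = j'") auto
      qed
      show "?p i \<notin> ?I" "?p j \<notin> ?I" "?p i \<notin> ?I'" "?p j \<notin> ?I'"
        using out[OF sub(3) sub(1)] out[OF j sub(1)] out[OF sub(3) sub(2)] out[OF j sub(2)] ij by auto
      show "?p i \<noteq> ?p j" using h.p_inj[of i j] ij j by auto
      show "?p i \<in> N (?p j)" using h.A_sym[OF _ ij(1)] ij j unfolding h.A_def by auto
      show "?I \<inter> ?I' = {}"
      proof (rule ccontr)
        assume "\<not> ?thesis"
        then obtain q where "q \<in> {i<..<j}" "?p q \<in> ?I'" by blast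
        then show False using out[OF _ sub(2), of q] j by auto
      qed
      show "N (?p i) \<subseteq> ?I \<union> ?I' \<union> {?p j}" "N (?p j) \<subseteq> ?I \<union> ?I' \<union> {?p i}"
        using N_sub irr unfolding cov[symmetric] by blast+
    qed
    then show ?thesis unfolding cov .
  next
    case False
    have no: "y \<le> Suc q" if "y \<in> h.A q" "\<not> (q = 0 \<and> y = ?n - 1)" for q y
      using False that by (metis Suc_1 add_2_eq_Suc' not_less_eq_eq)
    have A0: "h.A 0 \<inter> {0<..<?n - 1} = {Suc 0}"
      using no[of _ 0] h.A_Suc[of 0] h.n3 by force
    have An: "h.A (?n - 1) \<inter> {0<..<?n - 1} \<subseteq> {?n - 1 - 1}"
    proof
      fix y assume y: "y \<in> h.A (?n - 1) \<inter> {0<..<?n - 1}"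
      then have "?n - 1 \<in> h.A y" using h.A_sym[of "?n - 1" y] h.n3 by auto
      then have "?n - 1 \<le> Suc y" using no[of "?n - 1" y] y by auto
      then show "y \<in> {?n - 1 - 1}" using y by auto
    qed
    obtain k z J where F: "face N (?p 0) (?p (?n - 1)) k z J" "J 0 = {}"
      "face_interior k z J = ?p ` {0<..<?n - 1}" "\<And>t. t \<le> k \<Longrightarrow> piece N (z t) (z (Suc t)) (J t)"
      "J k = {}"
      using h.outer_face[OF A0] An by metis
    have "\<forall>t\<le>k. piece N (z t) (z (Suc t)) (J t)" using F(4) by blast
    from piece.face[OF F(1,2,5) this] have "piece N (?p 0) (?p (?n - 1)) (?p ` {0<..<?n - 1})"
      unfolding F(3) .
    from piece_flexible[OF this sym]
    have fl: "flexible N (?p 0) (?p (?n - 1)) (?p ` {0<..<?n - 1})" .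
    \<comment> \<open>The other side of the edge from the last to the first vertex is empty.\<close>
    have fl': "flexible N (?p 0) (?p (?n - 1)) {}"
      using piece_flexible[OF piece.edge sym] .
    have adj: "?p 0 \<in> N (?p (?n - 1))" using h.A_wrap(1) unfolding h.A_def by auto
    have "\<exists>c. valid_on N {0, 1, 2} c (?p ` {0<..<?n - 1} \<union> {} \<union> {?p 0, ?p (?n - 1)})"
      by (rule flexible_both_sides[OF fl fl' sym _ _ h.ends_notin(1,2) _ _ h.ends_notin(3) adj])
        (use h.ends_W N_sub irr in auto)
    then show ?thesis using h.ends_W by simp
  qed
qed

end

section \<open>Cutting along bridges\<close>

definition reach :: "('a \<Rightarrow> 'a set) \<Rightarrow> 'a set \<Rightarrow> ('a \<times> 'a) set" where
  "reach N S = {(x, y). x \<in> S \<and> y \<in> S \<and> y \<in> N x}\<^sup>*"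

lemma reach_path:
  assumes "(x, y) \<in> reach N S" "x \<in> S"
  shows "\<exists>ps. ps \<noteq> [] \<and> distinct ps \<and> set ps \<subseteq> S \<and> hd ps = x \<and> last ps = y \<and>
    walk N ps"
  using assms(1) unfolding reach_def
proof (induction rule: rtrancl_induct)
  case base
  show ?case using assms(2) by (intro exI[of _ "[x]"]) auto
next
  case (step y z)
  then obtain ps where ps: "ps \<noteq> []" "distinct ps" "set ps \<subseteq> S" "hd ps = x" "last ps = y"
    "walk N ps" by blast
  show ?case
  proof (cases "z \<in> set ps")
    case True
    then obtain as bs where "ps = as @ z # bs" by (auto simp: in_set_conv_decomp)
    then show ?thesis
      using ps by (intro exI[of _ "as @ [z]"]) (auto simp: successively_append_iff hd_append)
  next
    case False
    then show ?thesis
      using ps step.hyps(2) by (intro exI[of _ "ps @ [z]"]) (auto simp: successively_append_iff)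
  qed
qed

lemma theta_freeD:
  assumes "theta_free N" "xs \<noteq> []" "ys \<noteq> []" "zs \<noteq> []" "distinct (a # b # xs @ ys @ zs)"
    "walk N (a # xs @ [b])" "walk N (a # ys @ [b])"
    "walk N (a # zs @ [b])"
  shows False
proof -
  have "xs \<noteq> [] \<and> ys \<noteq> [] \<and> zs \<noteq> [] \<and> distinct (a # b # xs @ ys @ zs) \<and>
     (\<forall>ps \<in> {xs, ys, zs}. walk N (a # ps @ [b]))"
    using assms(2-) by simp
  with assms(1)[unfolded theta_free_def] show False by (elim notE) (intro exI)
qed

lemma cycle_iff_successively:
  "cycle N cs \<longleftrightarrow> distinct cs \<and> 3 \<le> length cs \<and> walk N cs \<and> hd cs \<in> N (last cs)"
proof (cases "3 \<le> length cs")
  case True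
  then have ne: "cs \<noteq> []" by auto
  have "(\<forall>i<length cs. cs ! (Suc i mod length cs) \<in> N (cs ! i)) \<longleftrightarrow>
    (\<forall>i. Suc i < length cs \<longrightarrow> cs ! Suc i \<in> N (cs ! i)) \<and> cs ! 0 \<in> N (cs ! (length cs - 1))"
    (is "?L \<longleftrightarrow> ?R")
  proof
    assume L: ?L
    have "cs ! Suc i \<in> N (cs ! i)" if "Suc i < length cs" for i
      using L[rule_format, of i] that by simp
    moreover have "cs ! 0 \<in> N (cs ! (length cs - 1))"
      using L[rule_format, of "length cs - 1"] ne by simp
    ultimately show ?R by blast
  next
    assume R: ?R
    show ?L
    proof (intro allI impI)
      fix i assume i: "i < length cs"
      show "cs ! (Suc i mod length cs) \<in> N (cs ! i)"
      proof (cases "Suc i = length cs")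
        case True
        then have "i = length cs - 1" by simp
        then show ?thesis using R True by simp
      next
        case False
        then show ?thesis using R i by simp
      qed
    qed
  qed
  then show ?thesis
    using ne unfolding cycle_def successively_conv_nth by (simp add: hd_conv_nth last_conv_nth)
qed (auto simp: cycle_def)

text \<open>The empty value outside \<open>S\<close> keeps the relation symmetric.\<close>

definition restrict_nbrs :: "('a \<Rightarrow> 'a set) \<Rightarrow> 'a set \<Rightarrow> 'a \<Rightarrow> 'a set" where
  "restrict_nbrs N S w = (if w \<in> S then N w \<inter> S else {})"

context outer_graph
begin

text \<open>Paths and cycles of the restriction are paths and cycles of \<open>N\<close>, so the
  forbidden configurations are inherited without reference to a drawing.\<close>

lemma restrict_outer_graph:
  assumes "S \<subseteq> W"
  shows "outer_graph S (restrict_nbrs N S)"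
proof
  have sub: "restrict_nbrs N S w \<subseteq> N w" for w unfolding restrict_nbrs_def by auto
  show "finite S" using assms finite_W finite_subset by blast
  show "restrict_nbrs N S w \<subseteq> S" for w unfolding restrict_nbrs_def by auto
  show "x \<in> restrict_nbrs N S y" if "y \<in> restrict_nbrs N S x" for x y
    using that sym unfolding restrict_nbrs_def by (auto split: if_splits)
  show "x \<notin> restrict_nbrs N S x" for x using irr sub by blast
  show "card (restrict_nbrs N S x) \<le> 3" for x
  proof -
    have "finite (N x)" using finite_subset[OF N_sub finite_W] .
    then show ?thesis using card_mono[OF _ sub] deg le_trans by blast
  qed
  have suc: "walk N ps" if "walk (restrict_nbrs N S) ps" for ps
    using that by (rule successively_mono) (use sub in auto)
  show "theta_free (restrict_nbrs N S)"
    unfolding theta_free_def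
  proof clarify
    fix a b xs ys zs
    assume *: "xs \<noteq> []" "ys \<noteq> []" "zs \<noteq> []" "distinct (a # b # xs @ ys @ zs)"
      "\<forall>ps\<in>{xs, ys, zs}. walk (restrict_nbrs N S) (a # ps @ [b])"
    show False
      by (rule theta_freeD[OF theta *(1-4)]; rule suc) (use *(5) in simp_all)
  qed
  have cyc: "cycle N cs" if "cycle (restrict_nbrs N S) cs" for cs
    using that subsetD[OF sub] unfolding cycle_def by simp
  show "chords_noncrossing (restrict_nbrs N S)"
    unfolding chords_noncrossing_def
  proof clarify
    fix cs i x j y
    assume *: "cycle (restrict_nbrs N S) cs" "i < x" "x < j" "j < y" "y < length cs"
      "cs ! j \<in> restrict_nbrs N S (cs ! i)" "cs ! y \<in> restrict_nbrs N S (cs ! x)"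
    have "\<not> (cs ! j \<in> N (cs ! i) \<and> cs ! y \<in> N (cs ! x))"
      using noncrossing cyc[OF *(1)] *(2-5) unfolding chords_noncrossing_def by simp
    then show False using subsetD[OF sub *(6)] subsetD[OF sub *(7)] by simp
  qed
qed

text \<open>At most one edge crosses, so this covers bridges and disconnected graphs alike.\<close>

definition thin_cut :: "'a set \<Rightarrow> 'a set \<Rightarrow> bool" where
  "thin_cut W1 W2 \<longleftrightarrow> W1 \<union> W2 = W \<and> W1 \<inter> W2 = {} \<and> W1 \<noteq> {} \<and> W2 \<noteq> {} \<and>
    (\<forall>a\<in>W1. \<forall>b\<in>W2. \<forall>a'\<in>W1. \<forall>b'\<in>W2. b \<in> N a \<longrightarrow> b' \<in> N a' \<longrightarrow> a = a' \<and> b = b')"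

lemma thin_cut_commute: "thin_cut W1 W2 \<Longrightarrow> thin_cut W2 W1"
proof -
  assume cut: "thin_cut W1 W2"
  have "a = a' \<and> b = b'" if "a \<in> W2" "b \<in> W1" "a' \<in> W2" "b' \<in> W1" "b \<in> N a" "b' \<in> N a'" for a b a' b'
    using cut that(1-4) sym[OF that(5)] sym[OF that(6)] unfolding thin_cut_def by blast
  then show ?thesis using cut unfolding thin_cut_def by (simp add: Un_commute Int_commute)
qed

lemma two_edges_out:
  assumes "\<And>W1 W2. \<not> thin_cut W1 W2" "K \<subseteq> W" "K \<noteq> {}" "K \<noteq> W"
  obtains a b a' b' where "a \<in> K" "a' \<in> K" "b \<in> W - K" "b' \<in> W - K" "b \<in> N a" "b' \<in> N a'"
    "a \<noteq> a' \<or> b \<noteq> b'"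
proof -
  have "K \<union> (W - K) = W" "K \<inter> (W - K) = {}" "W - K \<noteq> {}" using assms(2-4) by auto
  then have "\<exists>a\<in>K. \<exists>b\<in>W - K. \<exists>a'\<in>K. \<exists>b'\<in>W - K. b \<in> N a \<and> b' \<in> N a' \<and> \<not> (a = a' \<and> b = b')"
    using assms(1)[of K "W - K"] assms(3) unfolding thin_cut_def by blast
  then obtain a b a' b' where "a \<in> K" "b \<in> W - K" "a' \<in> K" "b' \<in> W - K" "b \<in> N a" "b' \<in> N a'"
    "a \<noteq> a' \<or> b \<noteq> b'" by blast
  then show ?thesis by (intro that)
qed

text \<open>Let \<open>K\<close> be the component of \<open>x\<close> in \<open>S\<close>. Edges
  leaving \<open>K\<close> end outside \<open>S\<close>, and there are two of them because no cut is
  thin; their ends in \<open>K\<close> are joined by a path inside \<open>S\<close>.\<close>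

lemma component_two_edges:
  assumes "\<And>W1 W2. \<not> thin_cut W1 W2" "S \<subseteq> W" "x \<in> S" "S \<noteq> W"
  obtains a b a' b' ps where "b \<in> W - S" "b' \<in> W - S" "b \<in> N a" "b' \<in> N a'" "a \<noteq> a' \<or> b \<noteq> b'"
    "ps \<noteq> []" "distinct ps" "set ps \<subseteq> S" "hd ps = a" "last ps = a'" "walk N ps"
proof -
  let ?R = "{(x, y). x \<in> S \<and> y \<in> S \<and> y \<in> N x}"
  define K where "K = {y. (x, y) \<in> reach N S}"
  have KS: "K \<subseteq> S"
  proof
    fix y assume "y \<in> K"
    then have "(x, y) \<in> ?R\<^sup>*" unfolding K_def reach_def by simp
    then show "y \<in> S" by (induction rule: rtrancl_induct) (use assms(3) in auto)
  qed
  have closed: "b \<in> K" if "a \<in> K" "b \<in> N a" "b \<in> S" for a b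
  proof -
    have "(a, b) \<in> ?R" using that KS by auto
    then show ?thesis using that(1) rtrancl_into_rtrancl[of x a ?R b] unfolding K_def reach_def by simp
  qed
  have "x \<in> K" unfolding K_def reach_def by simp
  then have "K \<subseteq> W" "K \<noteq> {}" "K \<noteq> W" using KS assms(2,4) by auto
  from two_edges_out[OF assms(1) this] obtain a b a' b' where e: "a \<in> K" "a' \<in> K" "b \<in> W - K" "b' \<in> W - K" "b \<in> N a" "b' \<in> N a'"
    "a \<noteq> a' \<or> b \<noteq> b'"
    .
  have "sym ?R" using sym unfolding sym_def by auto
  then have "sym (?R\<^sup>*)" by (rule sym_rtrancl)
  then have "(a, x) \<in> ?R\<^sup>*" using e(1) unfolding K_def reach_def by (auto dest: symD)
  moreover have "(x, a') \<in> ?R\<^sup>*" using e(2) unfolding K_def reach_def by simp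
  ultimately have aa: "(a, a') \<in> reach N S"
    unfolding reach_def by (rule rtrancl_trans)
  have "a \<in> S" using e(1) KS by blast
  from reach_path[OF aa this] obtain ps where ps: "ps \<noteq> []" "distinct ps" "set ps \<subseteq> S" "hd ps = a" "last ps = a'"
    "walk N ps"
    by blast
  have bS: "b \<in> W - S" "b' \<in> W - S"
    using e(3,4) closed[OF e(1,5)] closed[OF e(2,6)] by auto
  show ?thesis by (rule that[OF bS e(5-7) ps])
qed

text \<open>A longest cycle is Hamiltonian: otherwise some component of the rest is joined to it by two edges,
  which have distinct ends on the cycle because of the degree bound. The resulting ear either
  lengthens the cycle or forms a theta with it.\<close>

lemma ham_exists:
  assumes no_cut: "\<And>W1 W2. \<not> thin_cut W1 W2" and "2 \<le> card W"
  shows "\<exists>cs. cycle N cs \<and> set cs = W"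
proof -
  obtain r where r: "r \<in> W" using assms(2) by (metis card.empty equals0I not_numeral_le_zero)
  have Wr: "W - {r} \<noteq> {}" using assms(2) r
    by (metis card.empty card_Suc_Diff1 finite_W not_less_eq_eq numeral_2_eq_2 order_refl)
  then obtain x where x: "x \<in> W - {r}" by blast
  have "W - {r} \<noteq> W" using r by auto
  \<comment> \<open>A first cycle: a component of the graph without \<open>r\<close> is joined to
    \<open>r\<close> by two edges, and a path in it between their ends closes up through
    \<open>r\<close>.\<close>
  from component_two_edges[OF no_cut Diff_subset x this] obtain a b a' b' ps where
    e: "b \<in> W - (W - {r})" "b' \<in> W - (W - {r})" "b \<in> N a" "b' \<in> N a'" "a \<noteq> a' \<or> b \<noteq> b'"
    and ps: "ps \<noteq> []" "distinct ps" "set ps \<subseteq> W - {r}" "hd ps = a" "last ps = a'"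
      "walk N ps" .
  have br: "b = r" "b' = r" using e by auto
  have "length ps \<noteq> 1" using e br ps(4,5) by (auto simp: length_Suc_conv)
  then have "2 \<le> length ps" using ps(1) by (cases ps) (auto simp: Suc_le_eq)
  then have c0: "cycle N (r # ps)"
    using ps e(4) sym[OF e(3)] br unfolding cycle_iff_successively by (auto simp: successively_Cons)
  have csW: "set cs \<subseteq> W" if "cycle N cs" for cs
  proof
    fix v assume "v \<in> set cs"
    then obtain i where "i < length cs" "v = cs ! i" by (auto simp: in_set_conv_nth)
    then have "cs ! (Suc i mod length cs) \<in> N v" using that unfolding cycle_def by auto
    then show "v \<in> W" using sym N_sub by blast
  qed
  have bound: "\<forall>cs. cycle N cs \<longrightarrow> length cs < Suc (card W)"
    using csW card_mono[OF finite_W] distinct_card unfolding cycle_def by (metis le_imp_less_Suc)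
  obtain cs where cs: "cycle N cs" "\<And>cs'. cycle N cs' \<Longrightarrow> length cs' \<le> length cs"
    using ex_has_greatest_nat[of "cycle N", OF c0 bound] by blast
  have "set cs = W"
  proof (rule ccontr)
    assume "set cs \<noteq> W"
    then obtain w where w: "w \<in> W - set cs" using csW[OF cs(1)] by blast
    have "cs \<noteq> []" using cs(1) unfolding cycle_def by auto
    then have "hd cs \<in> set cs" "hd cs \<in> W" using csW[OF cs(1)] by (auto simp: hd_in_set subset_iff)
    then have "W - set cs \<noteq> W" by blast
    from component_two_edges[OF no_cut Diff_subset w this] obtain a b a' b' ps where
      e: "b \<in> W - (W - set cs)" "b' \<in> W - (W - set cs)" "b \<in> N a" "b' \<in> N a'" "a \<noteq> a' \<or> b \<noteq> b'"
      and ps: "ps \<noteq> []" "distinct ps" "set ps \<subseteq> W - set cs" "hd ps = a" "last ps = a'"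
        "walk N ps" .
    have aS: "a \<notin> set cs" "a' \<notin> set cs" using ps by (auto simp: subset_iff)
    obtain m where m: "m < length cs" "cs ! m = b" using e by (auto simp: in_set_conv_nth)
    define ds where "ds = rotate m cs"
    have ds: "cycle N ds" "set ds = set cs" "length ds = length cs"
      using cycle_rotate[OF cs(1)] by (auto simp: ds_def)
    have "hd ds = b" using m \<open>cs \<noteq> []\<close> unfolding ds_def by (simp add: hd_rotate_conv_nth)
    moreover have "ds \<noteq> []" using \<open>cs \<noteq> []\<close> by (simp add: ds_def)
    ultimately obtain es where es: "ds = b # es" by (cases ds) auto
    have dsc: "distinct (b # es)" "2 \<le> length es" "walk N (b # es)" "b \<in> N (last es)"
      using ds(1) unfolding es cycle_iff_successively by (auto split: if_splits)
    \<comment> \<open>Otherwise \<open>b\<close> would have four neighbours: \<open>a\<close> and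
      \<open>a'\<close> off the cycle, and two on it.\<close>
    have "b \<noteq> b'"
    proof
      assume bb: "b = b'"
      obtain d fs where es': "es = d # fs" using dsc(2) by (cases es) auto
      then have fs: "fs \<noteq> []" using dsc(2) by auto
      have "a \<in> N b" "a' \<in> N b" using e(3,4) bb sym by auto
      moreover have "d \<in> N b" using dsc(3) unfolding es' by simp
      moreover have "last fs \<in> N b" using sym[OF dsc(4)] fs unfolding es' by simp
      ultimately have sub: "{a, a', d, last fs} \<subseteq> N b" by simp
      have "finite (N b)" using finite_subset[OF N_sub finite_W] .
      from card_mono[OF this sub] have "card {a, a', d, last fs} \<le> 3"
        using deg[of b] by linarith
      moreover have "d \<noteq> last fs" using dsc(1) fs last_in_set[OF fs] unfolding es' by auto
      moreover have "d \<in> set cs" "last fs \<in> set cs"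
        using last_in_set[OF fs] unfolding ds(2)[symmetric] es es' by auto
      moreover have "a \<noteq> a'" using e(5) bb by simp
      ultimately show False using aS by (auto simp: card_insert_if split: if_splits)
    qed
    then have "b' \<in> set es" using e(2) ds(2) es by auto
    then obtain ys zs where es': "es = ys @ b' # zs" by (auto simp: in_set_conv_decomp)
    have disj: "set ps \<inter> set (b # es) = {}" using ps(3) ds(2) es by auto
    have succ: "walk N (b # ys @ [b'])" "walk N (b' # zs @ [b])"
      using dsc(3,4) unfolding es' by (auto simp: successively_Cons successively_append_iff hd_append split: if_splits)
    have symeq: "(\<lambda>x y. x \<in> N y) = (\<lambda>x y. y \<in> N x)" using sym by (intro ext) blast
    have srev: "walk N (rev qs) = walk N qs" for qs
      unfolding successively_rev by (rule arg_cong[OF symeq])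
    have sps: "walk N (b # ps @ [b'])"
      using ps(1,4,5,6) sym[OF e(3)] e(4) by (simp add: successively_Cons successively_append_iff)
    show False
    \<comment> \<open>If \<open>b\<close> and \<open>b'\<close> are consecutive on the cycle, the
      ear replaces the edge between them and lengthens the cycle. Otherwise the ear and the two
      parts of the cycle are the three paths of a theta.\<close>
    proof (cases "ys = [] \<or> zs = []")
      case True
      then show False
      proof
        assume ys: "ys = []"
        have "cycle N (b # ps @ b' # zs)"
          using sps succ(2) dsc(1,4) disj ps(1,2) unfolding cycle_iff_successively es' ys
          by (cases ps) (auto simp: successively_Cons successively_append_iff hd_append split: if_splits)
        from cs(2)[OF this] show False using ps(1) ds(3) es es' ys by (cases ps) simp_all
      next
        assume zs: "zs = []"
        have "walk N (ps @ [b'])"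
          using ps(1,5,6) e(4) by (simp add: successively_append_iff)
        then have "walk N (b' # rev ps)"
          using srev[of "ps @ [b']"] by simp
        then have "walk N ((b # ys) @ b' # rev ps)"
          using succ(1) by (auto simp: successively_append_iff successively_Cons hd_append split: if_splits)
        moreover have "b \<in> N (last (rev ps))" using ps(1,4) e(3) by (simp add: last_rev)
        moreover have "distinct (b # ys @ b' # rev ps)"
          using dsc(1) disj ps(2) unfolding es' zs by auto
        ultimately have "cycle N (b # ys @ b' # rev ps)"
          using ps(1) unfolding cycle_iff_successively by (auto simp: Suc_le_eq)
        from cs(2)[OF this] show False using ps(1) ds(3) es es' zs by (cases ps) simp_all
      qed
    next
      case False
      have "walk N (b # rev zs @ [b'])"
        using succ(2) srev[of "b' # zs @ [b]"] by simp
      moreover have "distinct (b # b' # ps @ ys @ rev zs)"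
        using dsc(1) disj ps(2) unfolding es' by auto
      moreover have "ys \<noteq> []" "rev zs \<noteq> []" using False by auto
      ultimately show False
        using theta_freeD[OF theta ps(1) _ _ _ sps succ(1)] by blast
    qed
  qed
  then show ?thesis using cs(1) by blast
qed

end

section \<open>Merging colourings across a bridge\<close>

text \<open>If the root \<open>r\<close> of one side of a bridge has an ordinary colour and one special colour is
  missing among its neighbours, then swapping 0 with 1 or 2 with 3 makes the colouring compatible with any
  colour at the other end of the bridge.\<close>

definition rooted_valid :: "('a \<Rightarrow> 'a set) \<Rightarrow> 'a set \<Rightarrow> 'a \<Rightarrow> ('a \<Rightarrow> nat) \<Rightarrow> bool" where
  "rooted_valid N W r c \<longleftrightarrow> valid_on N {0, 1, 2, 3} c W \<and> c r \<in> {0, 1} \<and> (2 \<notin> c ` N r \<or> 3 \<notin> c ` N r)"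

lemma valid_on_permute:
  assumes c: "valid_on N K c S" and "inj \<pi>" "\<pi> ` K \<subseteq> K" "\<pi> ` {0, 1} \<subseteq> {0, 1}"
  shows "valid_on N K (\<lambda>x. \<pi> (c x)) S"
  unfolding valid_on_def
proof (intro ballI conjI)
  fix w assume w: "w \<in> S"
  show "\<pi> (c w) \<in> K" using c w assms(3) unfolding valid_on_def by auto
  show "\<pi> (c y) \<noteq> \<pi> (c w)" if "y \<in> N w" for y
    using c w that assms(2) unfolding valid_on_def by (auto simp: inj_eq)
  have p: "packed c (N w)" using c w unfolding valid_on_def by auto
  show "packed (\<lambda>x. \<pi> (c x)) (N w)"
    unfolding packed_def
  proof (intro ballI impI)
    fix x y assume xy: "x \<in> N w" "y \<in> N w" "x \<noteq> y" "\<pi> (c x) = \<pi> (c y)"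
    then have "c x = c y" using assms(2) by (simp add: inj_eq)
    then have "c x \<in> {0, 1}" using p xy unfolding packed_def by simp
    then show "\<pi> (c x) \<in> {0, 1}" using assms(4) by blast
  qed
qed

lemma valid_on_swap:
  fixes c :: "'a \<Rightarrow> nat"
  assumes "valid_on N {0, 1, 2, 3} c S" "p \<in> {(0, 1), (2, 3)}"
  shows "valid_on N {0, 1, 2, 3} (\<lambda>x. if c x = fst p then snd p else if c x = snd p then fst p else c x) S"
proof -
  let ?\<pi> = "\<lambda>x. if x = fst p then snd p else if x = snd p then fst p else x"
  have "inj ?\<pi>" using assms(2) by (auto simp: inj_def split: if_splits)
  moreover have "?\<pi> ` {0, 1, 2, 3} \<subseteq> {0, 1, 2, 3}" "?\<pi> ` {0, 1} \<subseteq> {0, 1}" using assms(2) by auto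
  ultimately show ?thesis using valid_on_permute[OF assms(1)] by blast
qed

lemma rooted_valid_adjust:
  assumes "rooted_valid N S b c" "b \<in> S"
  shows "\<exists>c'. valid_on N {0, 1, 2, 3} c' S \<and> c' b \<in> {0, 1} \<and> c' b \<noteq> t \<and> (t \<in> {2, 3} \<longrightarrow> t \<notin> c' ` N b)"
proof -
  have c: "valid_on N {0, 1, 2, 3} c S" "c b \<in> {0, 1}" "2 \<notin> c ` N b \<or> 3 \<notin> c ` N b"
    using assms unfolding rooted_valid_def by auto
  show ?thesis
  proof (cases "c b \<noteq> t \<and> (t \<in> {2, 3} \<longrightarrow> t \<notin> c ` N b)")
    case True
    then show ?thesis using c by blast
  next
    case False
    then consider "t = c b" | "t \<in> {2, 3}" "t \<in> c ` N b" by blast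
    then show ?thesis
    proof cases
      case 1
      show ?thesis
        by (rule exI, intro conjI, rule valid_on_swap[OF c(1), of "(0, 1)"]) (use 1 c(2) in auto)
    next
      case 2
      show ?thesis
        by (rule exI, intro conjI, rule valid_on_swap[OF c(1), of "(2, 3)"])
          (use 2 c(2,3) in \<open>auto split: if_splits\<close>)
    qed
  qed
qed

context outer_graph
begin

text \<open>At a bridge, the side \<open>W2\<close> is coloured with root \<open>b\<close> and
  adjusted to the colour of \<open>a\<close>. Since \<open>b\<close> gets an ordinary colour, no
  special colour is added next to \<open>W1\<close>; the last conclusion lets a root in
  \<open>W1\<close> keep its missing special colour.\<close>

lemma cut_merge:
  assumes cut: "thin_cut W1 W2" and c1: "valid_on (restrict_nbrs N W1) {0, 1, 2, 3} c1 W1"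
    and ex: "\<exists>c. valid_on (restrict_nbrs N W2) {0, 1, 2, 3} c W2"
    and rooted: "\<And>b. b \<in> W2 \<Longrightarrow> card (restrict_nbrs N W2 b) \<le> 2 \<Longrightarrow> \<exists>c. rooted_valid (restrict_nbrs N W2) W2 b c"
  shows "\<exists>c. valid_on N {0, 1, 2, 3} c W \<and> (\<forall>x\<in>W1. c x = c1 x) \<and>
    (\<forall>x\<in>W1. c ` N x \<subseteq> c1 ` restrict_nbrs N W1 x \<union> {0, 1})"
proof -
  have W: "W1 \<union> W2 = W" "W1 \<inter> W2 = {}" using cut unfolding thin_cut_def by auto
  show ?thesis
  proof (cases "\<exists>a\<in>W1. \<exists>b\<in>W2. b \<in> N a")
    case False
    obtain c2 where c2: "valid_on (restrict_nbrs N W2) {0, 1, 2, 3} c2 W2" using ex by blast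
    define c where "c = (\<lambda>x. if x \<in> W1 then c1 x else c2 x)"
    have N1: "N x = restrict_nbrs N W1 x" if "x \<in> W1" for x
      using False that N_sub[of x] W unfolding restrict_nbrs_def by auto
    have N2: "N x = restrict_nbrs N W2 x" if "x \<in> W2" for x
    proof -
      have "y \<in> W2" if "y \<in> N x" for y
        using False \<open>x \<in> W2\<close> N_sub[of x] that W sym[OF that] by blast
      then show ?thesis using that unfolding restrict_nbrs_def by auto
    qed
    have e: "c x = c1 x" if "x \<in> W1" for x using that by (simp add: c_def)
    have e2: "c x = c2 x" if "x \<in> W2" for x using that W by (auto simp: c_def)
    have r1: "y \<in> W1" if "y \<in> restrict_nbrs N W1 x" for x y
      using that unfolding restrict_nbrs_def by (auto split: if_splits)
    have r2: "y \<in> W2" if "y \<in> restrict_nbrs N W2 x" for x y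
      using that unfolding restrict_nbrs_def by (auto split: if_splits)
    have v1: "valid_on (restrict_nbrs N W1) {0, 1, 2, 3} c W1"
      by (rule valid_on_cong[OF c1]) (use e r1 in auto)
    have v2: "valid_on (restrict_nbrs N W2) {0, 1, 2, 3} c W2"
      by (rule valid_on_cong[OF c2]) (use e2 r2 in auto)
    have "valid_on N {0, 1, 2, 3} c W"
      unfolding valid_on_def
    proof
      fix w assume "w \<in> W"
      then consider "w \<in> W1" | "w \<in> W2" using W by blast
      then show "c w \<in> {0, 1, 2, 3} \<and> (\<forall>y\<in>N w. c y \<noteq> c w) \<and> packed c (N w)"
        using v1 v2 N1 N2 unfolding valid_on_def by cases simp_all
    qed
    moreover have "c ` N x \<subseteq> c1 ` restrict_nbrs N W1 x \<union> {0, 1}" if "x \<in> W1" for x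
      using e r1 unfolding N1[OF that] by force
    moreover have "\<forall>x\<in>W1. c x = c1 x" using e by simp
    ultimately show ?thesis by (intro exI[of _ c]) simp
  next
    case True
    then obtain a b where ab: "a \<in> W1" "b \<in> W2" "b \<in> N a" by blast
    have only: "x = a \<and> y = b" if "x \<in> W1" "y \<in> W2" "y \<in> N x" for x y
      using cut ab that unfolding thin_cut_def by blast
    have N1: "N x = (if x = a then insert b (restrict_nbrs N W1 x) else restrict_nbrs N W1 x)" if "x \<in> W1" for x
    proof (rule set_eqI)
      fix y
      show "y \<in> N x \<longleftrightarrow> y \<in> (if x = a then insert b (restrict_nbrs N W1 x) else restrict_nbrs N W1 x)"
        using only[OF that, of y] that ab N_sub[of x] W unfolding restrict_nbrs_def by auto
    qed
    have N2: "N x = (if x = b then insert a (restrict_nbrs N W2 x) else restrict_nbrs N W2 x)" if "x \<in> W2" for x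
    proof (rule set_eqI)
      fix y
      show "y \<in> N x \<longleftrightarrow> y \<in> (if x = b then insert a (restrict_nbrs N W2 x) else restrict_nbrs N W2 x)"
        using only[OF _ that, of y] that ab N_sub[of x] W sym[of y x] sym[OF ab(3)]
        unfolding restrict_nbrs_def by auto
    qed
    have r1: "y \<in> W1" if "y \<in> restrict_nbrs N W1 x" for x y
      using that unfolding restrict_nbrs_def by (auto split: if_splits)
    have r2: "y \<in> W2" if "y \<in> restrict_nbrs N W2 x" for x y
      using that unfolding restrict_nbrs_def by (auto split: if_splits)
    \<comment> \<open>Without the bridge, \<open>b\<close> has at most two neighbours left. This is
      why rooted colourings are asked for at vertices of degree at most 2.\<close>
    have "a \<notin> restrict_nbrs N W2 b" using r2 W ab by blast
    moreover have "finite (restrict_nbrs N W2 b)" using finite_subset[OF N_sub finite_W, of b] N2[OF ab(2)] by simp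
    ultimately have "card (restrict_nbrs N W2 b) \<le> 2" using deg[of b] N2[OF ab(2)] by simp
    then obtain c' where c': "rooted_valid (restrict_nbrs N W2) W2 b c'" using rooted[OF ab(2)] by blast
    obtain c2 where c2: "valid_on (restrict_nbrs N W2) {0, 1, 2, 3} c2 W2" "c2 b \<in> {0, 1}" "c2 b \<noteq> c1 a"
      "c1 a \<in> {2, 3} \<longrightarrow> c1 a \<notin> c2 ` restrict_nbrs N W2 b"
      using rooted_valid_adjust[OF c' ab(2), of "c1 a"] by blast
    define c where "c = (\<lambda>x. if x \<in> W1 then c1 x else c2 x)"
    have e: "c x = c1 x" if "x \<in> W1" for x using that by (simp add: c_def)
    have e2: "c x = c2 x" if "x \<in> W2" for x using that W by (auto simp: c_def)
    have v1: "valid_on (restrict_nbrs N W1) {0, 1, 2, 3} c W1"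
      by (rule valid_on_cong[OF c1]) (use e r1 in auto)
    have v2: "valid_on (restrict_nbrs N W2) {0, 1, 2, 3} c W2"
      by (rule valid_on_cong[OF c2(1)]) (use e2 r2 in auto)
    have ca: "c a = c1 a" "c a \<in> {0, 1, 2, 3}" and cb: "c b = c2 b" "c b \<in> {0, 1}"
      using e[OF ab(1)] e2[OF ab(2)] c2(2) v1 ab(1) unfolding valid_on_def by auto
    have "valid_on N {0, 1, 2, 3} c W"
      unfolding valid_on_def
    proof
      fix w assume "w \<in> W"
      then consider "w \<in> W1" "w \<noteq> a" | "w \<in> W2" "w \<noteq> b" | "w = a" | "w = b" using W by blast
      then show "c w \<in> {0, 1, 2, 3} \<and> (\<forall>y\<in>N w. c y \<noteq> c w) \<and> packed c (N w)"
      proof cases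
        case 1
        then show ?thesis using v1 N1[of w] unfolding valid_on_def by auto
      next
        case 2
        then show ?thesis using v2 N2[of w] unfolding valid_on_def by auto
      next
        case 3
        have N: "N a = insert b (restrict_nbrs N W1 a)" using N1[OF ab(1)] by simp
        have "packed c (insert b (restrict_nbrs N W1 a))"
          by (rule packed_insert) (use v1 ab(1) cb(2) in \<open>auto simp: valid_on_def\<close>)
        moreover have "\<forall>y\<in>restrict_nbrs N W1 a. c y \<noteq> c a"
          using v1 ab(1) unfolding valid_on_def by blast
        moreover have "c b \<noteq> c a" using ca(1) cb(1) c2(3) by simp
        ultimately show ?thesis using ca(2) unfolding 3 N by blast
      next
        case 4
        have N: "N b = insert a (restrict_nbrs N W2 b)" using N2[OF ab(2)] by simp
        have "packed c (insert a (restrict_nbrs N W2 b))"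
        proof (rule packed_insert)
          show "packed c (restrict_nbrs N W2 b)" using v2 ab(2) by (auto simp: valid_on_def)
          fix x assume x: "x \<in> restrict_nbrs N W2 b" "c x = c a"
          then have "c x = c2 x" using e2 r2 by auto
          then show "c x \<in> {0, 1}" using c2(4) x ca by auto
        qed
        moreover have "\<forall>y\<in>restrict_nbrs N W2 b. c y \<noteq> c b"
          using v2 ab(2) unfolding valid_on_def by blast
        moreover have "c a \<noteq> c b" using ca(1) cb(1) c2(3) by simp
        ultimately show ?thesis using cb(2) unfolding 4 N by blast
      qed
    qed
    moreover have "c ` N x \<subseteq> c1 ` restrict_nbrs N W1 x \<union> {0, 1}" if "x \<in> W1" for x
    proof
      fix t assume "t \<in> c ` N x"
      then obtain y where y: "t = c y" "y \<in> N x" by blast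
      then have "y = b \<or> y \<in> restrict_nbrs N W1 x" using N1[OF that] by (simp split: if_splits)
      then show "t \<in> c1 ` restrict_nbrs N W1 x \<union> {0, 1}"
      proof
        assume "y = b"
        then have "t \<in> {0, 1}" using cb(2) y(1) by simp
        then show ?thesis by blast
      next
        assume yr: "y \<in> restrict_nbrs N W1 x"
        then show ?thesis using e[OF r1[OF yr]] y(1) by simp
      qed
    qed
    moreover have "\<forall>x\<in>W1. c x = c1 x" using e by simp
    ultimately show ?thesis by (intro exI[of _ c]) simp
  qed
qed

end

text \<open>The rooted statement is needed at the ends of bridges and so has to be carried through
  the induction. Without thin cuts, the graph is Hamiltonian or has at most one vertex.\<close>

lemma outer_graph_coloring:
  assumes "outer_graph W N"
  shows "(\<exists>c. valid_on N {0, 1, 2, 3} c W) \<and>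
    (\<forall>r\<in>W. card (N r) \<le> 2 \<longrightarrow> (\<exists>c. rooted_valid N W r c))"
  using assms
proof (induction "card W" arbitrary: W N rule: less_induct)
  case less
  interpret outer_graph W N by fact
  show ?case
  proof (cases "\<exists>W1 W2. thin_cut W1 W2")
    case True
    have IH: "(\<exists>c. valid_on (restrict_nbrs N W1) {0, 1, 2, 3} c W1) \<and>
      (\<forall>r\<in>W1. card (restrict_nbrs N W1 r) \<le> 2 \<longrightarrow> (\<exists>c. rooted_valid (restrict_nbrs N W1) W1 r c))"
      if "thin_cut W1 W2" for W1 W2
    proof -
      have sub: "W1 \<subset> W" using that unfolding thin_cut_def by auto
      have "W1 \<subseteq> W" using sub by blast
      from less.hyps[OF psubset_card_mono[OF finite_W sub] restrict_outer_graph[OF this]]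
      show ?thesis .
    qed
    obtain W1 W2 where cut: "thin_cut W1 W2" using True by blast
    have "\<exists>c. rooted_valid N W r c" if r: "r \<in> W" "card (N r) \<le> 2" for r
    proof -
      \<comment> \<open>\<open>cut_merge\<close> preserves the colouring of the first side, so the
        root is placed there.\<close>
      obtain U1 U2 where U: "thin_cut U1 U2" "r \<in> U1"
      proof (cases "r \<in> W1")
        case True
        then show ?thesis using that[OF cut] by blast
      next
        case False
        then have "r \<in> W2" using r(1) cut unfolding thin_cut_def by blast
        then show ?thesis using that[OF thin_cut_commute[OF cut]] by blast
      qed
      have "card (restrict_nbrs N U1 r) \<le> 2"
      proof -
        have "restrict_nbrs N U1 r \<subseteq> N r" unfolding restrict_nbrs_def by auto
        from card_mono[OF finite_subset[OF N_sub finite_W] this] show ?thesis using r(2) by linarith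
      qed
      then obtain c1 where c1: "rooted_valid (restrict_nbrs N U1) U1 r c1" using IH[OF U(1)] U(2) by blast
      then obtain c where c: "valid_on N {0, 1, 2, 3} c W" "\<forall>x\<in>U1. c x = c1 x"
        "\<forall>x\<in>U1. c ` N x \<subseteq> c1 ` restrict_nbrs N U1 x \<union> {0, 1}"
        using cut_merge[OF U(1), of c1] IH[OF thin_cut_commute[OF U(1)]] unfolding rooted_valid_def by blast
      have "c r \<in> {0, 1}" using c(2) U(2) c1 unfolding rooted_valid_def by simp
      moreover have "2 \<notin> c ` N r \<or> 3 \<notin> c ` N r"
        using c(3) U(2) c1 unfolding rooted_valid_def by fastforce
      ultimately show ?thesis using c(1) unfolding rooted_valid_def by blast
    qed
    moreover have "\<exists>c. valid_on N {0, 1, 2, 3} c W"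
    proof -
      obtain c1 where "valid_on (restrict_nbrs N W1) {0, 1, 2, 3} c1 W1" using IH[OF cut] by blast
      from cut_merge[OF cut this] IH[OF thin_cut_commute[OF cut]] show ?thesis by blast
    qed
    ultimately show ?thesis by blast
  next
    case False
    show ?thesis
    proof (cases "2 \<le> card W")
      case True
      then obtain cs where cs: "cycle N cs" "set cs = W" using ham_exists False by blast
      obtain c where "valid_on N {0, 1, 2} c W" using ham_coloring[OF cs] by blast
      then have "valid_on N {0, 1, 2, 3} c W" unfolding valid_on_def by auto
      then show ?thesis using ham_rooted_coloring[OF cs] unfolding rooted_valid_def by blast
    next
      case False
      have "N x = {}" for x
      proof (rule ccontr)
        assume "N x \<noteq> {}"
        then obtain y where y: "y \<in> N x" by blast
        then have "{x, y} \<subseteq> W" "x \<noteq> y" using N_sub sym irr by blast+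
        then have "2 \<le> card W" using card_mono[OF finite_W, of "{x, y}"] by simp
        then show False using False by simp
      qed
      then have "rooted_valid N W r (\<lambda>_. 0)" for r
        unfolding rooted_valid_def valid_on_def packed_def by auto
      then show ?thesis unfolding rooted_valid_def by blast
    qed
  qed
qed

section \<open>Packing colourings of the subdivision\<close>

lemma outerplanar_outer_graph:
  assumes G: "pair_graph G" and "subcubic G" "outerplanar G"
  shows "outer_graph (pverts G) (nbrs G)"
proof
  interpret pair_graph G by fact
  show "finite (pverts G)" using pair_finite_verts .
  show "nbrs G w \<subseteq> pverts G" for w unfolding nbrs_def using in_arcsD2 by auto
  show "x \<in> nbrs G y" if "y \<in> nbrs G x" for x y
    using that pair_sym_arcs unfolding nbrs_def symmetric_def by (auto dest: symD)
  show "x \<notin> nbrs G x" for x unfolding nbrs_def using pair_no_loops by force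
  show "card (nbrs G x) \<le> 3" for x
  proof (cases "x \<in> pverts G")
    case True
    have "out_arcs (with_proj G) x = Pair x ` nbrs G x"
      unfolding out_arcs_def nbrs_def by auto
    then have "out_degree (with_proj G) x = card (nbrs G x)"
      unfolding out_degree_def by (simp add: card_image inj_on_def)
    then show ?thesis using assms(2) True unfolding subcubic_def by auto
  next
    case False
    then have "nbrs G x = {}" unfolding nbrs_def using in_arcsD1 by auto
    then show ?thesis by simp
  qed
  show "theta_free (nbrs G)" "chords_noncrossing (nbrs G)"
    using outerplanar_theta_free outerplanar_chords_noncrossing G assms(3) by auto
qed

lemma reachable_induced_closed:
  assumes "Digraph_Component.connected (with_proj G \<restriction> U)" and "x \<in> A" "A \<subseteq> U" "y \<in> U"
    and closed: "\<And>v w. v \<in> A \<Longrightarrow> w \<in> U \<Longrightarrow> (v, w) \<in> parcs G \<or> (w, v) \<in> parcs G \<Longrightarrow> w \<in> A"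
  shows "y \<in> A"
proof -
  let ?M = "mk_symmetric (with_proj G \<restriction> U)"
  have "x \<rightarrow>\<^sup>*\<^bsub>?M\<^esub> y"
    using assms(1-4) unfolding Digraph_Component.connected_def by (auto elim!: strongly_connectedE)
  then have "(x, y) \<in> rtrancl_on U (parcs ?M)" unfolding reachable_def by simp
  then show "y \<in> A"
  proof (induction rule: rtrancl_on_induct)
    case base
    show ?case using assms(2) .
  next
    case (step v w)
    then have "(v, w) \<in> parcs G \<or> (w, v) \<in> parcs G" "w \<in> U"
      unfolding parcs_mk_symmetric by auto
    then show ?case using closed step by blast
  qed
qed

text \<open>There are at least three vertices, so one side of a thin cut would have two of them.
  Deleting the end of the crossing edge on this side would separate the rest of the side from the
  other one.\<close>

lemma two_connected_no_thin_cut: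
  assumes G: "outer_graph (pverts G) (nbrs G)" and con: "k_connected 2 G"
  shows "\<not> outer_graph.thin_cut (pverts G) (nbrs G) W1 W2"
proof
  interpret outer_graph "pverts G" "nbrs G" by fact
  have no: False if cut: "thin_cut U1 U2" and "2 \<le> card U1" for U1 U2
  proof -
    have U: "U1 \<union> U2 = pverts G" "U1 \<inter> U2 = {}" "U1 \<noteq> {}" "U2 \<noteq> {}"
      using cut unfolding thin_cut_def by auto
    have one: "a = a' \<and> b = b'"
      if "a \<in> U1" "b \<in> U2" "a' \<in> U1" "b' \<in> U2" "b \<in> nbrs G a" "b' \<in> nbrs G a'" for a b a' b'
      using cut that unfolding thin_cut_def by blast
    \<comment> \<open>The vertex to delete: the end of the crossing edge on this side, or any vertex
      of this side if no edge crosses.\<close>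
    obtain a where a: "a \<in> U1" and sep: "\<And>x y. x \<in> U1 - {a} \<Longrightarrow> y \<in> U2 \<Longrightarrow> y \<notin> nbrs G x"
    proof (cases "\<exists>a\<in>U1. \<exists>b\<in>U2. b \<in> nbrs G a")
      case True
      then obtain a b where "a \<in> U1" "b \<in> U2" "b \<in> nbrs G a" by blast
      then show ?thesis using that[of a] one by blast
    next
      case False
      then show ?thesis using that U(3) by blast
    qed
    have "U1 - {a} \<noteq> {}"
    proof
      assume "U1 - {a} = {}"
      then have "U1 \<subseteq> {a}" by auto
      then show False using card_mono[of "{a}" U1] \<open>2 \<le> card U1\<close> by simp
    qed
    then obtain x where x: "x \<in> U1 - {a}" by blast
    obtain y where y: "y \<in> U2" using U(4) by blast
    have "{a} \<subseteq> pverts G" "card {a} < 2" using a U by auto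
    then have "Digraph_Component.connected (with_proj G \<restriction> (pverts G - {a}))"
      using con unfolding k_connected_def by blast
    then have "y \<in> U1 - {a}"
    proof (rule reachable_induced_closed[OF _ x])
      show "U1 - {a} \<subseteq> pverts G - {a}" "y \<in> pverts G - {a}" using U a y by auto
      fix v w assume vw: "v \<in> U1 - {a}" "w \<in> pverts G - {a}" "(v, w) \<in> parcs G \<or> (w, v) \<in> parcs G"
      then have "w \<in> nbrs G v" using sym[of v w] unfolding nbrs_def by auto
      then show "w \<in> U1 - {a}" using sep[OF vw(1), of w] vw(2) U by auto
    qed
    then show False using y U by auto
  qed
  assume cut: "thin_cut W1 W2"
  then have W: "W1 \<union> W2 = pverts G" "W1 \<inter> W2 = {}" unfolding thin_cut_def by auto
  have "finite W1" "finite W2" using W(1) finite_W by (metis finite_Un)+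
  then have "card W1 + card W2 = card (pverts G)"
    using card_Un_disjoint W by metis
  moreover have "2 < card (pverts G)" using con unfolding k_connected_def by simp
  ultimately have "2 \<le> card W1 \<or> 2 \<le> card W2" by linarith
  then show False using no[OF cut] no[OF thin_cut_commute[OF cut]] by blast
qed

section \<open>Distances in the subdivision\<close>

text \<open>A potential that grows by at most 1 along each arc bounds the length of every walk from
  below. If no walk leads to \<open>y\<close>, the infimum is taken over the empty set and is
  infinite.\<close>

lemma graph_dist_ge:
  fixes \<phi> :: "'b \<Rightarrow> nat"
  assumes "pair_wf_digraph D" and lip: "\<And>x y. (x, y) \<in> parcs D \<Longrightarrow> \<phi> y \<le> Suc (\<phi> x)" and "\<phi> x = 0"
  shows "ereal (real (\<phi> y)) \<le> graph_dist D x y"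
proof -
  interpret pair_wf_digraph D by fact
  have "\<phi> y \<le> \<phi> x + length p" if "set p \<subseteq> parcs D" "pcas x p y" for x p
    using that
  proof (induction p arbitrary: x)
    case (Cons e p)
    then have "\<phi> y \<le> \<phi> (snd e) + length p" "(x, snd e) \<in> parcs D" by auto
    then show ?case using lip[of x "snd e"] by simp
  qed simp
  then have "\<phi> y \<le> length p" if "awalk x p y" for p
    using that assms(3) unfolding awalk_def by fastforce
  moreover have "awalk_cost (\<lambda>_. 1) p = real (length p)" for p
    by (simp add: awalk_cost_def sum_list_triv)
  ultimately show ?thesis
    unfolding graph_dist_def \<mu>_def by (intro INF_greatest) auto
qed

lemma subdivision_wf: "pair_wf_digraph (subdivision_graph G)" if "pair_graph G"
proof -
  show ?thesis
    by unfold_locales (use edges_subset_pverts[OF that, THEN subsetD] in \<open>auto simp: subdivision_graph_def\<close>)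
qed

lemma dist_subdivision_edges:
  assumes "pair_graph G" "e \<noteq> f"
  shows "2 \<le> graph_dist (subdivision_graph G) (Inr e) (Inr f)"
proof -
  define \<phi> :: "'a + 'a set \<Rightarrow> nat" where
    "\<phi> = case_sum (\<lambda>_. 1) (\<lambda>g. if g = e then 0 else 2)"
  have "ereal (real (\<phi> (Inr f))) \<le> graph_dist (subdivision_graph G) (Inr e) (Inr f)"
    by (rule graph_dist_ge[OF subdivision_wf[OF assms(1)]])
      (auto simp: subdivision_graph_def \<phi>_def)
  then show ?thesis using assms(2) by (simp add: \<phi>_def)
qed

text \<open>The potential is the distance in the subdivision from the vertex \<open>u\<close>, cut off at 6.\<close>

lemma dist_subdivision_vertices:
  assumes "pair_graph G" "u \<noteq> v" "v \<notin> nbrs G u"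
  shows "4 \<le> graph_dist (subdivision_graph G) (Inl u) (Inl v)"
    "(\<And>w. u \<in> nbrs G w \<Longrightarrow> v \<notin> nbrs G w) \<Longrightarrow> 6 \<le> graph_dist (subdivision_graph G) (Inl u) (Inl v)"
proof -
  interpret pair_graph G by fact
  define \<phi> :: "'a + 'a set \<Rightarrow> nat" where
    "\<phi> = case_sum
      (\<lambda>w. if w = u then 0 else if w \<in> nbrs G u then 2 else if (\<exists>x. u \<in> nbrs G x \<and> w \<in> nbrs G x) then 4 else 6)
      (\<lambda>e. if u \<in> e then 1 else if e \<inter> nbrs G u \<noteq> {} then 3 else 5)"
  have sym: "x \<in> nbrs G y" if "y \<in> nbrs G x" for x y
    using that pair_sym_arcs unfolding nbrs_def symmetric_def by (auto dest: symD)
  have edge: "w = x \<or> w \<in> nbrs G x" if "e \<in> edges G" "w \<in> e" "x \<in> e" for e w x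
    using that sym unfolding edges_def nbrs_def by fastforce
  have out: "\<phi> (Inr e) \<le> Suc (\<phi> (Inl w))" if "e \<in> edges G" "w \<in> e" for e w
    using that by (auto simp: \<phi>_def)
  have inn: "\<phi> (Inl w) \<le> Suc (\<phi> (Inr e))" if e: "e \<in> edges G" "w \<in> e" for e w
  proof -
    consider "u \<in> e" | "u \<notin> e" "e \<inter> nbrs G u \<noteq> {}" | "u \<notin> e" "e \<inter> nbrs G u = {}" by blast
    then show ?thesis
    proof cases
      case 1
      then show ?thesis using edge[OF e 1] by (auto simp: \<phi>_def)
    next
      case 2
      then obtain x where x: "x \<in> e" "x \<in> nbrs G u" by blast
      then have "w = x \<or> w \<in> nbrs G x" "u \<in> nbrs G x" using edge[OF e x(1)] sym by auto
      then have "\<phi> (Inl w) \<le> 4" using x(2) by (auto simp: \<phi>_def)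
      then show ?thesis using 2 by (simp add: \<phi>_def)
    next
      case 3
      then show ?thesis by (simp add: \<phi>_def)
    qed
  qed
  have *: "ereal (real (\<phi> (Inl v))) \<le> graph_dist (subdivision_graph G) (Inl u) (Inl v)"
  proof (rule graph_dist_ge[OF subdivision_wf[OF assms(1)]])
    fix x y assume "(x, y) \<in> parcs (subdivision_graph G)"
    then show "\<phi> y \<le> Suc (\<phi> x)" using out inn by (auto simp: subdivision_graph_def)
  qed (simp add: \<phi>_def)
  have "4 \<le> \<phi> (Inl v)" using assms(2,3) by (simp add: \<phi>_def)
  then have "(4::ereal) \<le> ereal (real (\<phi> (Inl v)))" by simp
  then show "4 \<le> graph_dist (subdivision_graph G) (Inl u) (Inl v)" using * by (rule order_trans)
  assume "\<And>w. u \<in> nbrs G w \<Longrightarrow> v \<notin> nbrs G w"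
  then have "\<phi> (Inl v) = 6" using assms(2,3) by (auto simp: \<phi>_def)
  then show "6 \<le> graph_dist (subdivision_graph G) (Inl u) (Inl v)" using * by simp
qed

text \<open>Class 0 consists of the subdivision vertices, and colour \<open>j\<close> becomes class
  \<open>j + 1\<close>, which needs distance \<open>j + 3\<close>. This is 3 or 4 for the ordinary
  colours and 5 or 6 for the special ones, while 4 and 6 are available; hence the bound
  \<open>k \<le> 4\<close>.\<close>

lemma packing_chromatic_number_subdivision:
  assumes G: "pair_graph G" and c: "valid_on (nbrs G) {..<k} c (pverts G)" and "k \<le> 4"
  shows "packing_chromatic_number (subdivision_graph G) \<le> Suc k"
proof -
  interpret pair_graph G by fact
  define V :: "nat \<Rightarrow> ('a + 'a set) set" where
    "V = case_nat (Inr ` edges G) (\<lambda>j. Inl ` {v \<in> pverts G. c v = j})"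
  have sym: "x \<in> nbrs G y" if "y \<in> nbrs G x" for x y
    using that pair_sym_arcs unfolding nbrs_def symmetric_def by (auto dest: symD)
  have V: "V 0 = Inr ` edges G" "V (Suc j) = Inl ` {v \<in> pverts G. c v = j}" for j
    by (auto simp: V_def)
  have "packing_coloring [1..<Suc k + 1] (subdivision_graph G) V"
    unfolding packing_coloring_def
  proof (intro conjI allI impI ballI)
    have "c v < k" if "v \<in> pverts G" for v using c that unfolding valid_on_def by auto
    then have "(\<Union>j<k. V (Suc j)) = Inl ` pverts G" unfolding V by auto
    then have "(\<Union>i<Suc k. V i) = Inr ` edges G \<union> Inl ` pverts G"
      by (simp only: lessThan_Suc_eq_insert_0 UN_insert V(1) image_image)
    then show "(\<Union>i<length [1..<Suc k + 1]. V i) = pverts (subdivision_graph G)"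
      by (simp add: subdivision_graph_def Un_commute del: upt_Suc)
    show "disjoint_family_on V {..<length [1..<Suc k + 1]}"
      unfolding disjoint_family_on_def V_def by (auto split: nat.splits)
    fix i x y
    assume i: "i < length [1..<Suc k + 1]" and x: "x \<in> V i" and y: "y \<in> V i" and xy: "x \<noteq> y"
    have S: "real ([1..<Suc k + 1] ! i + 1) = real i + 2" using i by (simp del: upt_Suc)
    show "ereal (real ([1..<Suc k + 1] ! i + 1)) \<le> graph_dist (subdivision_graph G) x y"
      unfolding S
    proof (cases i)
      case 0
      then obtain e f where "x = Inr e" "y = Inr f" "e \<noteq> f" using x y xy by (auto simp: V)
      then show "ereal (real i + 2) \<le> graph_dist (subdivision_graph G) x y"
        using dist_subdivision_edges[OF G] 0 by simp
    next
      case (Suc j)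
      then obtain u v where uv: "x = Inl u" "y = Inl v" "u \<noteq> v" "u \<in> pverts G" "v \<in> pverts G" "c u = j" "c v = j"
        using x y xy by (auto simp: V)
      have "v \<notin> nbrs G u" using c uv unfolding valid_on_def by metis
      note d = dist_subdivision_vertices[OF G uv(3) this]
      show "ereal (real i + 2) \<le> graph_dist (subdivision_graph G) x y"
      proof (cases "j \<le> 1")
        case True
        then have "ereal (real i + 2) \<le> 4" using Suc by simp
        then show ?thesis using d(1) uv by (metis order_trans)
      next
        case False
        have "v \<notin> nbrs G w" if "u \<in> nbrs G w" for w
        proof
          assume "v \<in> nbrs G w"
          have "w \<in> pverts G" using that in_arcsD1 unfolding nbrs_def by auto
          then have "packed c (nbrs G w)" using c unfolding valid_on_def by auto
          moreover have "c u = c v" using uv by simp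
          ultimately have "c u \<in> {0, 1}"
            using \<open>v \<in> nbrs G w\<close> that uv(3) unfolding packed_def by simp
          then show False using False uv(6) by auto
        qed
        then have "6 \<le> graph_dist (subdivision_graph G) x y" using d(2) uv by blast
        moreover have "ereal (real i + 2) \<le> 6" using i assms(3) by (simp del: upt_Suc)
        ultimately show ?thesis by (metis order_trans)
      qed
    qed
  qed
  then show ?thesis
    unfolding packing_chromatic_number_def by (intro Least_le exI)
qed

theorem corollary8:
  fixes G :: "'a pair_pre_digraph" and H :: "'b pair_pre_digraph"
  shows "(pair_graph G \<and> subcubic G \<and> outerplanar G \<longrightarrow>
            packing_chromatic_number (subdivision_graph G) \<le> 5) \<and>
         (pair_graph H \<and> k_connected 2 H \<and> subcubic H \<and> outerplanar H \<longrightarrow>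
            packing_chromatic_number (subdivision_graph H) \<le> 4)"
proof (intro conjI impI)
  assume G: "pair_graph G \<and> subcubic G \<and> outerplanar G"
  then have "outer_graph (pverts G) (nbrs G)" using outerplanar_outer_graph by blast
  then obtain c where "valid_on (nbrs G) {0, 1, 2, 3} c (pverts G)"
    using outer_graph_coloring by blast
  moreover have "{0, 1, 2, 3} = {..<4 :: nat}" by auto
  ultimately show "packing_chromatic_number (subdivision_graph G) \<le> 5"
    using packing_chromatic_number_subdivision[of G 4 c] G by simp
next
  assume H: "pair_graph H \<and> k_connected 2 H \<and> subcubic H \<and> outerplanar H"
  then have o: "outer_graph (pverts H) (nbrs H)" using outerplanar_outer_graph by blast
  then interpret outer_graph "pverts H" "nbrs H" .
  have "2 \<le> card (pverts H)" using H unfolding k_connected_def by simp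
  then obtain cs where "cycle (nbrs H) cs" "set cs = pverts H"
    using ham_exists two_connected_no_thin_cut[OF o] H by blast
  then obtain c where "valid_on (nbrs H) {0, 1, 2} c (pverts H)"
    using ham_coloring by blast
  moreover have "{0, 1, 2} = {..<3 :: nat}" by auto
  ultimately show "packing_chromatic_number (subdivision_graph H) \<le> 4"
    using packing_chromatic_number_subdivision[of H 3 c] H by simp
qed

end
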